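(* Let $F(z)=\sum_{n\ge1}|\mathbf{E}(\mathrm{Tam}_n)|z^n$. Then $F$ is algebraic of degree $4$: it satisfies $Q(F(z),z)=0$, where \[Q(y,z)=z+(-1+3z+z^2)y+(-2+2z+3z^2)y^2+3z^2y^3+z^2y^4.\] Consequently, $|\mathbf{E}(\mathrm{Tam}_n)|\sim\frac{\gamma}{\sqrt\pi}n^{-3/2}\rho^n$, where $\rho\approx2.90511$ is the unique positive real root of $32z^7-32z^6-155z^5-20z^4-148z^3+60z^2-8z-4$ and $\gamma\approx1.04240$ is a root of \[17348952064z^{14}-11927404544z^{12}-6678731520z^{10}-886278144z^8-33824320z^6-516144z^4+4048z^2+11.\]
   Context: $\mathrm{Tam}_n$ (the $n$-th Tamari lattice) is the set of $312$-avoiding permutations of $[n]$ (those with no $i_1<i_2<i_3$ with $w(i_2)<w(i_3)<w(i_1)$), which forms a sublattice of the right weak order on $S_n$ (where $u\le v$ iff every inversion of $u$ is an inversion of $v$). For a finite lattice $L$ and $x\in L$, an Ungar move sends $x$ to $\bigwedge(\{x\}\cup T)$ with $T$ a subset of the elements covered by $x$; it is nontrivial if $T\neq\emptyset$. Recursively, the bottom element $\hat0$ is an Eeta win in $L$, and $x$ is an Eeta win iff no element obtainable from $x$ by a nontrivial Ungar move is an Eeta win (equivalently, in the game on $[\hat0,x]$ starting at $x$ where Atniss then Eeta alternately make nontrivial Ungar moves and the player unable to move loses, Eeta has a winning strategy). $\mathbf{E}(L)$ is the set of Eeta wins in $L$. *)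

theory Defs
  imports
    Complex_Main
    "HOL-Algebra.Lattice"
    "HOL-Combinatorics.Permutations"
    "HOL-Computational_Algebra.Polynomial_FPS"
    "HOL-Library.Landau_Symbols"
begin

subsection \<open>The Ungar game on a finite lattice\<close>

definition lower_covers :: "('a, 'b) gorder_scheme \<Rightarrow> 'a \<Rightarrow> 'a set" where
  "lower_covers L x = {y \<in> carrier L. y \<sqsubset>\<^bsub>L\<^esub> x \<and> \<not> (\<exists>z\<in>carrier L. y \<sqsubset>\<^bsub>L\<^esub> z \<and> z \<sqsubset>\<^bsub>L\<^esub> x)}"

definition nontrivial_Ungar_moves :: "('a, 'b) gorder_scheme \<Rightarrow> 'a \<Rightarrow> 'a set" where
  "nontrivial_Ungar_moves L x =
     {\<Sqinter>\<^bsub>L\<^esub>({x} \<union> T) | T. T \<subseteq> lower_covers L x \<and> T \<noteq> {}}"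

locale finite_lattice = lattice L for L (structure) +
  assumes finite_carrier: "finite (carrier L)"
begin

lemma nontrivial_Ungar_moves_less:
  assumes "x \<in> carrier L" and "y \<in> nontrivial_Ungar_moves L x"
  shows "y \<in> carrier L" and "y \<sqsubset> x"
proof -
  obtain T t where T: "T \<subseteq> lower_covers L x" "t \<in> T" and y: "y = \<Sqinter>({x} \<union> T)"
    using assms(2) unfolding nontrivial_Ungar_moves_def by blast
  have sub: "{x} \<union> T \<subseteq> carrier L"
    using T assms(1) unfolding lower_covers_def by blast
  have "greatest L y (Lower L ({x} \<union> T))"
    unfolding y using sub finite_subset[OF sub finite_carrier]
    by (intro finite_inf_greatest) auto
  hence "y \<in> Lower L ({x} \<union> T)" unfolding greatest_def by blast
  hence yc: "y \<in> carrier L" and "y \<sqsubseteq> t"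
    using T sub unfolding Lower_def by auto
  moreover have "t \<in> carrier L" "t \<sqsubset> x"
    using T unfolding lower_covers_def by auto
  ultimately show "y \<in> carrier L" "y \<sqsubset> x"
    using assms(1) by (auto simp: lless_eq intro: le_trans dest: le_antisym)
qed

text \<open>The bottom element admits no nontrivial move, so it satisfies the recursive condition
  vacuously; the condition on the carrier is what makes the recursion terminate.\<close>

context notes conj_cong [fundef_cong]
begin

function Eeta_win :: "'a \<Rightarrow> bool" where
  "Eeta_win x \<longleftrightarrow> x \<in> carrier L \<and> (\<forall>y\<in>nontrivial_Ungar_moves L x. \<not> Eeta_win y)"
  by auto
termination
proof (relation "measure (\<lambda>x. card {z \<in> carrier L. z \<sqsubset> x})", goal_cases)
  case 1
  show ?case by simp
next
  case (2 x y)
  note y = nontrivial_Ungar_moves_less[OF 2]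
  have "{z \<in> carrier L. z \<sqsubset> y} \<subset> {z \<in> carrier L. z \<sqsubset> x}"
  proof
    show "{z \<in> carrier L. z \<sqsubset> y} \<subseteq> {z \<in> carrier L. z \<sqsubset> x}"
      using y 2(1) by (auto intro: lless_trans)
    show "{z \<in> carrier L. z \<sqsubset> y} \<noteq> {z \<in> carrier L. z \<sqsubset> x}"
      using y by (auto simp: lless_eq)
  qed
  thus ?case
    by (auto intro!: psubset_card_mono simp: finite_carrier)
qed

declare Eeta_win.simps [simp del]

end

definition Eeta_wins :: "'a set" where
  "Eeta_wins = {x \<in> carrier L. Eeta_win x}"

end

subsection \<open>Tamari lattices\<close>

text \<open>Inversions are pairs of values, so that containment of inversion sets is the
  right (rather than the left) weak order.\<close>

definition inversions :: "nat \<Rightarrow> (nat \<Rightarrow> nat) \<Rightarrow> (nat \<times> nat) set" where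
  "inversions n w = {(i, j). 1 \<le> i \<and> i < j \<and> j \<le> n \<and> inv w j < inv w i}"

definition right_weak_order :: "nat \<Rightarrow> (nat \<Rightarrow> nat) gorder" where
  "right_weak_order n =
     \<lparr>carrier = {w. w permutes {1..n}}, eq = (=), le = (\<lambda>u v. inversions n u \<subseteq> inversions n v)\<rparr>"

definition avoids_312 :: "nat \<Rightarrow> (nat \<Rightarrow> nat) \<Rightarrow> bool" where
  "avoids_312 n w \<longleftrightarrow>
     \<not> (\<exists>i\<^sub>1 i\<^sub>2 i\<^sub>3. 1 \<le> i\<^sub>1 \<and> i\<^sub>1 < i\<^sub>2 \<and> i\<^sub>2 < i\<^sub>3 \<and> i\<^sub>3 \<le> n \<and> w i\<^sub>2 < w i\<^sub>3 \<and> w i\<^sub>3 < w i\<^sub>1)"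

definition Tam :: "nat \<Rightarrow> (nat \<Rightarrow> nat) gorder" where
  "Tam n = (right_weak_order n)\<lparr>carrier := {w. w permutes {1..n} \<and> avoids_312 n w}\<rparr>"

lemma carrier_Tam: "carrier (Tam n) = {w. w permutes {1..n} \<and> avoids_312 n w}"
  and le_Tam: "u \<sqsubseteq>\<^bsub>Tam n\<^esub> v \<longleftrightarrow> inversions n u \<subseteq> inversions n v"
  and eq_Tam: "u .=\<^bsub>Tam n\<^esub> v \<longleftrightarrow> u = v"
  by (simp_all add: Tam_def right_weak_order_def)

lemma inversions_trans:
  "(a, b) \<in> inversions n w \<Longrightarrow> (b, c) \<in> inversions n w \<Longrightarrow> (a, c) \<in> inversions n w"
  by (auto simp: inversions_def)

lemma inversions_avoids_312:
  assumes w: "w permutes {1..n}" and av: "avoids_312 n w"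
    and ac: "(a, c) \<in> inversions n w" and ab: "a < b" and bc: "b < c"
  shows "(a, b) \<in> inversions n w"
proof (rule ccontr)
  assume "(a, b) \<notin> inversions n w"
  hence "\<not> inv w b < inv w a"
    using ac ab bc by (auto simp: inversions_def)
  moreover have "inv w a \<noteq> inv w b"
    using ab permutes_inverses(1)[OF w] by (metis less_irrefl)
  ultimately have 1: "inv w a < inv w b" by simp
  have 2: "inv w c < inv w a" and rng: "1 \<le> a" "c \<le> n"
    using ac by (auto simp: inversions_def)
  have "inv w c \<in> {1..n}" "inv w b \<in> {1..n}"
    using permutes_in_image[OF permutes_inv[OF w]] rng ab bc by auto
  moreover have "w (inv w a) = a" "w (inv w b) = b" "w (inv w c) = c"
    using permutes_inverses(1)[OF w] by auto
  ultimately show False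
    using av 1 2 ab bc unfolding avoids_312_def by (metis atLeastAtMost_iff)
qed

lemma inversions_inject:
  assumes u: "u permutes {1..n}" and v: "v permutes {1..n}"
    and eq: "inversions n u = inversions n v"
  shows "u = v"
proof -
  have pos: "inv w a = card {b \<in> {1..n}. inv w b \<le> inv w a}"
    if w: "w permutes {1..n}" and a: "a \<in> {1..n}" for w a
  proof -
    have iw: "inv w permutes {1..n}" using w by (rule permutes_inv)
    have "inv w ` {b \<in> {1..n}. inv w b \<le> inv w a} = {1..inv w a}"
    proof (intro equalityI subsetI)
      fix x assume "x \<in> inv w ` {b \<in> {1..n}. inv w b \<le> inv w a}"
      thus "x \<in> {1..inv w a}" using permutes_in_image[OF iw] by force
    next
      fix x assume x: "x \<in> {1..inv w a}"
      moreover have "inv w a \<in> {1..n}" using a permutes_in_image[OF iw] by blast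
      ultimately have "w x \<in> {1..n}" using permutes_in_image[OF w] by auto
      moreover have "inv w (w x) = x" using permutes_inverses(2)[OF w] .
      ultimately show "x \<in> inv w ` {b \<in> {1..n}. inv w b \<le> inv w a}"
        using x by (auto intro!: image_eqI[of x "inv w" "w x"])
    qed
    moreover have "inj_on (inv w) {b \<in> {1..n}. inv w b \<le> inv w a}"
      using permutes_inj[OF iw] by (rule inj_on_subset) simp
    ultimately show ?thesis by (metis card_image card_atLeastAtMost diff_Suc_1)
  qed
  have le_iff: "inv w b \<le> inv w a \<longleftrightarrow>
      a = b \<or> b < a \<and> (b, a) \<notin> inversions n w \<or> a < b \<and> (a, b) \<in> inversions n w"
    if w: "w permutes {1..n}" and "a \<in> {1..n}" "b \<in> {1..n}" for w a b
  proof -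
    have "inv w a = inv w b \<longleftrightarrow> a = b"
      using permutes_inj[OF permutes_inv[OF w]] by (auto dest: injD)
    thus ?thesis using that by (auto simp: inversions_def not_le not_less)
  qed
  have "inv u = inv v"
  proof
    fix a show "inv u a = inv v a"
    proof (cases "a \<in> {1..n}")
      case True
      have "{b \<in> {1..n}. inv u b \<le> inv u a} = {b \<in> {1..n}. inv v b \<le> inv v a}"
        using le_iff[OF u True] le_iff[OF v True] eq by blast
      thus ?thesis using pos[OF u True] pos[OF v True] by simp
    next
      case False
      thus ?thesis
        using permutes_not_in[OF permutes_inv[OF u]] permutes_not_in[OF permutes_inv[OF v]] by simp
    qed
  qed
  thus ?thesis using permutes_inv_inv[OF u] permutes_inv_inv[OF v] by metis
qed

lemma ex_Tam_inversions:
  assumes dom: "\<And>a b. (a, b) \<in> I \<Longrightarrow> 1 \<le> a \<and> a < b \<and> b \<le> n"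
    and tr: "\<And>a b c. (a, b) \<in> I \<Longrightarrow> (b, c) \<in> I \<Longrightarrow> (a, c) \<in> I"
    and dn: "\<And>a b c. (a, c) \<in> I \<Longrightarrow> a < b \<Longrightarrow> b < c \<Longrightarrow> (a, b) \<in> I"
  shows "\<exists>w. w permutes {1..n} \<and> avoids_312 n w \<and> inversions n w = I"
proof -
  define le where "le a b \<longleftrightarrow> a = b \<or> a < b \<and> (a, b) \<notin> I \<or> b < a \<and> (b, a) \<in> I" for a b
  have le_trans: "le a c" if "le a b" "le b c" for a b c
    using that tr dn dom unfolding le_def
    by (smt (verit, best) linorder_neqE_nat order.strict_trans)
  have le_antisym: "a = b" if "le a b" "le b a" for a b
    using that unfolding le_def by auto
  have le_total: "le a b \<or> le b a" for a b
    unfolding le_def by auto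
  define pos where "pos a = (if a \<in> {1..n} then card {b \<in> {1..n}. le b a} else a)" for a
  have pos_less: "pos a < pos b" if "le a b" "a \<noteq> b" "a \<in> {1..n}" "b \<in> {1..n}" for a b
  proof -
    have "{c \<in> {1..n}. le c a} \<subseteq> {c \<in> {1..n}. le c b}"
      using that le_trans by blast
    moreover have "b \<in> {c \<in> {1..n}. le c b}" "b \<notin> {c \<in> {1..n}. le c a}"
      using that le_antisym by (auto simp: le_def[of b b])
    ultimately have "{c \<in> {1..n}. le c a} \<subset> {c \<in> {1..n}. le c b}" by blast
    thus ?thesis using that by (auto simp: pos_def intro!: psubset_card_mono)
  qed
  have inj: "inj_on pos {1..n}"
    using pos_less le_total by (intro inj_onI) (metis less_irrefl)
  have "pos a \<in> {1..n}" if a: "a \<in> {1..n}" for a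
  proof -
    have "card {b \<in> {1..n}. le b a} \<le> card {1..n}" by (intro card_mono) auto
    moreover have "a \<in> {b \<in> {1..n}. le b a}" using a by (simp add: le_def)
    hence "0 < card {b \<in> {1..n}. le b a}" by (subst card_gt_0_iff) auto
    ultimately show ?thesis using a by (simp add: pos_def)
  qed
  hence "pos ` {1..n} = {1..n}" using inj by (intro endo_inj_surj) auto
  hence perm: "pos permutes {1..n}"
    using inj by (intro bij_imp_permutes) (auto simp: bij_betw_def pos_def)
  define w where "w = inv pos"
  have w: "w permutes {1..n}" unfolding w_def using perm by (rule permutes_inv)
  have iw: "inv w = pos" unfolding w_def using perm by (rule permutes_inv_inv)
  have I: "inversions n w = I"
  proof -
    have "pos j < pos i \<longleftrightarrow> (i, j) \<in> I" if "1 \<le> i" "i < j" "j \<le> n" for i j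
      using that pos_less[of i j] pos_less[of j i] by (cases "(i, j) \<in> I") (auto simp: le_def)
    thus ?thesis using dom by (auto simp: inversions_def iw)
  qed
  have "avoids_312 n w"
    unfolding avoids_312_def
  proof (intro notI, elim exE conjE)
    fix i j k assume ijk: "1 \<le> i" "i < j" "j < k" "k \<le> n" "w j < w k" "w k < w i"
    have rng: "w i \<in> {1..n}" "w j \<in> {1..n}"
      by (simp_all only: permutes_in_image[OF w]) (use ijk in auto)
    have iv: "inv w (w x) = x" for x using permutes_inverses(2)[OF w] .
    have "(w j, w i) \<in> I"
      unfolding I[symmetric] using ijk rng by (auto simp: inversions_def iv)
    hence "(w j, w k) \<in> I" using dn ijk by blast
    thus False unfolding I[symmetric] using ijk by (auto simp: inversions_def iv)
  qed
  thus ?thesis using w I by blast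
qed

lemma finite_lattice_Tam: "finite_lattice (Tam n)"
proof -
  have ex_Inter: "\<exists>w\<in>carrier (Tam n). inversions n w =
      {(a, b). 1 \<le> a \<and> a < b \<and> b \<le> n \<and> (\<forall>x\<in>A. (a, b) \<in> inversions n x)}"
    if A: "A \<subseteq> carrier (Tam n)" for A
  proof -
    let ?I = "{(a, b). 1 \<le> a \<and> a < b \<and> b \<le> n \<and> (\<forall>x\<in>A. (a, b) \<in> inversions n x)}"
    have "\<exists>w. w permutes {1..n} \<and> avoids_312 n w \<and> inversions n w = ?I"
    proof (rule ex_Tam_inversions)
      fix a b c assume "(a, b) \<in> ?I" "(b, c) \<in> ?I"
      thus "(a, c) \<in> ?I" using inversions_trans[of a b n _ c] by auto
    next
      fix a b c assume "(a, c) \<in> ?I" "a < b" "b < c"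
      thus "(a, b) \<in> ?I"
        using A inversions_avoids_312[of _ n a c b] by (auto simp: carrier_Tam subset_iff)
    qed auto
    thus ?thesis by (auto simp: carrier_Tam)
  qed
  have rng: "(a, b) \<in> inversions n w \<Longrightarrow> 1 \<le> a \<and> a < b \<and> b \<le> n" for a b w
    by (auto simp: inversions_def)
  interpret partial_order "Tam n"
  proof (unfold_locales, goal_cases)
    case (5 x y)
    thus ?case using inversions_inject by (auto simp: carrier_Tam le_Tam eq_Tam)
  qed (auto simp: le_Tam eq_Tam, simp_all add: fun_eq_iff eq_Tam)
  show ?thesis
  proof (unfold_locales, goal_cases)
    case (1 x y)
    let ?A = "Upper (Tam n) {x, y}"
    have "?A \<subseteq> carrier (Tam n)" by (auto simp: Upper_def)
    from ex_Inter[OF this] obtain w where w: "w \<in> carrier (Tam n)"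
      "inversions n w = {(a, b). 1 \<le> a \<and> a < b \<and> b \<le> n \<and> (\<forall>x\<in>?A. (a, b) \<in> inversions n x)}"
      by blast
    have "least (Tam n) w ?A"
      unfolding least_def using w 1 rng by (auto simp: Upper_def le_Tam)
    thus ?case by (rule exI[of _ w])
  next
    case (2 x y)
    hence "{x, y} \<subseteq> carrier (Tam n)" by auto
    from ex_Inter[OF this] obtain w where w: "w \<in> carrier (Tam n)"
      "inversions n w = {(a, b). 1 \<le> a \<and> a < b \<and> b \<le> n \<and> (\<forall>x\<in>{x, y}. (a, b) \<in> inversions n x)}"
      by blast
    have "greatest (Tam n) w (Lower (Tam n) {x, y})"
      unfolding greatest_def using w 2 rng by (auto simp: Lower_def le_Tam)
    thus ?case by (rule exI[of _ w])
  next
    case 3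
    show ?case
      by (rule finite_subset[OF _ finite_permutations[of "{1..n}"]]) (auto simp: carrier_Tam)
  qed
qed

subsection \<open>Algebraic power series\<close>

text \<open>A polynomial in \<open>y\<close> whose coefficients are polynomials in \<open>z\<close>, evaluated at \<open>y = f(z)\<close>.\<close>

definition annihilates :: "'a::field poly poly \<Rightarrow> 'a fps \<Rightarrow> bool" where
  "annihilates P f \<longleftrightarrow> poly (map_poly fps_of_poly P) f = 0"

text \<open>The degree of \<open>f\<close> over the field of rational functions in \<open>z\<close>, denominators having been
  cleared.\<close>

definition algebraic_of_degree :: "'a::field fps \<Rightarrow> nat \<Rightarrow> bool" where
  "algebraic_of_degree f d \<longleftrightarrow>
     (\<exists>P. P \<noteq> 0 \<and> annihilates P f \<and> degree P = d) \<and>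
     (\<forall>P. P \<noteq> 0 \<and> annihilates P f \<longrightarrow> d \<le> degree P)"

definition Eeta_Tam_gf :: "complex fps" where
  "Eeta_Tam_gf = Abs_fps (\<lambda>n. if n = 0 then 0 else of_nat (card (finite_lattice.Eeta_wins (Tam n))))"

definition Q_poly :: "complex poly poly" where
  "Q_poly = [: [:0, 1:], [:-1, 3, 1:], [:-2, 2, 3:], [:0, 0, 3:], [:0, 0, 1:] :]"

end

theory Submission
  imports Defs "HOL-Complex_Analysis.Complex_Analysis" "HOL-Real_Asymp.Real_Asymp"
    "HOL-Computational_Algebra.Polynomial_Factorial"
begin

unbundle no vec_syntax
unbundle fps_syntax

text \<open>An element of the Tamari lattice is a plane forest, and an Ungar move cuts off the last child at
  each node of a chosen set of inner nodes. The trees of a forest play independently, so a forest is a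
  win for Eeta iff all its trees are. A tree is a win iff its root is a leaf or has an even number of
  children, all but the last one winning trees and the last one with only winning trees below its
  root. Hence the generating function \<open>C\<close> of the winning trees satisfies \<open>C = z + z\<^sup>2 K(C)\<close> with
  \<open>K(c) = c / ((1 - c)\<^sup>2 (1 + c))\<close>, and \<open>F = C / (1 - C)\<close>.

  The polynomial \<open>Q(y, z)\<close> is quadratic in \<open>z\<close>, primitive, and its discriminant
  \<open>(1 + y)\<^sup>2 (1 + 2y) (1 + 2y + 4y\<^sup>2 + 4y\<^sup>3)\<close> is not a square. So it is, up to constants, the
  minimal polynomial of the compositional inverse of \<open>F\<close>, and every relation for \<open>F\<close> is a multiple of it.

  For the asymptotics, positivity of the equation for \<open>C\<close> bounds its partial sums at the critical point
  \<open>r = 1 / \<rho>\<close> by \<open>\<kappa> = C(r)\<close>. Near \<open>r\<close> the series is a holomorphic function of \<open>\<surd>(1 - z / r)\<close>, and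
  elsewhere on the circle \<open>|z\<^sup>2 K'(C(z))|\<close> stays below 1. Subtracting the terms of the expansion at \<open>r\<close>
  up to order 3 leaves a function with bounded second derivative, whose coefficients are
  \<open>O(n\<^sup>-\<^sup>2 r\<^sup>-\<^sup>n)\<close> by Cauchy's inequality.\<close>

subsection \<open>Winning forests\<close>

text \<open>The wins are found by a kernel argument: a set of forests that no nontrivial move
  connects internally, and that every other forest enters by some move, must be the set of Eeta wins
  because the game terminates. Neither half survives an induction on its own; each is strengthened
  by a statement about the parity of a list of children. The asymptotics use no continuation beyond
  the disc |z| < r. A bounded second derivative inside it gives coefficients of order n^-2 r^-n,
  already smaller than the main term n^(-3/2) r^-n. This is why the expansion must include exponent
  3/2: the second derivative of (1 - z/r)^(3/2) is unbounded, while what remains is (1 - z/r)^2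
  times a holomorphic function of the square root. To place C(z) on the right branch near r one
  needs C(z) to tend to \<kappa> first. This comes from an algebraic identity with a double root at
  \<kappa> whose cofactor does not vanish on the whole disc |c| \<le> \<kappa>. All constants are
  functions of one root of \<open>critical_poly\<close>; the long polynomial identities are
  divisions by it with explicit quotients.\<close>

datatype tree = Node (children: "tree list")

fun nodes :: "tree list \<Rightarrow> nat" where
  "nodes [] = 0"
| "nodes (Node \<psi> # \<phi>) = Suc (nodes \<psi> + nodes \<phi>)"

lemma nodes_append [simp]: "nodes (\<phi> @ \<psi>) = nodes \<phi> + nodes \<psi>"
  by (induction \<phi> rule: nodes.induct) auto

lemma nodes_eq_0_iff [simp]: "nodes \<phi> = 0 \<longleftrightarrow> \<phi> = []"
  by (cases \<phi> rule: nodes.cases) auto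

lemma nodes_pos_iff [simp]: "0 < nodes \<phi> \<longleftrightarrow> \<phi> \<noteq> []"
  by (metis nodes_eq_0_iff neq0_conv)

lemma nodes_single: "nodes [t] = Suc (nodes (children t))"
  by (cases t) auto

lemma nodes_single_le: "t \<in> set \<phi> \<Longrightarrow> nodes [t] \<le> nodes \<phi>"
  by (induction \<phi>) (auto simp: nodes_single,
     (metis nodes_append nodes_single append_Cons append_Nil le_add2 le_trans le_add1)+)

context notes conj_cong [fundef_cong]
begin

text \<open>The conjunct \<open>\<phi> \<noteq> []\<close> is handed by \<open>conj_cong\<close> to
  the termination goals, where \<open>last \<phi>\<close> has to be a member of
  \<open>\<phi>\<close>.\<close>

function win :: "tree \<Rightarrow> bool" where
  "win (Node \<phi>) \<longleftrightarrow> \<phi> = [] \<or> (\<phi> \<noteq> [] \<and> even (length \<phi>) \<and>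
     (\<forall>t\<in>set (butlast \<phi>). win t) \<and> (\<forall>t\<in>set (children (last \<phi>)). win t))"
  by (pat_completeness) auto
termination
proof (relation "Wellfounded.measure (\<lambda>t. nodes [t])", goal_cases)
  case (2 \<phi> t)
  thus ?case using nodes_single_le[of t \<phi>] by (auto dest: in_set_butlastD)
next
  case (3 \<phi> t)
  thus ?case using nodes_single_le[of t "children (last \<phi>)"] nodes_single_le[of "last \<phi>" \<phi>]
    by (auto simp: nodes_single)
qed auto

declare win.simps [simp del]

end

abbreviation wins :: "tree list \<Rightarrow> bool" where
  "wins \<phi> \<equiv> \<forall>t\<in>set \<phi>. win t"

text \<open>What winning demands of the children of an inner node, apart from their parity; the
  inductions have to track the two separately. On the empty list the value rests on the unspecified
  \<open>last []\<close>, hence the nonemptiness conditions below.\<close>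

definition tail_wins :: "tree list \<Rightarrow> bool" where
  "tail_wins \<phi> \<longleftrightarrow> wins (butlast \<phi>) \<and> wins (children (last \<phi>))"

lemma tail_wins_snoc [simp]: "tail_wins (\<phi> @ [Node \<psi>]) \<longleftrightarrow> wins \<phi> \<and> wins \<psi>"
  by (simp add: tail_wins_def)

lemma tail_wins_single [simp]: "tail_wins [Node \<psi>] \<longleftrightarrow> wins \<psi>"
  by (simp add: tail_wins_def)

lemma tail_wins_append: "\<psi> \<noteq> [] \<Longrightarrow> tail_wins (\<phi> @ \<psi>) \<longleftrightarrow> wins \<phi> \<and> tail_wins \<psi>"
  by (auto simp: tail_wins_def butlast_append)

lemma tail_wins_Cons: "\<psi> \<noteq> [] \<Longrightarrow> tail_wins (t # \<psi>) \<longleftrightarrow> win t \<and> tail_wins \<psi>"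
  using tail_wins_append[of \<psi> "[t]"] by auto

lemma win_Node: "win (Node \<phi>) \<longleftrightarrow> \<phi> = [] \<or> (even (length \<phi>) \<and> tail_wins \<phi>)"
  by (auto simp: tail_wins_def win.simps[of \<phi>])

text \<open>A forest with \<open>n\<close> nodes, numbered in preorder, stands for the element of the Tamari lattice in
  which \<open>(i, j)\<close> is an inversion iff \<open>j\<close> is a proper descendant of \<open>i\<close>. An Ungar move (trivial ones
  included) chooses a set of inner nodes and, at each of them, cuts off the last child, which becomes
  the next sibling.\<close>

inductive mv :: "tree list \<Rightarrow> tree list \<Rightarrow> bool" where
  Nil: "mv [] []"
| keep: "mv \<psi> \<psi>' \<Longrightarrow> mv \<phi> \<phi>' \<Longrightarrow> mv (Node \<psi> # \<phi>) (Node \<psi>' # \<phi>')"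
| cut: "mv \<psi> \<psi>' \<Longrightarrow> mv [t] \<tau> \<Longrightarrow> mv \<phi> \<phi>' \<Longrightarrow> mv (Node (\<psi> @ [t]) # \<phi>) (Node \<psi>' # \<tau> @ \<phi>')"

inductive_simps mv_Nil_iff [simp]: "mv [] \<phi>"

lemma mv_ConsE:
  assumes "mv (t # \<phi>) \<chi>"
  obtains (keep) \<psi> \<psi>' \<phi>' where "t = Node \<psi>" "\<chi> = Node \<psi>' # \<phi>'" "mv \<psi> \<psi>'" "mv \<phi> \<phi>'"
  | (cut) \<psi> \<psi>' c \<tau> \<phi>' where "t = Node (\<psi> @ [c])" "\<chi> = Node \<psi>' # \<tau> @ \<phi>'"
      "mv \<psi> \<psi>'" "mv [c] \<tau>" "mv \<phi> \<phi>'"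
  using assms
proof cases
  case (keep \<psi> \<psi>' \<phi>')
  thus ?thesis using that(1) by blast
next
  case (cut \<psi> \<psi>' c \<tau> \<phi>')
  thus ?thesis using that(2) by blast
qed

lemma mv_refl: "mv \<phi> \<phi>"
  by (induction \<phi> rule: nodes.induct) (auto intro: mv.intros)

lemma mv_nodes: "mv \<phi> \<phi>' \<Longrightarrow> nodes \<phi>' = nodes \<phi>"
  by (induction rule: mv.induct) auto

lemma mv_nonempty: "mv \<phi> \<phi>' \<Longrightarrow> \<phi>' = [] \<longleftrightarrow> \<phi> = []"
  by (induction rule: mv.induct) auto

lemma mv_append: "mv \<phi> \<phi>' \<Longrightarrow> mv \<psi> \<psi>' \<Longrightarrow> mv (\<phi> @ \<psi>) (\<phi>' @ \<psi>')"
proof (induction rule: mv.induct)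
  case (cut \<psi>1 \<psi>1' t \<tau> \<phi> \<phi>')
  thus ?case using mv.cut[of \<psi>1 \<psi>1' t \<tau> "\<phi> @ \<psi>" "\<phi>' @ \<psi>'"] by simp
qed (auto intro: mv.intros)

lemma mv_appendE:
  assumes "mv (\<phi> @ \<psi>) \<chi>"
  obtains \<phi>' \<psi>' where "\<chi> = \<phi>' @ \<psi>'" "mv \<phi> \<phi>'" "mv \<psi> \<psi>'"
proof -
  have "\<exists>\<phi>' \<psi>'. \<chi> = \<phi>' @ \<psi>' \<and> mv \<phi> \<phi>' \<and> mv \<psi> \<psi>'"
    using assms
  proof (induction \<phi> arbitrary: \<chi>)
    case (Cons t \<phi>)
    from Cons.prems have "mv (t # (\<phi> @ \<psi>)) \<chi>" by simp
    thus ?case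
    proof (cases rule: mv_ConsE)
      case (keep \<omega> \<omega>' \<xi>)
      with Cons.IH obtain \<phi>' \<psi>' where "\<xi> = \<phi>' @ \<psi>'" "mv \<phi> \<phi>'" "mv \<psi> \<psi>'" by blast
      thus ?thesis using keep by (intro exI[of _ "Node \<omega>' # \<phi>'"] exI[of _ \<psi>']) (auto intro: mv.intros)
    next
      case (cut \<omega> \<omega>' c \<tau> \<xi>)
      with Cons.IH obtain \<phi>' \<psi>' where "\<xi> = \<phi>' @ \<psi>'" "mv \<phi> \<phi>'" "mv \<psi> \<psi>'" by blast
      thus ?thesis using cut
        by (intro exI[of _ "Node \<omega>' # \<tau> @ \<phi>'"] exI[of _ \<psi>']) (auto intro: mv.intros)
    qed
  qed auto
  thus ?thesis using that by blast
qed

lemma mv_singleE: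
  assumes "mv [Node \<phi>] \<chi>"
  obtains (keep) \<phi>' where "\<chi> = [Node \<phi>']" "mv \<phi> \<phi>'"
  | (cut) \<psi> t \<psi>' \<tau> where "\<phi> = \<psi> @ [t]" "\<chi> = Node \<psi>' # \<tau>" "mv \<psi> \<psi>'" "mv [t] \<tau>"
  using assms
proof (cases rule: mv_ConsE)
  case (keep \<psi> \<psi>' \<phi>')
  thus ?thesis using that(1) by simp
next
  case (cut \<psi> \<psi>' c \<tau> \<phi>')
  thus ?thesis using that(2) by simp
qed

lemma mv_single_keep: "mv \<phi> \<phi>' \<Longrightarrow> mv [Node \<phi>] [Node \<phi>']"
  by (intro mv.keep) auto

lemma mv_single_cut: "mv \<psi> \<psi>' \<Longrightarrow> mv [t] \<tau> \<Longrightarrow> mv [Node (\<psi> @ [t])] (Node \<psi>' # \<tau>)"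
  using mv.cut[of \<psi> \<psi>' t \<tau> "[]" "[]"] by simp

text \<open>The parity clause is the strengthening that carries the induction through the case where
  the last child of the root is itself cut.\<close>

lemma wins_mv_rigid_aux:
  "wins \<phi> \<Longrightarrow> mv \<phi> \<phi>' \<Longrightarrow> (wins \<phi>' \<longrightarrow> \<phi>' = \<phi>) \<and>
     (odd (length \<phi>) \<longrightarrow> \<not> (even (length \<phi>') \<and> tail_wins \<phi>'))"
proof (induction "nodes \<phi>" arbitrary: \<phi> \<phi>' rule: less_induct)
  case less
  note IH1 = less.hyps[THEN conjunct1, THEN mp] and IH2 = less.hyps[THEN conjunct2, THEN mp]
  show ?case
  proof (cases \<phi> rule: rev_cases)
    case Nil
    thus ?thesis using less.prems by auto
  next
    case (snoc \<phi>0 t)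
    obtain \<phi>0' \<tau> where \<phi>': "\<phi>' = \<phi>0' @ \<tau>" "mv \<phi>0 \<phi>0'" "mv [t] \<tau>"
      using mv_appendE[of \<phi>0 "[t]" \<phi>'] less.prems(2) snoc by blast
    have \<tau>: "\<tau> \<noteq> []" using \<phi>' mv_nonempty by blast
    show ?thesis
    proof (cases "\<phi>0 = []")
      case False
      have lt: "nodes \<phi>0 < nodes \<phi>" "nodes [t] < nodes \<phi>"
        using False snoc by (auto simp: nodes_single)
      have 1: "\<phi>0' = \<phi>0" if "wins \<phi>0'"
        using IH1[OF lt(1)] \<phi>' less.prems snoc that by auto
      have 2: "\<tau> = [t]" if "wins \<tau>"
        using IH1[OF lt(2)] \<phi>' less.prems snoc that by auto
      have 3: "\<not> (even (length \<tau>) \<and> tail_wins \<tau>)"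
        using IH2[OF lt(2)] \<phi>' less.prems snoc by auto
      \<comment> \<open>Parity clause: if \<open>\<phi>'\<close> is tail-winning, then fact 1 gives
        \<open>\<phi>0' = \<phi>0\<close>, which has even length, so \<open>\<tau>\<close> would be
        even and tail-winning, against fact 3.\<close>
      show ?thesis
        using 1 2 3 \<phi>' snoc \<tau> by (auto simp: tail_wins_append)
    next
      case True
      obtain \<chi> where t: "t = Node \<chi>" by (cases t)
      have \<phi>: "\<phi> = [Node \<chi>]" and mv\<chi>: "mv [Node \<chi>] \<phi>'" and win\<chi>: "win (Node \<chi>)"
        using snoc True t less.prems by auto
      show ?thesis
      proof (cases \<chi> rule: rev_cases)
        case Nil
        from mv\<chi> show ?thesis using Nil \<phi> by (cases rule: mv_singleE) auto
      next
        case (snoc \<psi> d)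
        obtain \<omega> where d: "d = Node \<omega>" by (cases d)
        have \<psi>: "wins \<psi>" "odd (length \<psi>)" and \<omega>: "wins \<omega>"
          using win\<chi> snoc d by (auto simp: win_Node)
        have lt: "nodes \<psi> < nodes \<phi>" "nodes \<omega> < nodes \<phi>"
          using \<phi> snoc d by auto
        \<comment> \<open>The root of a winning inner tree cannot be cut profitably: an odd list of
          wins never moves to the children of a winning tree.\<close>
        have no_cut: "\<not> win (Node \<psi>')" if "mv \<psi> \<psi>'" for \<psi>'
          using IH2[OF lt(1) \<psi>(1) that \<psi>(2)] \<psi>(2) mv_nonempty[OF that]
          by (auto simp: win_Node)
        from mv\<chi> show ?thesis
        proof (cases rule: mv_singleE)
          case (cut \<psi>0 t0 \<psi>' \<tau>)
          hence "\<not> win (Node \<psi>')" using no_cut snoc by auto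
          moreover have "\<tau> \<noteq> []" using cut mv_nonempty by blast
          ultimately show ?thesis using cut by (auto simp: tail_wins_Cons)
        next
          case (keep \<chi>')
          obtain \<psi>' \<tau> where \<chi>': "\<chi>' = \<psi>' @ \<tau>" "mv \<psi> \<psi>'" "mv [Node \<omega>] \<tau>"
            using mv_appendE[of \<psi> "[d]" \<chi>'] keep(2) snoc d by blast
          have \<tau>: "\<tau> \<noteq> []" using \<chi>' mv_nonempty by blast
          have "\<chi>' = \<chi>" if win: "win (Node \<chi>')"
          proof -
            have ev: "even (length \<chi>')" and "wins \<psi>'" and tl: "tail_wins \<tau>"
              using win \<chi>' \<tau> by (auto simp: win_Node tail_wins_append)
            hence eq: "\<psi>' = \<psi>" using IH1[OF lt(1) \<psi>(1) \<chi>'(2)] by blast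
            from \<chi>'(3) show ?thesis
            proof (cases rule: mv_singleE)
              case (keep \<omega>')
              hence "\<omega>' = \<omega>" using tl IH1[OF lt(2) \<omega>] by auto
              thus ?thesis using keep \<chi>' eq snoc d by simp
            next
              \<comment> \<open>The parity clause is spent here. As \<open>\<psi>' = \<psi>\<close>
                is odd, \<open>\<tau>\<close> is odd, so \<open>\<tau>'\<close> is even and
                tail-winning, which no move from the single winning tree \<open>e\<close> can
                produce.\<close>
              case (cut \<omega>0 e \<omega>0' \<tau>')
              have "\<tau>' \<noteq> []" using cut mv_nonempty by blast
              hence "even (length \<tau>')" "tail_wins \<tau>'"
                using cut tl ev \<chi>' eq \<psi> by (auto simp: tail_wins_Cons)
              moreover have "nodes [e] < nodes \<phi>" "wins [e]"
                using lt(2) \<omega> cut by (auto)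
              ultimately show ?thesis using IH2[of "[e]" \<tau>'] cut by auto
            qed
          qed
          thus ?thesis using keep \<phi> by auto
        qed
      qed
    qed
  qed
qed

lemma wins_mv_rigid: "wins \<phi> \<Longrightarrow> mv \<phi> \<phi>' \<Longrightarrow> wins \<phi>' \<Longrightarrow> \<phi>' = \<phi>"
  using wins_mv_rigid_aux by blast

text \<open>A root with children \<open>\<psi> @ [d]\<close> has two ways to become winning: cut
  \<open>d\<close> and let \<open>Node \<psi>'\<close> win, or keep \<open>d\<close> beside an odd
  winning \<open>\<psi>'\<close>. The second conjunct guarantees that for every list of children one
  of them is available.\<close>

lemma ex_mv_wins_aux:
  "(\<exists>\<phi>'. mv \<phi> \<phi>' \<and> wins \<phi>') \<and>
   ((\<exists>\<phi>'. mv \<phi> \<phi>' \<and> win (Node \<phi>')) \<or> (\<exists>\<phi>'. mv \<phi> \<phi>' \<and> odd (length \<phi>') \<and> wins \<phi>'))"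
proof (induction "nodes \<phi>" arbitrary: \<phi> rule: less_induct)
  case less
  note IH1 = less.hyps[THEN conjunct1] and IH2 = less.hyps[THEN conjunct2]
  show ?case
  proof (cases \<phi> rule: rev_cases)
    case Nil
    thus ?thesis by (auto simp: win_Node)
  next
    case (snoc \<phi>0 t)
    obtain \<chi> where t: "t = Node \<chi>" by (cases t)
    show ?thesis
    proof (cases "\<phi>0 = []")
      case False
      have lt: "nodes \<phi>0 < nodes \<phi>" "nodes [t] < nodes \<phi>" "nodes \<chi> < nodes \<phi>"
        using False snoc t by auto
      obtain \<phi>0' where \<phi>0': "mv \<phi>0 \<phi>0'" "wins \<phi>0'" using IH1[OF lt(1)] by blast
      obtain \<tau> where \<tau>: "mv [t] \<tau>" "wins \<tau>" using IH1[OF lt(2)] by blast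
      obtain \<chi>' where \<chi>': "mv \<chi> \<chi>'" "wins \<chi>'" using IH1[OF lt(3)] by blast
      have app: "mv \<phi> (\<phi>0' @ \<xi>)" if "mv [t] \<xi>" for \<xi>
        using mv_append[OF \<phi>0'(1) that] snoc by simp
      have "(\<exists>\<phi>'. mv \<phi> \<phi>' \<and> win (Node \<phi>')) \<or> (\<exists>\<phi>'. mv \<phi> \<phi>' \<and> odd (length \<phi>') \<and> wins \<phi>')"
      \<comment> \<open>An odd \<open>\<phi>0'\<close> only needs a last child with wins below it.
        An even one does not change parities, so the alternative for \<open>[t]\<close> carries
        over.\<close>
      proof (cases "odd (length \<phi>0')")
        case True
        have "win (Node (\<phi>0' @ [Node \<chi>']))" using True \<phi>0' \<chi>' by (auto simp: win_Node)
        thus ?thesis using app[of "[Node \<chi>']"] mv_single_keep[OF \<chi>'(1)] t by blast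
      next
        case even: False
        consider \<xi> where "mv [t] \<xi>" "win (Node \<xi>)" | \<xi> where "mv [t] \<xi>" "odd (length \<xi>)" "wins \<xi>"
          using IH2[OF lt(2)] by blast
        thus ?thesis
        proof cases
          case 1
          hence "\<xi> \<noteq> []" using mv_nonempty by blast
          hence "win (Node (\<phi>0' @ \<xi>))" using 1 even \<phi>0' by (auto simp: win_Node tail_wins_append)
          thus ?thesis using app[OF 1(1)] by blast
        next
          case 2
          hence "odd (length (\<phi>0' @ \<xi>))" "wins (\<phi>0' @ \<xi>)" using even \<phi>0' by auto
          thus ?thesis using app[OF 2(1)] by blast
        qed
      qed
      moreover have "\<exists>\<phi>'. mv \<phi> \<phi>' \<and> wins \<phi>'"
        using app[OF \<tau>(1)] \<tau>(2) \<phi>0'(2) by (intro exI[of _ "\<phi>0' @ \<tau>"]) auto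
      ultimately show ?thesis by blast
    next
      case True
      have \<phi>: "\<phi> = [Node \<chi>]" using snoc True t by simp
      show ?thesis
      proof (cases \<chi> rule: rev_cases)
        case Nil
        hence "win (Node \<chi>)" by (simp add: win_Node)
        hence "mv \<phi> \<phi> \<and> odd (length \<phi>) \<and> wins \<phi>" using \<phi> mv_refl by simp
        thus ?thesis by blast
      next
        case (snoc \<psi> d)
        obtain \<omega> where d: "d = Node \<omega>" by (cases d)
        have lt: "nodes \<psi> < nodes \<phi>" "nodes \<omega> < nodes \<phi>" "nodes [d] < nodes \<phi>"
          using \<phi> snoc d by auto
        obtain \<omega>' where \<omega>': "mv \<omega> \<omega>'" "wins \<omega>'" using IH1[OF lt(2)] by blast
        obtain \<tau> where \<tau>: "mv [d] \<tau>" "wins \<tau>" using IH1[OF lt(3)] by blast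
        consider \<psi>' where "mv \<psi> \<psi>'" "win (Node \<psi>')" | \<psi>' where "mv \<psi> \<psi>'" "odd (length \<psi>')" "wins \<psi>'"
          using IH2[OF lt(1)] by blast
        thus ?thesis
        proof cases
          case 1
          have "mv \<phi> (Node \<psi>' # \<tau>)" "mv \<phi> (Node \<psi>' # [Node \<omega>'])"
            using mv_single_cut[OF 1(1)] mv_single_keep[OF \<omega>'(1)] \<tau>(1) \<phi> snoc d by auto
          moreover have "wins (Node \<psi>' # \<tau>)" "win (Node (Node \<psi>' # [Node \<omega>']))"
            using 1 \<tau> \<omega>' by (auto simp: win_Node[of "_ # _"] tail_wins_Cons)
          ultimately show ?thesis by blast
        next
          case 2
          have "mv \<phi> [Node (\<psi>' @ [Node \<omega>'])]"
            using mv_single_keep[OF mv_append[OF 2(1) mv_single_keep[OF \<omega>'(1)]]] \<phi> snoc d by simp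
          moreover have "win (Node (\<psi>' @ [Node \<omega>']))"
            using 2 \<omega>' by (auto simp: win_Node[of "_ @ _"])
          hence "odd (length [Node (\<psi>' @ [Node \<omega>'])]) \<and> wins [Node (\<psi>' @ [Node \<omega>'])]" by simp
          ultimately show ?thesis by blast
        qed
      qed
    qed
  qed
qed

lemma ex_mv_wins: "\<exists>\<phi>'. mv \<phi> \<phi>' \<and> wins \<phi>'"
  using ex_mv_wins_aux by blast

text \<open>The winning forests are a kernel of the graph of nontrivial moves: rigidity makes the
  set independent, \<open>ex_mv_wins\<close> makes it absorbing.\<close>

theorem wins_iff_no_mv: "wins \<phi> \<longleftrightarrow> (\<forall>\<phi>'. mv \<phi> \<phi>' \<and> \<phi>' \<noteq> \<phi> \<longrightarrow> \<not> wins \<phi>')"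
  using wins_mv_rigid ex_mv_wins by metis

subsection \<open>Forests as elements of the Tamari lattice\<close>

text \<open>\<open>code\<close> lists the numbers of proper descendants in preorder; \<open>red\<close> lists what each of them
  becomes when that node loses its last child.\<close>

fun code :: "tree list \<Rightarrow> nat list" where
  "code [] = []"
| "code (Node \<psi> # \<phi>) = nodes \<psi> # code \<psi> @ code \<phi>"

fun red :: "tree list \<Rightarrow> nat list" where
  "red [] = []"
| "red (Node \<psi> # \<phi>) = nodes (butlast \<psi>) # red \<psi> @ red \<phi>"

lemma length_code [simp]: "length (code \<phi>) = nodes \<phi>"
  by (induction \<phi> rule: nodes.induct) auto

lemma length_red [simp]: "length (red \<phi>) = nodes \<phi>"
  by (induction \<phi> rule: nodes.induct) auto

lemma code_append [simp]: "code (\<phi> @ \<psi>) = code \<phi> @ code \<psi>"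
  by (induction \<phi> rule: nodes.induct) auto

lemma red_append [simp]: "red (\<phi> @ \<psi>) = red \<phi> @ red \<psi>"
  by (induction \<phi> rule: nodes.induct) auto

lemma code_inject: "code \<phi> = code \<psi> \<longleftrightarrow> \<phi> = \<psi>"
proof
  show "code \<phi> = code \<psi> \<Longrightarrow> \<phi> = \<psi>"
  proof (induction \<phi> arbitrary: \<psi> rule: nodes.induct)
    case 1
    thus ?case by (cases \<psi> rule: nodes.cases) auto
  next
    case (2 \<psi>1 \<phi>1)
    from 2(3) obtain \<psi>2 \<phi>2 where \<psi>: "\<psi> = Node \<psi>2 # \<phi>2" by (cases \<psi> rule: nodes.cases) auto
    have "code \<psi>1 @ code \<phi>1 = code \<psi>2 @ code \<phi>2" "length (code \<psi>1) = length (code \<psi>2)"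
      using 2(3) \<psi> by auto
    hence "code \<psi>1 = code \<psi>2" "code \<phi>1 = code \<phi>2" by auto
    thus ?case using 2(1)[of \<psi>2] 2(2)[of \<phi>2] \<psi> by auto
  qed
qed auto

section \<open>Moves as independent choices between \<open>code\<close> and
  \<open>red\<close>\<close>

definition chosen :: "nat \<times> nat \<Rightarrow> nat \<Rightarrow> bool" where
  "chosen = (\<lambda>(c, r) x. x = c \<or> x = r)"

text \<open>Cuts preserve the preorder numbering, and cuts further down do not change how many
  descendants a node loses by its own cut. So the choices at different nodes do not interfere;
  \<open>ex_mv_chosen\<close> adds that all combinations occur.\<close>

lemma mv_chosen: "mv \<phi> \<phi>' \<Longrightarrow> list_all2 chosen (zip (code \<phi>) (red \<phi>)) (code \<phi>')"
proof (induction rule: mv.induct)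
  case (keep \<psi> \<psi>' \<phi> \<phi>')
  thus ?case using mv_nodes[OF keep.hyps(1)]
    by (auto simp: chosen_def intro!: list_all2_appendI)
next
  case (cut \<psi> \<psi>' t \<tau> \<phi> \<phi>')
  thus ?case using mv_nodes[OF cut.hyps(1)]
    by (auto simp: chosen_def intro!: list_all2_appendI)
qed auto

lemma ex_mv_chosen:
  "list_all2 chosen (zip (code \<phi>) (red \<phi>)) x \<Longrightarrow> \<exists>\<phi>'. mv \<phi> \<phi>' \<and> code \<phi>' = x"
proof (induction \<phi> arbitrary: x rule: nodes.induct)
  case 1
  thus ?case by auto
next
  case (2 \<psi> \<phi>)
  from 2(3) obtain a y z where x: "x = a # y @ z" and a: "a = nodes \<psi> \<or> a = nodes (butlast \<psi>)"
    and y: "list_all2 chosen (zip (code \<psi>) (red \<psi>)) y"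
    and z: "list_all2 chosen (zip (code \<phi>) (red \<phi>)) z"
    by (auto simp: chosen_def list_all2_Cons1 list_all2_append1)
  obtain \<psi>' where \<psi>': "mv \<psi> \<psi>'" "code \<psi>' = y" using 2(1)[OF y] by blast
  obtain \<phi>' where \<phi>': "mv \<phi> \<phi>'" "code \<phi>' = z" using 2(2)[OF z] by blast
  have keep: ?case if "a = nodes \<psi>"
    using that x \<psi>' \<phi>' mv_nodes[OF \<psi>'(1)]
    by (intro exI[of _ "Node \<psi>' # \<phi>'"]) (auto intro: mv.keep)
  show ?case
  proof (cases \<psi> rule: rev_cases)
    case Nil
    thus ?thesis using keep a by auto
  next
    case (snoc \<psi>0 t)
    obtain \<psi>0' \<tau> where \<psi>0': "\<psi>' = \<psi>0' @ \<tau>" "mv \<psi>0 \<psi>0'" "mv [t] \<tau>"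
      using \<psi>'(1) snoc mv_appendE by blast
    have "a = nodes \<psi>0 \<Longrightarrow> code (Node \<psi>0' # \<tau> @ \<phi>') = x"
      using x \<psi>0' \<psi>'(2) \<phi>'(2) mv_nodes[OF \<psi>0'(2)] by auto
    moreover have "mv (Node \<psi> # \<phi>) (Node \<psi>0' # \<tau> @ \<phi>')"
      using mv.cut[OF \<psi>0'(2,3) \<phi>'(1)] snoc by simp
    ultimately show ?thesis using keep a snoc by auto
  qed
qed

text \<open>These are the bracket vectors of Huang and Tamari: position i opens a block that ends at
  i + x ! i, and blocks are nested or disjoint.\<close>

definition nested :: "nat list \<Rightarrow> bool" where
  "nested x \<longleftrightarrow> (\<forall>i<length x. i + x ! i < length x \<and> (\<forall>j. i < j \<and> j \<le> i + x ! i \<longrightarrow> j + x ! j \<le> i + x ! i))"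

lemma nested_append:
  assumes x: "nested x" and y: "nested y"
  shows "nested (x @ y)"
  unfolding nested_def
proof (intro allI impI)
  fix i assume i: "i < length (x @ y)"
  show "i + (x @ y) ! i < length (x @ y) \<and>
    (\<forall>j. i < j \<and> j \<le> i + (x @ y) ! i \<longrightarrow> j + (x @ y) ! j \<le> i + (x @ y) ! i)"
  proof (cases "i < length x")
    case True
    hence "i + x ! i < length x" using x by (auto simp: nested_def)
    thus ?thesis using x True by (auto simp: nested_def nth_append)
  next
    case False
    define k where "k = i - length x"
    have ik: "i = length x + k" and k: "k < length y" using False i by (auto simp: k_def)
    have "j + (x @ y) ! j \<le> i + (x @ y) ! i" if "i < j" "j \<le> i + (x @ y) ! i" for j
    proof -
      define l where "l = j - length x"
      have jl: "j = length x + l" using that ik by (auto simp: l_def)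
      thus ?thesis using y k that ik by (auto simp: nested_def)
    qed
    moreover have "i + (x @ y) ! i < length (x @ y)" using y k ik by (auto simp: nested_def)
    ultimately show ?thesis by blast
  qed
qed

lemma nested_Cons: "nested x \<Longrightarrow> nested (length x # x)"
  unfolding nested_def
  by (auto simp: nth_Cons split: nat.splits)
    (metis Suc_le_mono add_Suc_right Suc_leI add.commute less_Suc_eq_le le_SucE less_eq_Suc_le)+

lemma nested_code: "nested (code \<phi>)"
proof (induction \<phi> rule: nodes.induct)
  case (2 \<psi> \<phi>)
  have "code (Node \<psi> # \<phi>) = (length (code \<psi>) # code \<psi>) @ code \<phi>" by simp
  thus ?case using nested_append[OF nested_Cons[OF 2(1)] 2(2)] by metis
qed (simp add: nested_def)

text \<open>The first entry tells how many of the following entries belong below the first tree's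
  root; the part before and the part after this boundary are again nested.\<close>

lemma nested_imp_code: "nested x \<Longrightarrow> \<exists>\<phi>. code \<phi> = x"
proof (induction x rule: length_induct)
  case (1 x)
  show ?case
  proof (cases x)
    case Nil
    thus ?thesis by (intro exI[of _ "[]"]) auto
  next
    case (Cons a xs)
    have N: "i + x ! i < length x" "\<And>j. i < j \<Longrightarrow> j \<le> i + x ! i \<Longrightarrow> j + x ! j \<le> i + x ! i"
      if "i < length x" for i
      using 1(2) that by (auto simp: nested_def)
    have a: "a \<le> length xs" using N(1)[of 0] Cons by auto
    have "nested (take a xs)"
      unfolding nested_def
    proof (intro allI impI conjI)
      fix i assume i: "i < length (take a xs)"
      show "i + take a xs ! i < length (take a xs)"
        using N(2)[of 0 "Suc i"] i Cons a by auto
      hence lt: "i + take a xs ! i < a" using a by (simp del: nth_take)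
      fix j assume j: "i < j \<and> j \<le> i + take a xs ! i"
      moreover from j lt have "j < a" by linarith
      ultimately show "j + take a xs ! j \<le> i + take a xs ! i"
        using N(2)[of "Suc i" "Suc j"] i Cons a by auto
    qed
    moreover have "nested (drop a xs)"
      unfolding nested_def
    proof (intro allI impI conjI)
      fix i assume i: "i < length (drop a xs)"
      hence ai: "a + i < length xs" by simp
      show "i + drop a xs ! i < length (drop a xs)"
        using N(1)[of "Suc (a + i)"] ai Cons a by simp
      fix j assume j: "i < j \<and> j \<le> i + drop a xs ! i"
      thus "j + drop a xs ! j \<le> i + drop a xs ! i"
        using N(2)[of "Suc (a + i)" "Suc (a + j)"] ai Cons a by simp
    qed
    moreover have "length (take a xs) < length x" "length (drop a xs) < length x"
      using Cons by auto
    ultimately obtain \<psi> \<phi> where *: "code \<psi> = take a xs" "code \<phi> = drop a xs"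
      using 1(1) by blast
    have "nodes \<psi> = a" using arg_cong[OF *(1), of length] a by simp
    hence "code (Node \<psi> # \<phi>) = x" using * Cons by simp
    thus ?thesis by blast
  qed
qed

text \<open>The blocks of the other children come first, so the last child of node a sits at
  \<open>Suc (a + red \<phi> ! a)\<close>, and its descendants fill the rest of the block of
  a.\<close>

lemma red_less_code:
  "a < nodes \<phi> \<Longrightarrow> 0 < code \<phi> ! a \<Longrightarrow>
     red \<phi> ! a < code \<phi> ! a \<and> code \<phi> ! Suc (a + red \<phi> ! a) = code \<phi> ! a - Suc (red \<phi> ! a)"
proof (induction \<phi> arbitrary: a rule: nodes.induct)
  case (2 \<psi> \<phi>)
  have bound: "Suc (b + red \<chi> ! b) < nodes \<chi>" if "b < nodes \<chi>" "red \<chi> ! b < code \<chi> ! b" for b \<chi>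
    using nested_code[of \<chi>] that by (auto simp: nested_def)
  consider "a = 0" | b where "a = Suc b" "b < nodes \<psi>" | b where "a = Suc (nodes \<psi> + b)" "b < nodes \<phi>"
  proof (cases a)
    case (Suc b)
    show ?thesis
    proof (cases "b < nodes \<psi>")
      case False
      thus ?thesis using that(3)[of "b - nodes \<psi>"] Suc 2(3) by auto
    qed (use Suc that in blast)
  qed (use that in blast)
  thus ?case
  proof cases
    case 1
    obtain \<psi>0 t where \<psi>: "\<psi> = \<psi>0 @ [t]" using 1 2(4) by (cases \<psi> rule: rev_cases) auto
    show ?thesis using 1 \<psi> by (cases t) (auto simp: nth_append)
  next
    case 2: 2
    thus ?thesis using "2.IH"(1)[of b] "2.prems" bound[of b \<psi>] by (auto simp: nth_append)
  next
    case 3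
    thus ?thesis using "2.IH"(2)[of b] "2.prems" bound[of b \<phi>] by (auto simp: nth_append)
  qed
qed auto

lemma red_le_code: "a < nodes \<phi> \<Longrightarrow> red \<phi> ! a \<le> code \<phi> ! a"
proof (induction \<phi> arbitrary: a rule: nodes.induct)
  case (2 \<psi> \<phi>)
  have "nodes (butlast \<psi>) \<le> nodes \<psi>" by (cases \<psi> rule: rev_cases) auto
  thus ?case using 2 by (auto simp: nth_Cons nth_append split: nat.splits)
qed auto

section \<open>The permutation of a forest, and the order in terms of codes\<close>

definition forest_inversions :: "tree list \<Rightarrow> (nat \<times> nat) set" where
  "forest_inversions \<phi> = {(i, j). 1 \<le> i \<and> i \<le> nodes \<phi> \<and> i < j \<and> j \<le> i + code \<phi> ! (i - 1)}"

definition tam_perm :: "tree list \<Rightarrow> nat \<Rightarrow> nat" where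
  "tam_perm \<phi> = (SOME w. w \<in> carrier (Tam (nodes \<phi>)) \<and>
     inversions (nodes \<phi>) w = forest_inversions \<phi>)"

text \<open>The descendants of i directly follow i in preorder, so each row of
  \<open>forest_inversions\<close> is an interval starting after i: this is 312-avoidance.
  Nestedness of the blocks is transitivity.\<close>

lemma tam_perm:
  shows tam_perm_carrier: "tam_perm \<phi> \<in> carrier (Tam (nodes \<phi>))"
    and inversions_tam_perm: "inversions (nodes \<phi>) (tam_perm \<phi>) = forest_inversions \<phi>"
proof -
  let ?n = "nodes \<phi>" and ?I = "forest_inversions \<phi>"
  have N: "i + code \<phi> ! i < ?n" "\<And>j. i < j \<Longrightarrow> j \<le> i + code \<phi> ! i \<Longrightarrow> j + code \<phi> ! j \<le> i + code \<phi> ! i"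
    if "i < ?n" for i
    using nested_code[of \<phi>] that by (auto simp: nested_def)
  have "\<exists>w. w permutes {1..?n} \<and> avoids_312 ?n w \<and> inversions ?n w = ?I"
  proof (rule ex_Tam_inversions)
    fix a b assume "(a, b) \<in> ?I"
    thus "1 \<le> a \<and> a < b \<and> b \<le> ?n" using N(1)[of "a - 1"] by (cases a) (auto simp: forest_inversions_def)
  next
    fix a b c assume "(a, b) \<in> ?I" "(b, c) \<in> ?I"
    thus "(a, c) \<in> ?I" using N(2)[of "a - 1" "b - 1"]
      by (cases a; cases b) (auto simp: forest_inversions_def)
  qed (auto simp: forest_inversions_def)
  hence "\<exists>w. w \<in> carrier (Tam ?n) \<and> inversions ?n w = ?I" by (auto simp: carrier_Tam)
  from someI_ex[OF this] show "tam_perm \<phi> \<in> carrier (Tam ?n)" "inversions ?n (tam_perm \<phi>) = ?I"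
    by (auto simp: tam_perm_def)
qed

definition forest_le :: "tree list \<Rightarrow> tree list \<Rightarrow> bool" where
  "forest_le \<phi> \<psi> \<longleftrightarrow> (\<forall>i<nodes \<phi>. code \<phi> ! i \<le> code \<psi> ! i)"

lemma forest_inversions_subset_iff:
  assumes "nodes \<phi> = nodes \<psi>"
  shows "forest_inversions \<phi> \<subseteq> forest_inversions \<psi> \<longleftrightarrow> forest_le \<phi> \<psi>"
proof
  assume sub: "forest_inversions \<phi> \<subseteq> forest_inversions \<psi>"
  show "forest_le \<phi> \<psi>"
    unfolding forest_le_def
  proof (intro allI impI)
    fix i assume i: "i < nodes \<phi>"
    show "code \<phi> ! i \<le> code \<psi> ! i"
    proof (cases "code \<phi> ! i = 0")
      case False
      hence "(Suc i, Suc i + code \<phi> ! i) \<in> forest_inversions \<phi>"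
        using i by (auto simp: forest_inversions_def)
      hence "(Suc i, Suc i + code \<phi> ! i) \<in> forest_inversions \<psi>" using sub by blast
      thus ?thesis by (auto simp: forest_inversions_def)
    qed simp
  qed
next
  assume le: "forest_le \<phi> \<psi>"
  show "forest_inversions \<phi> \<subseteq> forest_inversions \<psi>"
  proof
    fix p assume "p \<in> forest_inversions \<phi>"
    moreover obtain i j where "p = (i, j)" by (cases p)
    ultimately show "p \<in> forest_inversions \<psi>"
      using le[unfolded forest_le_def, rule_format, of "i - 1"] assms
      by (cases i) (auto simp: forest_inversions_def)
  qed
qed

lemma forest_le_antisym:
  assumes "nodes \<phi> = nodes \<psi>" "forest_le \<phi> \<psi>" "forest_le \<psi> \<phi>"
  shows "\<phi> = \<psi>"
proof -
  have "code \<phi> = code \<psi>"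
    using assms by (intro nth_equalityI) (auto simp: forest_le_def intro: order.antisym)
  thus ?thesis by (simp add: code_inject)
qed

lemma tam_perm_le_iff:
  assumes "nodes \<phi> = n" "nodes \<psi> = n"
  shows "tam_perm \<phi> \<sqsubseteq>\<^bsub>Tam n\<^esub> tam_perm \<psi> \<longleftrightarrow> forest_le \<phi> \<psi>"
  using inversions_tam_perm[of \<phi>] inversions_tam_perm[of \<psi>] assms
  by (simp add: le_Tam forest_inversions_subset_iff)

lemma tam_perm_inject:
  assumes "nodes \<phi> = n" "nodes \<psi> = n"
  shows "tam_perm \<phi> = tam_perm \<psi> \<longleftrightarrow> \<phi> = \<psi>"
proof
  assume eq: "tam_perm \<phi> = tam_perm \<psi>"
  have "tam_perm \<phi> \<sqsubseteq>\<^bsub>Tam n\<^esub> tam_perm \<psi>" "tam_perm \<psi> \<sqsubseteq>\<^bsub>Tam n\<^esub> tam_perm \<phi>"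
    unfolding eq by (simp_all add: le_Tam)
  thus "\<phi> = \<psi>" using assms by (auto simp: tam_perm_le_iff intro: forest_le_antisym)
qed auto

lemma tam_perm_less_iff:
  assumes "nodes \<phi> = n" "nodes \<psi> = n"
  shows "tam_perm \<phi> \<sqsubset>\<^bsub>Tam n\<^esub> tam_perm \<psi> \<longleftrightarrow> forest_le \<phi> \<psi> \<and> \<phi> \<noteq> \<psi>"
  using assms by (auto simp: lless_def eq_Tam tam_perm_le_iff tam_perm_inject)

lemma Tam_imp_tam_perm:
  assumes w: "w \<in> carrier (Tam n)"
  obtains \<phi> where "nodes \<phi> = n" "w = tam_perm \<phi>"
proof -
  let ?I = "inversions n w"
  have wp: "w permutes {1..n}" "avoids_312 n w" using w by (auto simp: carrier_Tam)
  define x where "x = map (\<lambda>i. card {j. (Suc i, j) \<in> ?I}) [0..<n]"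
  have dom: "1 \<le> i \<and> i < j \<and> j \<le> n" if "(i, j) \<in> ?I" for i j
    using that by (auto simp: inversions_def)
  \<comment> \<open>312-avoidance closes each row downwards, so the row is an interval starting
    right after i and its size determines it.\<close>
  have row: "{j. (i, j) \<in> ?I} = {i<..i + card {j. (i, j) \<in> ?I}}" for i
  proof -
    let ?J = "{j. (i, j) \<in> ?I}"
    have fin: "finite ?J" by (rule finite_subset[of _ "{..n}"]) (auto dest: dom)
    show ?thesis
    proof (cases "?J = {}")
      case False
      have "?J = {i<..Max ?J}"
      proof (intro equalityI subsetI)
        fix j assume "j \<in> {i<..Max ?J}"
        moreover have "(i, Max ?J) \<in> ?I" using Max_in[OF fin False] by simp
        ultimately show "j \<in> ?J"
          using inversions_avoids_312[OF wp, of i "Max ?J" j] by (cases "j = Max ?J") auto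
      qed (use fin dom in auto)
      moreover from this have "card ?J = Max ?J - i" by (metis card_greaterThanAtMost)
      moreover have "i < Max ?J" using Max_in[OF fin False] dom by auto
      ultimately show ?thesis by simp
    qed auto
  qed
  have I_iff: "(Suc i, j) \<in> ?I \<longleftrightarrow> Suc i < j \<and> j \<le> Suc i + x ! i" if "i < n" for i j
    using row[of "Suc i"] that by (auto simp: x_def)
  have len: "length x = n" by (simp add: x_def)
  have "nested x"
    unfolding nested_def len
  proof (intro allI impI conjI)
    fix i assume i: "i < n"
    show "i + x ! i < n"
      using I_iff[OF i, of "Suc i + x ! i"] dom[of "Suc i" "Suc i + x ! i"] i
      by (cases "x ! i = 0") auto
    fix j assume j: "i < j \<and> j \<le> i + x ! i"
    hence 1: "(Suc i, Suc j) \<in> ?I" using I_iff[OF i, of "Suc j"] by auto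
    hence jn: "j < n" using dom[OF 1] by simp
    show "j + x ! j \<le> i + x ! i"
    proof (cases "x ! j = 0")
      case False
      hence "(Suc j, Suc j + x ! j) \<in> ?I" using I_iff[OF jn] by auto
      hence "(Suc i, Suc j + x ! j) \<in> ?I" using 1 inversions_trans by blast
      thus ?thesis using I_iff[OF i] by auto
    qed (use j in auto)
  qed
  then obtain \<phi> where \<phi>: "code \<phi> = x" using nested_imp_code by blast
  have n: "nodes \<phi> = n" using arg_cong[OF \<phi>, of length] len by simp
  have "forest_inversions \<phi> = ?I"
  proof (intro Set.set_eqI)
    fix p :: "nat \<times> nat" obtain i j where p: "p = (i, j)" by (cases p)
    show "p \<in> forest_inversions \<phi> \<longleftrightarrow> p \<in> ?I"
      using I_iff[of "i - 1" j] dom[of i j] p n \<phi>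
      by (cases i) (auto simp: forest_inversions_def)
  qed
  hence "inversions n w = inversions n (tam_perm \<phi>)"
    using inversions_tam_perm[of \<phi>] n by simp
  hence "w = tam_perm \<phi>"
    using inversions_inject[of w n "tam_perm \<phi>"] wp tam_perm_carrier[of \<phi>] n
    by (auto simp: carrier_Tam)
  thus ?thesis using that n by blast
qed

lemma carrier_Tam_eq: "carrier (Tam n) = tam_perm ` {\<phi>. nodes \<phi> = n}"
  using Tam_imp_tam_perm tam_perm_carrier by blast

section \<open>Lower covers, meets and Ungar moves\<close>

definition cut_at :: "tree list \<Rightarrow> nat \<Rightarrow> tree list" where
  "cut_at \<phi> a = (THE \<psi>. code \<psi> = (code \<phi>)[a := red \<phi> ! a])"

lemma code_cut_at:
  assumes "a < nodes \<phi>"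
  shows "code (cut_at \<phi> a) = (code \<phi>)[a := red \<phi> ! a]"
proof -
  have "list_all2 chosen (zip (code \<phi>) (red \<phi>)) ((code \<phi>)[a := red \<phi> ! a])"
    using assms by (auto simp: list_all2_conv_all_nth chosen_def nth_list_update)
  then obtain \<psi> where "code \<psi> = (code \<phi>)[a := red \<phi> ! a]" using ex_mv_chosen by blast
  hence "\<exists>!\<psi>. code \<psi> = (code \<phi>)[a := red \<phi> ! a]" by (metis code_inject)
  thus ?thesis unfolding cut_at_def by (rule theI')
qed

lemma nodes_cut_at: "a < nodes \<phi> \<Longrightarrow> nodes (cut_at \<phi> a) = nodes \<phi>"
  using arg_cong[OF code_cut_at, of a \<phi> length] by simp

definition inner_nodes :: "tree list \<Rightarrow> nat set" where
  "inner_nodes \<phi> = {a. a < nodes \<phi> \<and> 0 < code \<phi> ! a}"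

lemma forest_le_cut_at:
  assumes "a \<in> inner_nodes \<phi>" "nodes \<psi> = nodes \<phi>"
  shows "forest_le \<psi> (cut_at \<phi> a) \<longleftrightarrow> forest_le \<psi> \<phi> \<and> code \<psi> ! a \<le> red \<phi> ! a"
  using assms red_le_code[of _ \<phi>]
  by (auto simp: forest_le_def code_cut_at inner_nodes_def nth_list_update split: if_splits)
     (meson le_trans | metis)+

text \<open>At the largest position where \<open>\<psi>\<close> differs from \<open>\<phi>\<close>, all later blocks are still intact, so
  nestedness forces the whole last child block to be gone.\<close>

lemma below_some_cut_at:
  assumes n: "nodes \<psi> = nodes \<phi>" and le: "forest_le \<psi> \<phi>" and ne: "\<psi> \<noteq> \<phi>"
  shows "\<exists>a\<in>inner_nodes \<phi>. forest_le \<psi> (cut_at \<phi> a)"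
proof -
  let ?D = "{a. a < nodes \<phi> \<and> code \<psi> ! a < code \<phi> ! a}"
  have "?D \<noteq> {}"
  proof
    assume "?D = {}"
    hence "\<not> code \<psi> ! i < code \<phi> ! i" if "i < nodes \<phi>" for i using that by blast
    hence "forest_le \<phi> \<psi>" by (auto simp: forest_le_def not_less)
    thus False using forest_le_antisym n le ne by metis
  qed
  moreover have fin: "finite ?D" by simp
  ultimately have a: "Max ?D \<in> ?D" using Max_in by blast
  define a where "a = Max ?D"
  have an: "a < nodes \<phi>" "code \<psi> ! a < code \<phi> ! a" using a a_def by auto
  have later: "code \<psi> ! b = code \<phi> ! b" if "a < b" "b < nodes \<phi>" for b
  proof -
    have "b \<notin> ?D" using that Max_ge[OF fin] a_def by (meson leD)
    thus ?thesis using that le n by (auto simp: forest_le_def not_less intro: order.antisym)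
  qed
  have inner: "a \<in> inner_nodes \<phi>" using an by (auto simp: inner_nodes_def)
  let ?d = "Suc (a + red \<phi> ! a)"
  have d: "red \<phi> ! a < code \<phi> ! a" "code \<phi> ! ?d = code \<phi> ! a - Suc (red \<phi> ! a)"
    using red_less_code[of a \<phi>] an by auto
  have "code \<psi> ! a \<le> red \<phi> ! a"
  proof (rule ccontr)
    assume c: "\<not> ?thesis"
    have "j + code \<psi> ! j \<le> a + code \<psi> ! a" if "a < j" "j \<le> a + code \<psi> ! a" for j
      using nested_code[of \<psi>] that an n by (auto simp: nested_def)
    from this[of ?d] have N: "?d + code \<psi> ! ?d \<le> a + code \<psi> ! a" using c by simp
    have "a + code \<phi> ! a < nodes \<phi>" using nested_code[of \<phi>] an by (auto simp: nested_def)
    hence "code \<psi> ! ?d = code \<phi> ! ?d" using d later[of ?d] by auto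
    thus False using N d an by auto
  qed
  thus ?thesis using inner le n forest_le_cut_at by blast
qed

lemma cut_at_neq: "a \<in> inner_nodes \<phi> \<Longrightarrow> cut_at \<phi> a \<noteq> \<phi>"
  using code_cut_at[of a \<phi>] red_less_code[of a \<phi>]
  by (auto simp: inner_nodes_def) (metis length_code nat_neq_iff nth_list_update_eq)

lemma cut_at_le: "a \<in> inner_nodes \<phi> \<Longrightarrow> forest_le (cut_at \<phi> a) \<phi>"
  using forest_le_cut_at[of a \<phi> "cut_at \<phi> a"]
  by (auto simp: nodes_cut_at inner_nodes_def) (auto simp: forest_le_def)

lemma forest_le_trans:
  "nodes \<phi> = nodes \<psi> \<Longrightarrow> forest_le \<phi> \<psi> \<Longrightarrow> forest_le \<psi> \<chi> \<Longrightarrow> forest_le \<phi> \<chi>"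
  by (auto simp: forest_le_def intro: order.trans)

lemma cut_at_le_cut_at:
  assumes a: "a \<in> inner_nodes \<phi>" and b: "b \<in> inner_nodes \<phi>" and le: "forest_le (cut_at \<phi> a) (cut_at \<phi> b)"
  shows "a = b"
proof (rule ccontr)
  assume "a \<noteq> b"
  hence "code (cut_at \<phi> a) ! b = code \<phi> ! b"
    using a b by (auto simp: code_cut_at inner_nodes_def)
  moreover have "code (cut_at \<phi> a) ! b \<le> red \<phi> ! b"
    using le a b forest_le_cut_at[of b \<phi> "cut_at \<phi> a"] by (auto simp: nodes_cut_at inner_nodes_def)
  ultimately show False using red_less_code[of b \<phi>] b by (auto simp: inner_nodes_def)
qed

text \<open>Every forest strictly below \<open>\<phi>\<close> lies below some single cut, and
  distinct single cuts are incomparable, since each still has the full block that the other has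
  shortened. So the single cuts are the maximal elements below \<open>\<phi>\<close>.\<close>

lemma lower_covers_Tam:
  assumes n: "nodes \<phi> = n"
  shows "lower_covers (Tam n) (tam_perm \<phi>) = (\<lambda>a. tam_perm (cut_at \<phi> a)) ` inner_nodes \<phi>"
proof -
  have nc: "nodes (cut_at \<phi> a) = n" if "a \<in> inner_nodes \<phi>" for a
    using that n by (auto simp: nodes_cut_at inner_nodes_def)
  have "(\<lambda>a. tam_perm (cut_at \<phi> a)) ` inner_nodes \<phi> \<subseteq> lower_covers (Tam n) (tam_perm \<phi>)"
  proof (intro image_subsetI)
    fix a assume a: "a \<in> inner_nodes \<phi>"
    have "\<not> (\<exists>z\<in>carrier (Tam n). tam_perm (cut_at \<phi> a) \<sqsubset>\<^bsub>Tam n\<^esub> z \<and> z \<sqsubset>\<^bsub>Tam n\<^esub> tam_perm \<phi>)"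
    proof (intro notI, elim bexE conjE)
      fix z assume z: "z \<in> carrier (Tam n)" "tam_perm (cut_at \<phi> a) \<sqsubset>\<^bsub>Tam n\<^esub> z" "z \<sqsubset>\<^bsub>Tam n\<^esub> tam_perm \<phi>"
      obtain \<chi> where \<chi>: "nodes \<chi> = n" "z = tam_perm \<chi>" using Tam_imp_tam_perm z(1) by blast
      have 1: "forest_le (cut_at \<phi> a) \<chi>" "cut_at \<phi> a \<noteq> \<chi>" and 2: "forest_le \<chi> \<phi>" "\<chi> \<noteq> \<phi>"
        using z \<chi> nc[OF a] n by (auto simp: tam_perm_less_iff)
      obtain b where b: "b \<in> inner_nodes \<phi>" "forest_le \<chi> (cut_at \<phi> b)"
        using below_some_cut_at[OF _ 2] \<chi> n by auto
      have "forest_le (cut_at \<phi> a) (cut_at \<phi> b)"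
        using forest_le_trans[OF _ 1(1) b(2)] nc[OF a] \<chi> by simp
      hence "a = b" using cut_at_le_cut_at a b by blast
      thus False using 1 b forest_le_antisym[of "cut_at \<phi> a" \<chi>] nc[OF a] \<chi> by auto
    qed
    thus "tam_perm (cut_at \<phi> a) \<in> lower_covers (Tam n) (tam_perm \<phi>)"
      using tam_perm_carrier[of "cut_at \<phi> a"] nc[OF a] n cut_at_le[OF a] cut_at_neq[OF a]
      by (auto simp: lower_covers_def tam_perm_less_iff)
  qed
  moreover have "lower_covers (Tam n) (tam_perm \<phi>) \<subseteq> (\<lambda>a. tam_perm (cut_at \<phi> a)) ` inner_nodes \<phi>"
  proof
    fix y assume y: "y \<in> lower_covers (Tam n) (tam_perm \<phi>)"
    then obtain \<chi> where \<chi>: "nodes \<chi> = n" "y = tam_perm \<chi>"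
      using Tam_imp_tam_perm by (auto simp: lower_covers_def)
    have 2: "forest_le \<chi> \<phi>" "\<chi> \<noteq> \<phi>"
      using y \<chi> n by (auto simp: lower_covers_def tam_perm_less_iff)
    obtain b where b: "b \<in> inner_nodes \<phi>" "forest_le \<chi> (cut_at \<phi> b)"
      using below_some_cut_at[OF _ 2] \<chi> n by auto
    have "\<chi> = cut_at \<phi> b"
    proof (rule ccontr)
      assume "\<chi> \<noteq> cut_at \<phi> b"
      hence "y \<sqsubset>\<^bsub>Tam n\<^esub> tam_perm (cut_at \<phi> b)" "tam_perm (cut_at \<phi> b) \<sqsubset>\<^bsub>Tam n\<^esub> tam_perm \<phi>"
        using b \<chi> nc[OF b(1)] n cut_at_le[OF b(1)] cut_at_neq[OF b(1)]
        by (auto simp: tam_perm_less_iff)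
      moreover have "tam_perm (cut_at \<phi> b) \<in> carrier (Tam n)"
        using tam_perm_carrier[of "cut_at \<phi> b"] nc[OF b(1)] by simp
      ultimately show False using y by (auto simp: lower_covers_def)
    qed
    thus "y \<in> (\<lambda>a. tam_perm (cut_at \<phi> a)) ` inner_nodes \<phi>" using b \<chi> by auto
  qed
  ultimately show ?thesis by blast
qed

text \<open>Meets are componentwise minima of codes, and each cut differs from \<open>\<phi>\<close>
  in one position only.\<close>

lemma Inf_cut_at:
  assumes n: "nodes \<phi> = n" and S: "S \<subseteq> inner_nodes \<phi>" and \<chi>: "nodes \<chi> = n"
    and code: "\<And>i. i < n \<Longrightarrow> code \<chi> ! i = (if i \<in> S then red \<phi> ! i else code \<phi> ! i)"
  shows "\<Sqinter>\<^bsub>Tam n\<^esub>({tam_perm \<phi>} \<union> (\<lambda>a. tam_perm (cut_at \<phi> a)) ` S) = tam_perm \<chi>"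
proof -
  interpret finite_lattice "Tam n" by (rule finite_lattice_Tam)
  let ?A = "{tam_perm \<phi>} \<union> (\<lambda>a. tam_perm (cut_at \<phi> a)) ` S"
  have nc: "nodes (cut_at \<phi> a) = n" if "a \<in> S" for a
    using that n S by (auto simp: nodes_cut_at inner_nodes_def subset_iff)
  have "tam_perm (cut_at \<phi> a) \<in> carrier (Tam n)" if "a \<in> S" for a
    using tam_perm_carrier[of "cut_at \<phi> a"] nc[OF that] by simp
  hence sub: "?A \<subseteq> carrier (Tam n)"
    using tam_perm_carrier[of \<phi>] n by auto
  have \<chi>\<phi>: "forest_le \<chi> \<phi>"
    using code red_le_code n \<chi> by (auto simp: forest_le_def)
  have lower: "forest_le \<chi> (cut_at \<phi> a)" if "a \<in> S" for a
  proof -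
    have "a \<in> inner_nodes \<phi>" "a < n" using that S n by (auto simp: inner_nodes_def)
    thus ?thesis using \<chi>\<phi> code[of a] that n \<chi> by (simp add: forest_le_cut_at)
  qed
  have "greatest (Tam n) (tam_perm \<chi>) (Lower (Tam n) ?A)"
    unfolding greatest_def
  proof (intro conjI ballI)
    show "Lower (Tam n) ?A \<subseteq> carrier (Tam n)" by (auto simp: Lower_def)
    show "tam_perm \<chi> \<in> Lower (Tam n) ?A"
      using lower \<chi>\<phi> tam_perm_carrier[of \<chi>] \<chi> n nc sub
      by (auto simp: Lower_def tam_perm_le_iff)
    fix v assume v: "v \<in> Lower (Tam n) ?A"
    then obtain \<omega> where \<omega>: "nodes \<omega> = n" "v = tam_perm \<omega>"
      using Tam_imp_tam_perm by (auto simp: Lower_def)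
    have "forest_le \<omega> \<phi>"
      using v sub \<omega> n by (auto simp: Lower_def tam_perm_le_iff)
    moreover have "forest_le \<omega> (cut_at \<phi> a)" if "a \<in> S" for a
    proof -
      have "tam_perm \<omega> \<sqsubseteq>\<^bsub>Tam n\<^esub> tam_perm (cut_at \<phi> a)"
        using v \<omega> sub that by (auto simp: Lower_def)
      thus ?thesis using \<omega> nc[OF that] by (simp add: tam_perm_le_iff)
    qed
    hence "code \<omega> ! a \<le> red \<phi> ! a" if "a \<in> S" for a
      using that S forest_le_cut_at[of a \<phi> \<omega>] \<omega> n by auto
    ultimately have "forest_le \<omega> \<chi>"
      using code \<omega> by (auto simp: forest_le_def)
    thus "v \<sqsubseteq>\<^bsub>Tam n\<^esub> tam_perm \<chi>" using \<omega> \<chi> by (simp add: tam_perm_le_iff)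
  qed
  moreover from this have "greatest (Tam n) (\<Sqinter>\<^bsub>Tam n\<^esub>?A) (Lower (Tam n) ?A)"
    unfolding inf_def by (rule someI[where P = "\<lambda>x. greatest (Tam n) x (Lower (Tam n) ?A)"])
  ultimately show ?thesis using greatest_unique[of "tam_perm \<chi>" "Lower (Tam n) ?A"] by auto
qed

lemma nontrivial_Ungar_moves_Tam:
  assumes n: "nodes \<phi> = n"
  shows "nontrivial_Ungar_moves (Tam n) (tam_perm \<phi>) = tam_perm ` {\<chi>. mv \<phi> \<chi> \<and> \<chi> \<noteq> \<phi>}"
proof (intro equalityI subsetI)
  fix y assume "y \<in> nontrivial_Ungar_moves (Tam n) (tam_perm \<phi>)"
  then obtain T where y: "y = \<Sqinter>\<^bsub>Tam n\<^esub>({tam_perm \<phi>} \<union> T)" and T: "T \<noteq> {}"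
      "T \<subseteq> (\<lambda>a. tam_perm (cut_at \<phi> a)) ` inner_nodes \<phi>"
    by (auto simp: nontrivial_Ungar_moves_def lower_covers_Tam[OF n])
  obtain S where S: "S \<subseteq> inner_nodes \<phi>" "T = (\<lambda>a. tam_perm (cut_at \<phi> a)) ` S"
    using T by (meson subset_imageE)
  define x where "x = map (\<lambda>i. if i \<in> S then red \<phi> ! i else code \<phi> ! i) [0..<n]"
  have "list_all2 chosen (zip (code \<phi>) (red \<phi>)) x"
    using n by (auto simp: list_all2_conv_all_nth chosen_def x_def)
  then obtain \<chi> where \<chi>: "mv \<phi> \<chi>" "code \<chi> = x" using ex_mv_chosen by blast
  have "y = tam_perm \<chi>"
    unfolding y S(2) using S \<chi> n mv_nodes[OF \<chi>(1)]
    by (intro Inf_cut_at) (auto simp: x_def)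
  moreover have "\<chi> \<noteq> \<phi>"
  proof
    assume eq: "\<chi> = \<phi>"
    obtain a where a: "a \<in> S" using T S by auto
    hence "a < n" "0 < code \<phi> ! a" using S n by (auto simp: inner_nodes_def)
    moreover from this have "code \<chi> ! a = red \<phi> ! a" using \<chi>(2) a by (simp add: x_def)
    ultimately show False using eq red_less_code[of a \<phi>] n by auto
  qed
  ultimately show "y \<in> tam_perm ` {\<chi>. mv \<phi> \<chi> \<and> \<chi> \<noteq> \<phi>}" using \<chi> by auto
next
  fix y assume "y \<in> tam_perm ` {\<chi>. mv \<phi> \<chi> \<and> \<chi> \<noteq> \<phi>}"
  then obtain \<chi> where \<chi>: "mv \<phi> \<chi>" "\<chi> \<noteq> \<phi>" "y = tam_perm \<chi>" by auto
  \<comment> \<open>The chosen nodes are recovered as the positions where the code changed. At a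
    leaf \<open>red\<close> and \<open>code\<close> agree, so only inner nodes can occur.\<close>
  define S where "S = {a. a < n \<and> code \<chi> ! a \<noteq> code \<phi> ! a}"
  have nn: "nodes \<chi> = n" using mv_nodes[OF \<chi>(1)] n by simp
  have ch: "code \<chi> ! i = code \<phi> ! i \<or> code \<chi> ! i = red \<phi> ! i" if "i < n" for i
    using mv_chosen[OF \<chi>(1)] that n by (auto simp: list_all2_conv_all_nth chosen_def)
  have S: "S \<subseteq> inner_nodes \<phi>"
    using ch red_le_code[of _ \<phi>] n by (fastforce simp: S_def inner_nodes_def)
  have "S \<noteq> {}"
  proof
    assume "S = {}"
    hence "code \<chi> = code \<phi>" using n nn by (intro nth_equalityI) (auto simp: S_def)
    thus False using \<chi>(2) by (simp add: code_inject)
  qed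
  moreover have "\<Sqinter>\<^bsub>Tam n\<^esub>({tam_perm \<phi>} \<union> (\<lambda>a. tam_perm (cut_at \<phi> a)) ` S) = y"
    unfolding \<chi>(3) using ch by (intro Inf_cut_at[OF n S nn]) (auto simp: S_def)
  ultimately show "y \<in> nontrivial_Ungar_moves (Tam n) (tam_perm \<phi>)"
    unfolding nontrivial_Ungar_moves_def lower_covers_Tam[OF n] using S by blast
qed

lemma Eeta_win_Tam:
  assumes "nodes \<phi> = n"
  shows "finite_lattice.Eeta_win (Tam n) (tam_perm \<phi>) \<longleftrightarrow> wins \<phi>"
proof -
  interpret finite_lattice "Tam n" by (rule finite_lattice_Tam)
  have "\<forall>\<phi>. nodes \<phi> = n \<and> w = tam_perm \<phi> \<longrightarrow> Eeta_win w = wins \<phi>" for w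
  proof (induction w rule: Eeta_win.induct)
    case (1 w)
    show ?case
    proof (intro allI impI)
      fix \<phi> assume \<phi>: "nodes \<phi> = n \<and> w = tam_perm \<phi>"
      hence w: "w \<in> carrier (Tam n)" using tam_perm_carrier[of \<phi>] by simp
      have moves: "nontrivial_Ungar_moves (Tam n) w = tam_perm ` {\<chi>. mv \<phi> \<chi> \<and> \<chi> \<noteq> \<phi>}"
        using \<phi> nontrivial_Ungar_moves_Tam[of \<phi> n] by simp
      have IH: "Eeta_win (tam_perm \<chi>) = wins \<chi>" if "mv \<phi> \<chi>" "\<chi> \<noteq> \<phi>" for \<chi>
        using 1[OF w, of "tam_perm \<chi>"] that \<phi> mv_nodes[of \<phi> \<chi>] moves by auto
      have "Eeta_win w \<longleftrightarrow> (\<forall>\<chi>. mv \<phi> \<chi> \<and> \<chi> \<noteq> \<phi> \<longrightarrow> \<not> wins \<chi>)"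
        using Eeta_win.simps[of w] w moves IH by auto
      thus "Eeta_win w = wins \<phi>" using wins_iff_no_mv[of \<phi>] by simp
    qed
  qed
  thus ?thesis using assms by blast
qed

lemma card_Eeta_wins_Tam:
  "card (finite_lattice.Eeta_wins (Tam n)) = card {\<phi>. nodes \<phi> = n \<and> wins \<phi>}"
proof -
  have "finite_lattice.Eeta_wins (Tam n) = tam_perm ` {\<phi>. nodes \<phi> = n \<and> wins \<phi>}"
    unfolding finite_lattice.Eeta_wins_def[OF finite_lattice_Tam] carrier_Tam_eq
    using Eeta_win_Tam by auto
  moreover have "inj_on tam_perm {\<phi>. nodes \<phi> = n \<and> wins \<phi>}"
    by (intro inj_onI) (auto simp: tam_perm_inject)
  ultimately show ?thesis by (simp add: card_image)
qed

subsection \<open>Generating functions\<close>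

lemma finite_forests: "finite {\<phi>. nodes \<phi> = n}"
proof (rule finite_imageD)
  show "finite (tam_perm ` {\<phi>. nodes \<phi> = n})"
    using finite_lattice.finite_carrier[OF finite_lattice_Tam, of n] unfolding carrier_Tam_eq .
  show "inj_on tam_perm {\<phi>. nodes \<phi> = n}"
    using tam_perm_inject unfolding inj_on_def by blast
qed

text \<open>Polymorphic so that one set of combinatorial equations serves the real series, where
  nonnegativity bounds partial sums, and the complex series, which is evaluated as a function. The
  sets counted are finite by \<open>finite_forests\<close>.\<close>

definition gf :: "tree list set \<Rightarrow> 'a :: comm_ring_1 fps" where
  "gf A = Abs_fps (\<lambda>n. of_nat (card {\<phi> \<in> A. nodes \<phi> = n}))"

lemma gf_Un:
  assumes "A \<inter> B = {}"
  shows "gf (A \<union> B) = gf A + gf B"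
proof (rule fps_ext)
  fix n
  let ?A = "{\<phi> \<in> A. nodes \<phi> = n}" and ?B = "{\<phi> \<in> B. nodes \<phi> = n}"
  have "{\<phi> \<in> A \<union> B. nodes \<phi> = n} = ?A \<union> ?B" by blast
  moreover have "card (?A \<union> ?B) = card ?A + card ?B"
  proof (rule card_Un_disjoint)
    show "finite ?A" "finite ?B" by (auto intro: finite_subset[OF _ finite_forests[of n]])
    show "?A \<inter> ?B = {}" using assms by blast
  qed
  ultimately have "card {\<phi> \<in> A \<union> B. nodes \<phi> = n} = card ?A + card ?B" by (simp only:)
  thus "gf (A \<union> B) $ n = (gf A + gf B) $ n" by (simp only: gf_def fps_nth_Abs_fps fps_add_nth of_nat_add)
qed

lemma gf_single: "gf {\<phi>} = fps_X ^ nodes \<phi>"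
proof (rule fps_ext)
  fix n
  have "{\<psi> \<in> {\<phi>}. nodes \<psi> = n} = (if n = nodes \<phi> then {\<phi>} else {})" by auto
  thus "gf {\<phi>} $ n = (fps_X ^ nodes \<phi>) $ n" by (simp add: gf_def fps_X_power_nth)
qed

lemma gf_image_Times:
  assumes inj: "inj_on f (A \<times> B)"
    and nodes: "\<And>a b. nodes (f (a, b)) = k + nodes a + nodes b"
  shows "gf (f ` (A \<times> B)) = fps_X ^ k * (gf A * gf B)"
proof (rule fps_ext)
  fix n
  show "gf (f ` (A \<times> B)) $ n = (fps_X ^ k * (gf A * gf B)) $ n"
  proof (cases "n < k")
    case True
    hence "{\<phi> \<in> f ` (A \<times> B). nodes \<phi> = n} = {}" using nodes by auto
    hence "card {\<phi> \<in> f ` (A \<times> B). nodes \<phi> = n} = 0" by (simp only: card.empty)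
    thus ?thesis using True by (simp add: gf_def fps_X_power_mult_nth)
  next
    case False
    define m where "m = n - k"
    have n: "n = k + m" using False by (simp add: m_def)
    let ?A = "\<lambda>i. {\<phi> \<in> A. nodes \<phi> = i}" and ?B = "\<lambda>i. {\<phi> \<in> B. nodes \<phi> = i}"
    have fin: "finite (?A i)" "finite (?B i)" for i
      by (auto intro: finite_subset[OF _ finite_forests[of i]])
    have "{\<phi> \<in> f ` (A \<times> B). nodes \<phi> = n} = f ` (\<Union>i\<in>{0..m}. ?A i \<times> ?B (m - i))"
    proof (intro equalityI subsetI)
      fix \<chi> assume "\<chi> \<in> {\<phi> \<in> f ` (A \<times> B). nodes \<phi> = n}"
      then obtain a b where ab: "a \<in> A" "b \<in> B" "\<chi> = f (a, b)" "nodes (f (a, b)) = n" by auto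
      hence "nodes a \<in> {0..m}" "nodes b = m - nodes a" using nodes[of a b] n by auto
      thus "\<chi> \<in> f ` (\<Union>i\<in>{0..m}. ?A i \<times> ?B (m - i))" using ab by blast
    next
      fix \<chi> assume "\<chi> \<in> f ` (\<Union>i\<in>{0..m}. ?A i \<times> ?B (m - i))"
      then obtain a b i where "i \<le> m" "a \<in> ?A i" "b \<in> ?B (m - i)" "\<chi> = f (a, b)" by auto
      thus "\<chi> \<in> {\<phi> \<in> f ` (A \<times> B). nodes \<phi> = n}" using nodes[of a b] n by auto
    qed
    moreover have "inj_on f (\<Union>i\<in>{0..m}. ?A i \<times> ?B (m - i))"
      by (rule inj_on_subset[OF inj]) auto
    ultimately have "card {\<phi> \<in> f ` (A \<times> B). nodes \<phi> = n} = card (\<Union>i\<in>{0..m}. ?A i \<times> ?B (m - i))"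
      by (simp add: card_image)
    also have "\<dots> = (\<Sum>i\<in>{0..m}. card (?A i \<times> ?B (m - i)))"
      by (rule card_UN_disjoint) (use fin in auto)
    finally have "gf (f ` (A \<times> B)) $ n = (gf A * gf B) $ m"
      by (simp add: gf_def fps_mult_nth card_cartesian_product)
    thus ?thesis using False by (simp add: fps_X_power_mult_nth m_def)
  qed
qed

section \<open>Equations between the generating functions\<close>

definition win_forests :: "tree list set" where "win_forests = {\<phi>. wins \<phi>}"
text \<open>Trees appear as one-element forests because \<open>gf\<close> and \<open>nodes\<close>
  are made for forests.\<close>

definition win_trees :: "tree list set" where "win_trees = {[t] | t. win t}"
definition odd_win_forests :: "tree list set" where
  "odd_win_forests = {\<phi>. wins \<phi> \<and> odd (length \<phi>)}"
definition even_win_forests :: "tree list set" where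
  "even_win_forests = {\<phi>. wins \<phi> \<and> even (length \<phi>)}"

lemma gf_append_win_trees:
  assumes "C = {t # \<phi> | t \<phi>. win t \<and> \<phi> \<in> A}"
  shows "gf C = gf win_trees * gf A"
proof -
  have "C = (\<lambda>(\<tau>, \<phi>). \<tau> @ \<phi>) ` (win_trees \<times> A)"
  proof (intro equalityI subsetI)
    fix \<chi> assume "\<chi> \<in> C"
    then obtain t \<phi> where "\<chi> = t # \<phi>" "win t" "\<phi> \<in> A" using assms by blast
    hence "\<chi> = (\<lambda>(\<tau>, \<phi>). \<tau> @ \<phi>) ([t], \<phi>)" "([t], \<phi>) \<in> win_trees \<times> A"
      by (auto simp: win_trees_def)
    thus "\<chi> \<in> (\<lambda>(\<tau>, \<phi>). \<tau> @ \<phi>) ` (win_trees \<times> A)" by (rule image_eqI)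
  qed (auto simp: assms win_trees_def)
  moreover have "inj_on (\<lambda>(\<tau>, \<phi>). \<tau> @ \<phi>) (win_trees \<times> A)"
    by (auto simp: inj_on_def win_trees_def)
  ultimately show ?thesis
    using gf_image_Times[of "\<lambda>(\<tau>, \<phi>). \<tau> @ \<phi>" win_trees A 0] by simp
qed

lemma gf_win_forests: "gf win_forests = 1 + gf win_trees * gf win_forests"
proof -
  have eq: "win_forests = {[]} \<union> {t # \<phi> | t \<phi>. win t \<and> \<phi> \<in> win_forests}" (is "_ = _ \<union> ?C")
  proof (rule Set.set_eqI)
    fix \<phi> show "\<phi> \<in> win_forests \<longleftrightarrow> \<phi> \<in> {[]} \<union> ?C" by (cases \<phi>) (auto simp: win_forests_def)
  qed
  have "gf win_forests = gf ({[]} \<union> ?C)" using eq by (rule arg_cong)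
  also have "\<dots> = gf {[]} + gf ?C" by (rule gf_Un) blast
  also have "gf {[]} = 1" by (simp add: gf_single)
  also have "gf ?C = gf win_trees * gf win_forests" by (rule gf_append_win_trees) (rule refl)
  finally show ?thesis .
qed

lemma gf_even_win_forests: "gf even_win_forests = 1 + gf win_trees * gf odd_win_forests"
proof -
  have eq: "even_win_forests = {[]} \<union> {t # \<phi> | t \<phi>. win t \<and> \<phi> \<in> odd_win_forests}" (is "_ = _ \<union> ?C")
  proof (rule Set.set_eqI)
    fix \<phi> show "\<phi> \<in> even_win_forests \<longleftrightarrow> \<phi> \<in> {[]} \<union> ?C"
      by (cases \<phi>) (auto simp: even_win_forests_def odd_win_forests_def)
  qed
  have "gf even_win_forests = gf ({[]} \<union> ?C)" using eq by (rule arg_cong)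
  also have "\<dots> = gf {[]} + gf ?C" by (rule gf_Un) blast
  also have "gf {[]} = 1" by (simp add: gf_single)
  also have "gf ?C = gf win_trees * gf odd_win_forests" by (rule gf_append_win_trees) (rule refl)
  finally show ?thesis .
qed

lemma gf_odd_win_forests: "gf odd_win_forests = gf win_trees * gf even_win_forests"
proof (rule gf_append_win_trees, rule Set.set_eqI)
  fix \<phi> show "\<phi> \<in> odd_win_forests \<longleftrightarrow> \<phi> \<in> {t # \<phi> | t \<phi>. win t \<and> \<phi> \<in> even_win_forests}"
    by (cases \<phi>) (auto simp: even_win_forests_def odd_win_forests_def)
qed

text \<open>Besides the leaf, a winning tree consists of a root and a last child, counted by
  \<open>fps_X ^ 2\<close>, an odd list of further winning children, and a winning forest below the
  last child.\<close>

lemma gf_win_trees: "gf win_trees = fps_X + fps_X ^ 2 * (gf odd_win_forests * gf win_forests)"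
proof -
  let ?f = "\<lambda>(\<phi>, \<psi>). [Node (\<phi> @ [Node \<psi>])]"
  have eq: "win_trees = {[Node []]} \<union> ?f ` (odd_win_forests \<times> win_forests)"
  proof (rule Set.set_eqI)
    fix \<phi> show "\<phi> \<in> win_trees \<longleftrightarrow> \<phi> \<in> {[Node []]} \<union> ?f ` (odd_win_forests \<times> win_forests)"
    proof
      assume "\<phi> \<in> win_trees"
      then obtain t where t: "\<phi> = [t]" "win t" unfolding win_trees_def by blast
      obtain \<chi> where \<chi>: "t = Node \<chi>" by (cases t)
      have \<phi>: "\<phi> = [Node \<chi>]" "win (Node \<chi>)" using t \<chi> by simp_all
      show "\<phi> \<in> {[Node []]} \<union> ?f ` (odd_win_forests \<times> win_forests)"
      proof (cases \<chi> rule: rev_cases)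
        case (snoc \<omega> t)
        moreover obtain \<psi> where "t = Node \<psi>" by (cases t)
        ultimately have "\<omega> \<in> odd_win_forests" "\<psi> \<in> win_forests" "\<phi> = ?f (\<omega>, \<psi>)"
          using \<phi> by (auto simp: win_Node odd_win_forests_def win_forests_def)
        thus ?thesis by blast
      qed (use \<phi> in auto)
    next
      assume "\<phi> \<in> {[Node []]} \<union> ?f ` (odd_win_forests \<times> win_forests)"
      then consider "\<phi> = [Node []]"
        | \<omega> \<psi> where "\<phi> = [Node (\<omega> @ [Node \<psi>])]" "\<omega> \<in> odd_win_forests" "\<psi> \<in> win_forests"
        by auto
      thus "\<phi> \<in> win_trees"
      proof cases
        case 1
        thus ?thesis by (simp add: win_trees_def win_Node)
      next
        case 2
        hence "win (Node (\<omega> @ [Node \<psi>]))"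
          by (simp add: win_Node[of "\<omega> @ [Node \<psi>]"] odd_win_forests_def win_forests_def)
        thus ?thesis using 2 by (simp add: win_trees_def)
      qed
    qed
  qed
  have inj: "inj_on ?f (odd_win_forests \<times> win_forests)" by (auto simp: inj_on_def)
  have "gf win_trees = gf ({[Node []]} \<union> ?f ` (odd_win_forests \<times> win_forests))"
    using eq by (rule arg_cong)
  also have "\<dots> = gf {[Node []]} + gf (?f ` (odd_win_forests \<times> win_forests))"
    by (rule gf_Un) auto
  also have "gf {[Node []]} = fps_X" by (simp add: gf_single)
  also have "gf (?f ` (odd_win_forests \<times> win_forests))
      = fps_X ^ 2 * (gf odd_win_forests * gf win_forests)"
    by (rule gf_image_Times[OF inj]) auto
  finally show ?thesis .
qed

lemma card_Eeta_wins_Tam_gf: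
  "of_nat (card (finite_lattice.Eeta_wins (Tam n))) = gf win_forests $ n"
  by (simp only: card_Eeta_wins_Tam gf_def fps_nth_Abs_fps win_forests_def mem_Collect_eq conj_commute)

lemma gf_win_forests_nth_0: "gf win_forests $ 0 = 1"
proof -
  have "{\<phi> \<in> win_forests. nodes \<phi> = 0} = {[]}" by (auto simp: win_forests_def)
  thus ?thesis by (simp only: gf_def fps_nth_Abs_fps) simp
qed

lemma Eeta_Tam_gf_eq: "Eeta_Tam_gf = gf win_forests - 1"
  by (rule fps_ext) (simp add: Eeta_Tam_gf_def card_Eeta_wins_Tam_gf gf_win_forests_nth_0)

text \<open>Elimination without division, as no element is assumed invertible. The relations become
  C (1 + y) = y and D (1 + C) = y; multiplying the equation for C by (1 + y)^2 (1 + C) leaves (1 +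
  2y) (y - X (1 + y)) = X^2 (1 + y)^3 y.\<close>

lemma win_system_quartic:
  fixes C D X y :: "'a :: comm_ring_1"
  assumes L: "1 + y = 1 + C * (1 + y)" and D: "D = C * (1 + C * D)"
    and C: "C = X + X\<^sup>2 * (D * (1 + y))"
  shows "X + (- 1 + 3 * X + X\<^sup>2) * y + (- 2 + 2 * X + 3 * X\<^sup>2) * y ^ 2
    + 3 * X\<^sup>2 * y ^ 3 + X\<^sup>2 * y ^ 4 = 0"
proof -
  have y: "C * (1 + y) = y" using L by simp
  \<comment> \<open>The inserted factor equals 1 because C (1 + y) = y.\<close>
  have "D * (1 + C) = D * (1 + C) * (1 + y - C * (1 + y))"
    unfolding y by simp
  also have "\<dots> = (D - C * C * D) * (1 + y)" by (simp add: algebra_simps power2_eq_square power3_eq_cube power4_eq_xxxx)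
  also have "D - C * C * D = C" by (subst (1) D) (simp add: algebra_simps)
  also have "C * (1 + y) = y" by (fact y)
  finally have D': "D * (1 + C) = y" .
  have "(1 + 2 * y) * (y - X * (1 + y)) = (1 + y + C * (1 + y)) * (C * (1 + y) - X * (1 + y))"
    unfolding y by (simp add: algebra_simps power2_eq_square power3_eq_cube power4_eq_xxxx)
  also have "\<dots> = (1 + y)^2 * (1 + C) * (C - X)" by (simp add: algebra_simps power2_eq_square power3_eq_cube power4_eq_xxxx)
  also have "C - X = X\<^sup>2 * (D * (1 + y))" by (subst (1) C) simp
  also have "(1 + y)^2 * (1 + C) * (X\<^sup>2 * (D * (1 + y))) = X\<^sup>2 * (1 + y) ^ 3 * (D * (1 + C))"
    by (simp add: algebra_simps power2_eq_square power3_eq_cube power4_eq_xxxx)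
  finally have "(1 + 2 * y) * (y - X * (1 + y)) = X\<^sup>2 * (1 + y) ^ 3 * y" unfolding D' .
  moreover have "X + (- 1 + 3 * X + X\<^sup>2) * y + (- 2 + 2 * X + 3 * X\<^sup>2) * y ^ 2
    + 3 * X\<^sup>2 * y ^ 3 + X\<^sup>2 * y ^ 4 = X\<^sup>2 * (1 + y) ^ 3 * y - (1 + 2 * y) * (y - X * (1 + y))"
    by (simp add: algebra_simps power2_eq_square power3_eq_cube power4_eq_xxxx)
  ultimately show ?thesis by simp
qed

lemma gf_win_forests_quartic:
  fixes y :: "'a :: comm_ring_1 fps"
  assumes y: "y = gf win_forests - 1"
  shows "fps_X + (- 1 + 3 * fps_X + fps_X\<^sup>2) * y + (- 2 + 2 * fps_X + 3 * fps_X\<^sup>2) * y ^ 2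
    + 3 * fps_X\<^sup>2 * y ^ 3 + fps_X\<^sup>2 * y ^ 4 = 0"
proof (rule win_system_quartic)
  have eq: "1 + y = gf win_forests" using y by simp
  show "1 + y = 1 + gf win_trees * (1 + y)"
    unfolding eq by (rule gf_win_forests)
  show "gf odd_win_forests = gf win_trees * (1 + gf win_trees * gf odd_win_forests)"
    unfolding gf_even_win_forests[symmetric] by (rule gf_odd_win_forests)
  show "gf win_trees = fps_X + fps_X\<^sup>2 * (gf odd_win_forests * (1 + y))"
    unfolding eq by (rule gf_win_trees)
qed

lemma annihilates_Q_poly_iff:
  "annihilates Q_poly f \<longleftrightarrow> fps_X + (- 1 + 3 * fps_X + fps_X\<^sup>2) * f
    + (- 2 + 2 * fps_X + 3 * fps_X\<^sup>2) * f ^ 2 + 3 * fps_X\<^sup>2 * f ^ 3 + fps_X\<^sup>2 * f ^ 4 = 0"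
proof -
  have c: "fps_const (- 1 :: complex) = - 1" "fps_const (- 2 :: complex) = - 2"
    by (simp_all add: fps_eq_iff fps_numeral_nth)
  have "fps_of_poly [:-1, 3, 1:] = (- 1 + 3 * fps_X + fps_X\<^sup>2 :: complex fps)"
    "fps_of_poly [:-2, 2, 3:] = (- 2 + 2 * fps_X + 3 * fps_X\<^sup>2 :: complex fps)"
    "fps_of_poly [:0, 0, 3:] = (3 * fps_X\<^sup>2 :: complex fps)"
    "fps_of_poly [:0, 0, 1:] = (fps_X\<^sup>2 :: complex fps)"
    "fps_of_poly [:0, 1:] = (fps_X :: complex fps)"
    by (simp_all add: fps_of_poly_pCons c power2_eq_square distrib_left mult_ac add_ac)
  hence "poly (map_poly fps_of_poly Q_poly) f = fps_X + f * (- 1 + 3 * fps_X + fps_X\<^sup>2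
      + f * (- 2 + 2 * fps_X + 3 * fps_X\<^sup>2 + f * (3 * fps_X\<^sup>2 + f * fps_X\<^sup>2)))"
    by (simp only: Q_poly_def map_poly_pCons fps_of_poly_0 map_poly_0 poly_pCons poly_0 mult_zero_right add_0_right)
  also have "\<dots> = fps_X + (- 1 + 3 * fps_X + fps_X\<^sup>2) * f
    + (- 2 + 2 * fps_X + 3 * fps_X\<^sup>2) * f ^ 2 + 3 * fps_X\<^sup>2 * f ^ 3 + fps_X\<^sup>2 * f ^ 4"
    by (simp add: algebra_simps power2_eq_square power3_eq_cube power4_eq_xxxx)
  finally show ?thesis by (simp add: annihilates_def)
qed

lemma annihilates_Q_poly: "annihilates Q_poly Eeta_Tam_gf"
  unfolding annihilates_Q_poly_iff by (rule gf_win_forests_quartic[OF Eeta_Tam_gf_eq])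

subsection \<open>Algebraic degree\<close>

definition fps_poly_eval :: "'a::comm_ring_1 poly poly \<Rightarrow> 'a fps \<Rightarrow> 'a fps" where
  "fps_poly_eval P f = poly (map_poly fps_of_poly P) f"

lemma fps_poly_eval_0 [simp]: "fps_poly_eval 0 f = 0"
  by (simp add: fps_poly_eval_def)

lemma fps_poly_eval_pCons [simp]: "fps_poly_eval (pCons p P) f = fps_of_poly p + f * fps_poly_eval P f"
  by (simp add: fps_poly_eval_def map_poly_pCons)

lemma fps_poly_eval_add: "fps_poly_eval (P + R) f = fps_poly_eval P f + fps_poly_eval R f"
proof (induction P arbitrary: R)
  case (pCons p P)
  obtain a q where R: "R = pCons a q" by (cases R)
  show ?case unfolding R add_pCons fps_poly_eval_pCons pCons.IH fps_of_poly_add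
    by (simp add: algebra_simps)
qed simp

lemma fps_poly_eval_smult: "fps_poly_eval (smult p P) f = fps_of_poly p * fps_poly_eval P f"
  by (induction P) (simp_all add: fps_of_poly_mult algebra_simps)

lemma fps_poly_eval_mult: "fps_poly_eval (P * R) f = fps_poly_eval P f * fps_poly_eval R f"
  by (induction P) (simp_all add: fps_poly_eval_add fps_poly_eval_smult algebra_simps)

lemma annihilates_iff: "annihilates P f \<longleftrightarrow> fps_poly_eval P f = 0"
  by (simp add: annihilates_def fps_poly_eval_def)

lemma fps_poly_eval_consts: "fps_poly_eval (map_poly (\<lambda>c. [:c:]) p) g = fps_of_poly p oo g"
  if "g $ 0 = 0" for g :: "'a :: idom fps"
proof (induction p)
  case (pCons a p)
  thus ?case using that
    by (simp add: map_poly_pCons fps_of_poly_pCons fps_of_poly_const fps_compose_add_distrib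
        fps_compose_mult_distrib mult.commute)
qed simp

text \<open>Interchanging the two variables turns a relation for \<open>f\<close> into one for its compositional
  inverse \<open>g\<close>.\<close>

lemma ex_swapped_relation:
  fixes f g :: "'a :: idom fps"
  assumes g0: "g $ 0 = 0" and fg: "f oo g = fps_X"
  shows "\<exists>M. fps_poly_eval M g = fps_poly_eval P f oo g \<and>
    (\<forall>j. degree (coeff M j) \<le> degree P) \<and> (M = 0 \<longleftrightarrow> P = 0)"
proof (induction P)
  case 0
  show ?case by (intro exI[of _ 0]) simp
next
  case (pCons p P)
  then obtain M where M: "fps_poly_eval M g = fps_poly_eval P f oo g"
    "\<forall>j. degree (coeff M j) \<le> degree P" "M = 0 \<longleftrightarrow> P = 0" by blast
  define N where "N = map_poly (\<lambda>c. [:c:]) p + smult [:0, 1:] M"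
  have N: "coeff N j = pCons (coeff p j) (coeff M j)" for j
    by (simp add: N_def coeff_map_poly)
  have "fps_poly_eval N g = fps_poly_eval (pCons p P) f oo g"
    using M(1) g0 fg
    by (simp add: N_def fps_poly_eval_add fps_poly_eval_smult fps_poly_eval_consts
        fps_compose_add_distrib fps_compose_mult_distrib)
  moreover have "degree (coeff N j) \<le> degree (pCons p P)" for j
  proof (cases "P = 0")
    case False
    have "degree (coeff N j) \<le> Suc (degree (coeff M j))" unfolding N by (rule degree_pCons_le)
    thus ?thesis using False M(2)[rule_format, of j] by simp
  qed (use M in \<open>simp add: N\<close>)
  moreover have "N = 0 \<longleftrightarrow> pCons p P = 0"
  proof -
    have "N = 0 \<longleftrightarrow> (\<forall>j. coeff p j = 0 \<and> coeff M j = 0)"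
      unfolding poly_eq_iff[of N] N by simp
    also have "\<dots> \<longleftrightarrow> p = 0 \<and> M = 0" by (auto simp: poly_eq_iff)
    finally show ?thesis using M(3) by simp
  qed
  ultimately show ?case by blast
qed

text \<open>The coefficients of z^2, z and 1 when Q(y, z) is collected by powers of z; from here on
  the coefficient ring consists of polynomials in y.\<close>

definition Q_lead :: "complex poly" where "Q_lead = [:0, 1:] * [:1, 1:] ^ 3"
definition Q_mid :: "complex poly" where "Q_mid = [:1, 1:] * [:1, 2:]"
definition Q_const :: "complex poly" where "Q_const = - ([:0, 1:] * [:1, 2:])"

definition Q_swapped :: "complex poly poly" where "Q_swapped = [:Q_const, Q_mid, Q_lead:]"

lemma Q_lead_nonzero: "Q_lead \<noteq> 0"
  by (simp add: Q_lead_def)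

lemma Q_swapped_nonzero: "Q_swapped \<noteq> 0"
  using Q_lead_nonzero by (simp add: Q_swapped_def)

text \<open>The discriminant has a simple root at -1/2, so the right side would vanish there to odd
  order and the left side to even order.\<close>

lemma discriminant_not_square:
  assumes "q\<^sup>2 = u\<^sup>2 * (Q_mid\<^sup>2 - 4 * Q_lead * Q_const)"
  shows "u = 0"
proof (rule ccontr)
  assume u: "u \<noteq> 0"
  define D2 where "D2 = [:1, 1:]\<^sup>2 * ([:2:] * [:1, 2, 4, 4 :: complex:])"
  have D: "Q_mid\<^sup>2 - 4 * Q_lead * Q_const = [:- (- 1/2), 1:] * D2"
    by (simp add: Q_mid_def Q_lead_def Q_const_def D2_def power2_eq_square power3_eq_cube
        numeral_poly)
  have D2: "poly D2 (- 1/2) \<noteq> 0"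
    by (simp add: D2_def)
  hence D20: "D2 \<noteq> 0" by auto
  have ne: "[:- (- 1/2), 1 :: complex:] \<noteq> 0" by simp
  have "order (- 1/2) (q\<^sup>2) = order (- 1/2) (u\<^sup>2 * ([:- (- 1/2), 1:] * D2))"
    using assms D by simp
  also have "\<dots> = order (- 1/2) (u\<^sup>2) + (order (- 1/2) [:- (- 1/2), 1 :: complex:] + order (- 1/2) D2)"
  proof -
    have 1: "[:- (- 1/2), 1 :: complex:] * D2 \<noteq> 0" using D20 ne no_zero_divisors by blast
    hence 2: "u\<^sup>2 * ([:- (- 1/2), 1 :: complex:] * D2) \<noteq> 0"
      using u no_zero_divisors power_not_zero by blast
    show ?thesis by (simp only: order_mult[OF 1] order_mult[OF 2])
  qed
  also have "order (- 1/2) ([:- (- 1/2), 1 :: complex:]) = 1"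
    using order_power_n_n[of "-1/2 :: complex" 1] by simp
  also have "order (- 1/2) D2 = 0" using D2 by (simp add: order_root)
  finally have "order (- 1/2) (q * q) = order (- 1/2) (u * u) + 1"
    by (simp add: power2_eq_square)
  moreover have "q \<noteq> 0"
  proof
    assume "q = 0"
    hence "u\<^sup>2 * ([:- (- 1/2), 1:] * D2) = 0" using assms D by simp
    thus False using u D20 ne by (metis mult_eq_0_iff power_eq_0_iff)
  qed
  ultimately have "2 * order (- 1/2) q = 2 * order (- 1/2) u + 1"
    using u by (simp add: order_mult)
  thus False by presburger
qed

text \<open>A quotient g = -v/u solving the quadratic would make u^2 times the discriminant a
  square; this is the quadratic formula with denominators cleared.\<close>

lemma not_rational:
  assumes g: "fps_poly_eval Q_swapped g = 0" and uv: "fps_of_poly v + fps_of_poly u * g = 0"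
  shows "u = 0" "v = 0"
proof -
  let ?A = "fps_of_poly Q_lead" and ?B = "fps_of_poly Q_mid" and ?E = "fps_of_poly Q_const"
  let ?u = "fps_of_poly u" and ?v = "fps_of_poly v"
  have eq: "?E + g * (?B + g * ?A) = 0" using g by (simp add: Q_swapped_def)
  have v: "?v = - (?u * g)" using uv by (simp add: eq_neg_iff_add_eq_0)
  have "(2 * ?A * ?v - ?B * ?u)^2 - ?u\<^sup>2 * (?B\<^sup>2 - 4 * ?A * ?E) = 4 * ?A * ?u\<^sup>2 * (?E + g * (?B + g * ?A))"
    unfolding v by (simp add: power2_eq_square algebra_simps)
  hence "(2 * ?A * ?v - ?B * ?u)^2 = ?u\<^sup>2 * (?B\<^sup>2 - 4 * ?A * ?E)" by (simp add: eq)
  hence "fps_of_poly ((2 * Q_lead * v - Q_mid * u)^2) = fps_of_poly (u\<^sup>2 * (Q_mid\<^sup>2 - 4 * Q_lead * Q_const))"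
    by (simp add: fps_of_poly_mult fps_of_poly_diff fps_of_poly_power)
  hence "(2 * Q_lead * v - Q_mid * u)^2 = u\<^sup>2 * (Q_mid\<^sup>2 - 4 * Q_lead * Q_const)"
    by (simp only: fps_of_poly_eq_iff)
  thus u: "u = 0" by (rule discriminant_not_square)
  thus "v = 0" using uv fps_of_poly_eq_iff[of v 0] by simp
qed

text \<open>One step of Gauss's lemma: a prime of the coefficient ring stays prime as a constant
  polynomial.\<close>

lemma Q_swapped_cancel:
  assumes p: "prime_elem p" and nd: "\<not> [:p:] dvd Q_swapped" and eq: "smult p M = Q_swapped * R"
  shows "\<exists>R'. M = Q_swapped * R'"
proof -
  have p0: "p \<noteq> 0" using p by auto
  have "[:p:] dvd Q_swapped * R" by (rule dvdI[of _ _ M]) (simp flip: eq)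
  hence "[:p:] dvd R" using lift_prime_elem_poly[OF p] nd prime_elem_dvd_multD by blast
  then obtain R' where "R = [:p:] * R'" by (elim dvdE)
  hence R: "R = smult p R'" by simp
  have "smult p M = smult p (Q_swapped * R')" using eq R by simp
  thus ?thesis using p0 by (metis smult_cancel)
qed

text \<open>The only primes in \<open>Q_lead\<close> are y and 1 + y. The first does not divide
  \<open>Q_mid\<close> and the second does not divide \<open>Q_const\<close>, so both can be
  cancelled one factor at a time.\<close>

lemma Q_swapped_dvd_smult:
  assumes "smult (Q_lead ^ k) M = Q_swapped * R"
  shows "Q_swapped dvd M"
proof -
  have p: "prime_elem [:0, 1 :: complex:]" "prime_elem [:1, 1 :: complex:]"
    by (rule prime_elem_linear_field_poly; simp)+
  have nd1: "\<not> [:[:0, 1:]:] dvd Q_swapped"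
  proof
    assume "[:[:0, 1:]:] dvd Q_swapped"
    hence "[:0, 1:] dvd coeff Q_swapped 1" by (simp add: const_poly_dvd_iff)
    thus False by (simp add: Q_swapped_def Q_mid_def dvd_iff_poly_eq_0[of 0, simplified])
  qed
  have nd2: "\<not> [:[:1, 1:]:] dvd Q_swapped"
  proof
    assume "[:[:1, 1:]:] dvd Q_swapped"
    hence "[:1, 1:] dvd coeff Q_swapped 0" by (simp add: const_poly_dvd_iff)
    thus False using poly_eq_0_iff_dvd[of Q_const "-1"] by (simp add: Q_swapped_def Q_const_def)
  qed
  have "\<exists>R. M = Q_swapped * R" if "smult ([:0, 1:] ^ i * [:1, 1:] ^ j) M = Q_swapped * R" for i j M R
    using that
  proof (induction "i + j" arbitrary: i j M R)
    case 0
    thus ?case by auto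
  next
    case (Suc n)
    show ?case
    proof (cases i)
      case 0
      then obtain j' where j: "j = Suc j'" using Suc.hyps(2) by (cases j) auto
      have "smult [:1, 1:] (smult ([:0, 1:] ^ i * [:1, 1:] ^ j') M) = Q_swapped * R"
        using Suc.prems unfolding j by (simp only: smult_smult power_Suc mult_ac)
      then obtain R' where "smult ([:0, 1:] ^ i * [:1, 1:] ^ j') M = Q_swapped * R'"
        using Q_swapped_cancel[OF p(2)] nd2 by blast
      thus ?thesis using Suc.hyps(1)[of i j'] Suc.hyps(2) j by auto
    next
      case i: (Suc i')
      have "smult [:0, 1:] (smult ([:0, 1:] ^ i' * [:1, 1:] ^ j) M) = Q_swapped * R"
        using Suc.prems unfolding i by (simp only: smult_smult power_Suc mult_ac)
      then obtain R' where "smult ([:0, 1:] ^ i' * [:1, 1:] ^ j) M = Q_swapped * R'"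
        using Q_swapped_cancel[OF p(1)] nd1 by blast
      thus ?thesis using Suc.hyps(1)[of i' j] Suc.hyps(2) i by auto
    qed
  qed
  moreover have "smult ([:0, 1:] ^ k * [:1, 1:] ^ (3 * k)) M = Q_swapped * R"
    using assms unfolding Q_lead_def by (simp only: power_mult_distrib power_mult)
  ultimately show ?thesis unfolding dvd_def by blast
qed

text \<open>Pseudo-division leaves a remainder of degree below 2 that still vanishes at g, so it is
  zero by \<open>not_rational\<close>; the power of \<open>Q_lead\<close> introduced by the division
  is then cancelled.\<close>

lemma Q_swapped_dvd:
  assumes g: "fps_poly_eval Q_swapped g = 0" and M: "fps_poly_eval M g = 0"
  shows "Q_swapped dvd M"
proof -
  obtain q r where qr: "pseudo_divmod M Q_swapped = (q, r)" by (cases "pseudo_divmod M Q_swapped")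
  have deg: "degree Q_swapped = 2" "coeff Q_swapped 2 = Q_lead"
    using Q_lead_nonzero by (auto simp: Q_swapped_def numeral_2_eq_2)
  define k where "k = Suc (degree M) - degree Q_swapped"
  have eq: "smult (Q_lead ^ k) M = Q_swapped * q + r" and r: "r = 0 \<or> degree r < 2"
    using pseudo_divmod[OF Q_swapped_nonzero qr] deg by (auto simp: k_def)
  have "fps_poly_eval r g = 0"
    using arg_cong[OF eq, of "\<lambda>p. fps_poly_eval p g"] g M
    by (simp add: fps_poly_eval_add fps_poly_eval_smult fps_poly_eval_mult)
  moreover obtain v u where "r = [:v, u:]"
  proof -
    have "degree r < 2" using r by auto
    hence "r = [:coeff r 0, coeff r 1:]"
      by (intro poly_eqI) (auto simp: coeff_pCons coeff_eq_0 split: nat.splits)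
    thus ?thesis using that by blast
  qed
  ultimately have "r = 0" using not_rational[OF g, of v u] by (simp add: mult.commute)
  thus ?thesis using eq Q_swapped_dvd_smult by simp
qed

text \<open>Take a coefficient of N of maximal degree e. Two places higher in the product,
  \<open>Q_lead\<close> contributes degree 4 + e, and the other two contributions stay below because
  \<open>Q_mid\<close> and \<open>Q_const\<close> have degree at most 2.\<close>

lemma degree_multiple_of_Q_swapped:
  assumes "M = Q_swapped * N" "M \<noteq> 0"
  shows "\<exists>j. 4 \<le> degree (coeff M j)"
proof -
  have N0: "N \<noteq> 0" using assms by auto
  define e where "e = Max ((\<lambda>j. degree (coeff N j)) ` {..degree N})"
  have le: "degree (coeff N j) \<le> e" for j
    by (cases "j \<le> degree N") (auto simp: e_def coeff_eq_0)
  have "e \<in> (\<lambda>j. degree (coeff N j)) ` {..degree N}" unfolding e_def by (rule Max_in) auto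
  then obtain j0 where j0: "degree (coeff N j0) = e" by auto
  \<comment> \<open>A maximiser may be the zero polynomial, whose degree counts as 0. Then e = 0,
    and the leading coefficient of N serves instead.\<close>
  obtain j where j: "degree (coeff N j) = e" "coeff N j \<noteq> 0"
  proof (cases "coeff N j0 = 0")
    case True
    hence "e = 0" using j0 by simp
    hence "degree (coeff N (degree N)) = e" using le[of "degree N"] by simp
    thus ?thesis using that[of "degree N"] N0 by simp
  qed (use that j0 in blast)
  have coeff: "coeff M (Suc (Suc j)) = Q_lead * coeff N j + (Q_mid * coeff N (Suc j) + Q_const * coeff N (Suc (Suc j)))"
    unfolding assms(1) Q_swapped_def by (simp add: mult_pCons_left algebra_simps)
  have dl: "degree Q_lead = 4"
    by (simp add: Q_lead_def degree_mult_eq degree_power_eq)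
  have dm: "degree Q_mid \<le> 2" "degree Q_const \<le> 2"
    by (simp_all add: Q_mid_def Q_const_def)
  have 1: "degree (Q_lead * coeff N j) = 4 + e"
    using j dl Q_lead_nonzero by (simp add: degree_mult_eq)
  have "degree (Q_mid * coeff N (Suc j)) \<le> 2 + e"
    using degree_mult_le[of Q_mid "coeff N (Suc j)"] dm le[of "Suc j"] by linarith
  moreover have "degree (Q_const * coeff N (Suc (Suc j))) \<le> 2 + e"
    using degree_mult_le[of Q_const "coeff N (Suc (Suc j))"] dm le[of "Suc (Suc j)"] by linarith
  ultimately have "degree (Q_mid * coeff N (Suc j) + Q_const * coeff N (Suc (Suc j))) < 4 + e"
    by (meson degree_add_le le_less_trans add_less_mono1 numeral_less_iff order.trans add_strict_right_mono semiring_norm)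
  hence "degree (coeff M (Suc (Suc j))) = 4 + e"
    unfolding coeff using 1 degree_add_eq_left[of _ "Q_lead * coeff N j"] by simp
  thus ?thesis by (metis le_add1)
qed

lemma algebraic_of_degree_4:
  assumes f0: "f $ 0 = 0" and ann: "annihilates Q_poly f"
    and Q: "fps_X + (- 1 + 3 * fps_X + fps_X\<^sup>2) * f
    + (- 2 + 2 * fps_X + 3 * fps_X\<^sup>2) * f ^ 2 + 3 * fps_X\<^sup>2 * f ^ 3 + fps_X\<^sup>2 * f ^ 4 = 0" (is "?Q f fps_X = 0")
  shows "algebraic_of_degree f 4"
proof -
  \<comment> \<open>Comparing coefficients of z in the relation gives 1 - f $ 1 = 0, so f has a
    compositional inverse.\<close>
  have f1: "f $ 1 \<noteq> 0"
    using arg_cong[OF Q, of "\<lambda>h. h $ 1"] f0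
    by (simp add: fps_mult_nth power2_eq_square power3_eq_cube power4_eq_xxxx fps_numeral_nth)
  define g where "g = fps_inv f"
  have g0: "g $ 0 = 0" by (simp add: g_def fps_inv_def)
  have fg: "f oo g = fps_X" unfolding g_def using fps_inv_right[OF f0 f1] .
  have num: "numeral k oo g = (numeral k :: complex fps)" for k
    by (metis fps_const_compose numeral_fps_const)
  have "?Q f fps_X oo g = 0" unfolding Q by simp
  hence "?Q fps_X g = 0"
    by (simp add: fps_compose_add_distrib fps_compose_mult_distrib[OF g0] fps_compose_power[OF g0, symmetric] fps_compose_sub_distrib
        fps_compose_uminus g0 fg num)
  moreover have "fps_poly_eval Q_swapped g = ?Q fps_X g"
  proof -
    have "fps_of_poly [:1, 1 :: complex:] = 1 + fps_X" "fps_of_poly [:1, 2 :: complex:] = 1 + 2 * fps_X"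
      by (simp_all add: fps_of_poly_pCons)
    hence "fps_poly_eval Q_swapped g = - (fps_X * (1 + 2 * fps_X)) + g * ((1 + fps_X) * (1 + 2 * fps_X)
        + g * (fps_X * (1 + fps_X) ^ 3))"
      by (simp only: Q_swapped_def Q_lead_def Q_mid_def Q_const_def fps_poly_eval_pCons fps_poly_eval_0
          fps_of_poly_mult fps_of_poly_power fps_of_poly_uminus fps_of_poly_fps_X mult_zero_right add_0_right)
    thus ?thesis
      by (simp add: power2_eq_square power3_eq_cube power4_eq_xxxx algebra_simps)
  qed
  ultimately have g: "fps_poly_eval Q_swapped g = 0" by simp
  have "4 \<le> degree P" if P: "P \<noteq> 0" "annihilates P f" for P
  proof -
    obtain M where M: "fps_poly_eval M g = fps_poly_eval P f oo g"
        "\<forall>j. degree (coeff M j) \<le> degree P" "M = 0 \<longleftrightarrow> P = 0"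
      using ex_swapped_relation[OF g0 fg, of P] by blast
    have "fps_poly_eval M g = 0" using M P by (simp add: annihilates_iff)
    then obtain N where "M = Q_swapped * N" using Q_swapped_dvd[OF g] unfolding dvd_def by blast
    then obtain j where "4 \<le> degree (coeff M j)" using degree_multiple_of_Q_swapped M P by blast
    thus ?thesis using M(2) le_trans by blast
  qed
  moreover have "degree Q_poly = 4" "Q_poly \<noteq> 0" by (simp_all add: Q_poly_def)
  ultimately show ?thesis using ann unfolding algebraic_of_degree_def by blast
qed

subsection \<open>The critical point\<close>

text \<open>Eliminating \<open>r\<close> from \<open>k = r + r\<^sup>2 K(k)\<close> and \<open>1 = r\<^sup>2 K'(k)\<close>, where
  \<open>K(c) = c / ((1 - c)\<^sup>2 (1 + c))\<close>, leaves this equation for \<open>k\<close>, and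
  \<open>r = k\<^sup>2 (1 + 3k) / (1 + k + 2k\<^sup>2)\<close>.\<close>

definition critical_poly :: "real \<Rightarrow> real" where
  "critical_poly k = 2*k^7 + 8*k^6 + 2*k^5 + 2*k^4 + 2*k^3 + k^2 - 1"

lemma ex_critical: "\<exists>k::real. 0.52700329 < k \<and> k < 0.52700330 \<and> critical_poly k = 0"
proof -
  let ?a = "0.52700329 :: real" and ?b = "0.52700330 :: real"
  have ab: "critical_poly ?a < 0" "0 < critical_poly ?b"
    by (simp_all add: critical_poly_def power_divide)
  have "\<exists>x\<ge>?a. x \<le> ?b \<and> critical_poly x = 0"
    by (rule IVT') (use ab in \<open>auto simp: critical_poly_def intro!: continuous_intros\<close>)
  then obtain x where x: "?a \<le> x" "x \<le> ?b" "critical_poly x = 0" by blast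
  moreover have "x \<noteq> ?a" "x \<noteq> ?b" using x(3) ab less_irrefl by metis+
  ultimately show ?thesis by (intro exI[of _ x]) auto
qed

text \<open>The left side is the growth polynomial, homogenised, at numerator and denominator of 1 /
  r; the long factor on the right is its quotient by \<open>critical_poly\<close>.\<close>

lemma critical_rho_identity:
  fixes k :: real
  shows "32*(1 + k + 2*k^2)^7 - 32*(1 + k + 2*k^2)^6*(k^2*(1 + 3*k)) - 155*(1 + k + 2*k^2)^5*(k^2*(1 + 3*k))^2
    - 20*(1 + k + 2*k^2)^4*(k^2*(1 + 3*k))^3 - 148*(1 + k + 2*k^2)^3*(k^2*(1 + 3*k))^4
    + 60*(1 + k + 2*k^2)^2*(k^2*(1 + 3*k))^5 - 8*(1 + k + 2*k^2)*(k^2*(1 + 3*k))^6 - 4*(k^2*(1 + 3*k))^7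
    = critical_poly k * (-32 - 224*k - 1120*k^2 - 3808*k^3 - 10565*k^4 - 22775*k^5 - 40824*k^6 - 57040*k^7 - 64005*k^8 - 50805*k^9 - 27324*k^10 - 3078*k^11 + 2916*k^12 + 1458*k^13 - 4374*k^14)"
  unfolding critical_poly_def by algebra

text \<open>The square of the constant \<open>\<gamma>\<close> is a rational function of the root \<open>k\<close>; this is its
  reduction modulo \<open>critical_poly\<close>, whose positive coefficients make it monotone.\<close>

definition critical_gamma_sq :: "real \<Rightarrow> real" where
  "critical_gamma_sq k = (518517 + 1126001*k + 1662664*k^2 + 1976382*k^3 + 2389564*k^4 + 2623010*k^5 + 555282*k^6) / 1993216"

text \<open>Links the reduced form to the rational function in which the square of \<gamma> arises
  in \<open>w0_gamma\<close>, with the denominator cleared.\<close>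

lemma critical_gamma_sq_eq:
  assumes "critical_poly k = 0"
  shows "critical_gamma_sq k * (4*(1 - k)^5*(1 + k + 2*k^2)*(1 + 5*k + 3*k^2 + 3*k^3))
    = k^2*(1 + 3*k)*(1 + 5*k^4 + 2*k^5)"
proof -
  have "critical_gamma_sq k * (4*(1 - k)^5*(1 + k + 2*k^2)*(1 + 5*k + 3*k^2 + 3*k^3))
      - k^2*(1 + 3*k)*(1 + 5*k^4 + 2*k^5) = critical_poly k * ((-518517 - 1644518*k + 2376292*k^2 - 1861948*k^3 + 5776342*k^4 - 9936636*k^5 + 6920780*k^6 - 5067372*k^7 + 4624815*k^8 - 1665846*k^9) / 498304)"
    unfolding critical_gamma_sq_def critical_poly_def by (simp add: field_simps) algebra
  thus ?thesis using assms by simp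
qed

text \<open>Expanding directly would give degree 42 in k. Horner's scheme is used instead, every
  step being reduced modulo \<open>critical_poly\<close>: \<open>A6\<close> to \<open>A1\<close> are
  the remainders, of degree at most 6, and the right-hand cofactors the quotients.\<close>

lemma critical_gamma_sq_root:
  assumes "critical_poly k = 0"
  defines "G \<equiv> critical_gamma_sq k"
  shows "17348952064*G^7 - 11927404544*G^6 - 6678731520*G^5 - 886278144*G^4 - 33824320*G^3
    - 516144*G^2 + 4048*G + 11 = 0"
proof -
  define A6 where "A6 = (-7414232576 + 9800712704*k + 14471827456*k^2 + 17202428928*k^3 + 20798765056*k^4 + 22830679040*k^5 + 4833174528*k^6)"
  have s6: "17348952064 * G - 11927404544 = A6"
    unfolding G_def critical_gamma_sq_def A6_def by (simp add: field_simps)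
  define A5 where "A5 = (-4062835200 + 3973137920*k + 4499620352*k^2 + 4246573056*k^3 + 5456282624*k^4 + 11411680768*k^5 + 2691778560*k^6)"
  have "A6 * G - 6678731520 - A5 = critical_poly k * ((1040722889703 + 1285146968982*k + 1357426934838*k^2 + 1253467398248*k^3 + 839834039772*k^4 + 154169049762*k^5) / 229)"
    unfolding G_def critical_gamma_sq_def critical_poly_def A6_def A5_def by (simp add: field_simps) algebra
  hence s5: "A6 * G - 6678731520 = A5" using assms(1) by simp
  define A4 where "A4 = (-463572864 + 445054464*k + 412806400*k^2 + 330036352*k^3 + 262593536*k^4 + 1677510656*k^5 + 428867072*k^6)"
  have "A5 * G - 886278144 - A4 = critical_poly k * ((5760140716365 + 6643958245482*k + 7266107960973*k^2 + 8033492357441*k^3 + 7244607686979*k^4 + 1459664240580*k^5) / 3893)"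
    unfolding G_def critical_gamma_sq_def critical_poly_def A5_def A4_def by (simp add: field_simps) algebra
  hence s4: "A5 * G - 886278144 = A4" using assms(1) by simp
  define A3 where "A3 = (-13363360 + 10042272*k + 10991232*k^2 + 22476864*k^3 - 12791680*k^4 + 68243392*k^5 + 19264896*k^6)"
  have "A4 * G - 33824320 - A3 = critical_poly k * ((2196511902891 + 2431497032451*k + 2801940841989*k^2 + 3582898927172*k^3 + 4311896205916*k^4 + 930242833884*k^5) / 15572)"
    unfolding G_def critical_gamma_sq_def critical_poly_def A4_def A3_def by (simp add: field_simps) algebra
  hence s3: "A4 * G - 33824320 = A3" using assms(1) by simp
  define A2 where "A2 = (-113744 + 198016*k - 228320*k^2 + 484160*k^3 - 369264*k^4 + 559712*k^5 + 183552*k^6)"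
  have "A3 * G - 516144 - A2 = critical_poly k * ((241599982985 + 319836144756*k + 390254281632*k^2 + 385799897462*k^3 + 713070970794*k^4 + 167147655948*k^5) / 62288)"
    unfolding G_def critical_gamma_sq_def critical_poly_def A3_def A2_def by (simp add: field_simps) algebra
  hence s2: "A3 * G - 516144 = A2" using assms(1) by simp
  define A1 where "A1 = (-190 + 390*k - 548*k^2 + 956*k^3 - 744*k^4 + 916*k^5 + 316*k^6)"
  have "A2 * G + 4048 - A1 = critical_poly k * ((3158184265 + 1636159357*k + 8373644207*k^2 + 1922302367*k^3 + 12017632614*k^4 + 3185097552*k^5) / 124576)"
    unfolding G_def critical_gamma_sq_def critical_poly_def A2_def A1_def by (simp add: field_simps) algebra
  hence s1: "A2 * G + 4048 = A1" using assms(1) by simp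
  have "A1 * G + 11 - 0 = critical_poly k * ((38296427 + 5859280*k + 118752970*k^2 + 6662092*k^3 + 158908256*k^4 + 43867278*k^5) / 996608)"
    unfolding G_def critical_gamma_sq_def critical_poly_def A1_def by (simp add: field_simps) algebra
  hence s0: "A1 * G + 11 = 0" using assms(1) by simp
  have "17348952064*G^7 - 11927404544*G^6 - 6678731520*G^5 - 886278144*G^4 - 33824320*G^3
      - 516144*G^2 + 4048*G + 11
    = ((((((17348952064*G - 11927404544)*G - 6678731520)*G - 886278144)*G - 33824320)*G - 516144)*G + 4048)*G + 11"
    by algebra
  also have "\<dots> = 0" unfolding s6 s5 s4 s3 s2 s1 s0 ..
  finally show ?thesis .
qed

lemma critical_gamma_sq_bounds:
  assumes "0.52700329 < k" "k < 0.52700330"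
  shows "1.042395^2 < critical_gamma_sq k" "critical_gamma_sq k < 1.042405^2"
proof -
  have mono: "critical_gamma_sq x \<le> critical_gamma_sq y" if "0 \<le> x" "x \<le> y" for x y
    unfolding critical_gamma_sq_def using that
    by (intro divide_right_mono add_mono mult_left_mono power_mono) auto
  have "1.042395^2 < critical_gamma_sq 0.52700329"
    by (simp add: critical_gamma_sq_def power_divide)
  also have "\<dots> \<le> critical_gamma_sq k" using assms by (intro mono) auto
  finally show "1.042395^2 < critical_gamma_sq k" .
  have "critical_gamma_sq k \<le> critical_gamma_sq 0.52700330" using assms by (intro mono) auto
  also have "\<dots> < 1.042405^2" by (simp add: critical_gamma_sq_def power_divide)
  finally show "critical_gamma_sq k < 1.042405^2" .
qed

section \<open>The growth constant\<close>

definition growth_poly :: "real \<Rightarrow> real" where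
  "growth_poly x = 32*x^7 - 32*x^6 - 155*x^5 - 20*x^4 - 148*x^3 + 60*x^2 - 8*x - 4"

lemma growth_poly_root:
  assumes k: "critical_poly k = 0" "0 < k" and x: "x = (1 + k + 2*k^2) / (k^2*(1 + 3*k))"
  shows "growth_poly x = 0"
proof -
  define D where "D = k^2*(1 + 3*k)"
  have D: "D \<noteq> 0" using k(2) by (auto simp: D_def)
  have N: "1 + k + 2*k^2 = x*D" using D x by (simp add: D_def)
  have "D^7 * growth_poly x = 32*(x*D)^7 - 32*(x*D)^6*D - 155*(x*D)^5*D^2 - 20*(x*D)^4*D^3
      - 148*(x*D)^3*D^4 + 60*(x*D)^2*D^5 - 8*(x*D)*D^6 - 4*D^7"
    unfolding growth_poly_def by algebra
  also have "\<dots> = 0"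
    using critical_rho_identity[of k] k(1) unfolding N D_def[symmetric] by simp
  finally show ?thesis using D by simp
qed

text \<open>Multiplied by \<open>25x\<^sup>2 + 10x + 3\<close>, the polynomial has a single sign change.\<close>

lemma growth_poly_unique:
  assumes x: "0 < x" "growth_poly x = 0" and y: "0 < y" "growth_poly y = 0"
  shows "x = y"
proof -
  \<comment> \<open>Dividing the product by x^9 turns a positive root x into a solution of S (1 / x)
    = 800, and S increases strictly on nonnegative arguments.\<close>
  define S where "S t = 480*t + 4099*t^2 + 2146*t^3 + 4365*t^4 + 40*t^5 + 44*t^6 + 64*t^8 + 12*t^9"
    for t :: real
  have mono: "S t < S u" if "0 \<le> t" "t < u" for t u
    unfolding S_def using that
    by (intro add_strict_mono mult_strict_left_mono power_strict_mono) auto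
  have S: "S (inverse a) = 800" if a: "0 < a" "growth_poly a = 0" for a
  proof -
    have "growth_poly a * (25*a^2 + 10*a + 3) = 800*a^9 - (480*a^8 + 4099*a^7 + 2146*a^6
        + 4365*a^5 + 40*a^4 + 44*a^3 + 64*a + 12)"
      unfolding growth_poly_def by algebra
    moreover have "a^9 * S (inverse a) = 480*a^8 + 4099*a^7 + 2146*a^6
        + 4365*a^5 + 40*a^4 + 44*a^3 + 64*a + 12"
      using a(1) by (simp add: S_def field_simps power_numeral_reduce)
    ultimately have "a^9 * S (inverse a) = a^9 * 800" using a(2) by simp
    thus ?thesis using a(1) by simp
  qed
  have "inverse x = inverse y"
    using S[OF x] S[OF y] mono[of "inverse x" "inverse y"] mono[of "inverse y" "inverse x"] x(1) y(1)
    by (cases "inverse x" "inverse y" rule: linorder_cases) auto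
  thus ?thesis by simp
qed

lemma growth_bounds:
  assumes k: "0.52700329 < k" "k < 0.52700330" and x: "x = (1 + k + 2*k^2) / (k^2*(1 + 3*k))"
  shows "\<bar>x - 2.90511\<bar> < (0.000005 :: real)"
proof -
  have pos: "0 < k^2*(1 + 3*k)" using k by simp
  have up: "1 + y + 2*y^2 \<le> 1 + z + 2*z^2" "y^2*(1 + 3*y) \<le> z^2*(1 + 3*z)"
    if "0 \<le> y" "y \<le> z" for y z :: real
    using that by (auto intro!: mult_mono power_mono add_mono)
  have "x \<le> (1 + 0.52700330 + 2*0.52700330^2) / (0.52700329^2*(1 + 3*0.52700329))"
    unfolding x by (rule frac_le[OF _ up(1) _ up(2)]) (use k in auto)
  also have "\<dots> < 2.905115" by (simp add: power_divide)
  finally have 1: "x < 2.905115" .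
  have "2.905105 < (1 + 0.52700329 + 2*0.52700329^2) / (0.52700330^2*(1 + 3*0.52700330) :: real)"
    by (simp add: power_divide)
  also have "\<dots> \<le> x"
    unfolding x by (rule frac_le[OF _ up(1) pos up(2)]) (use k in auto)
  finally have "2.905105 < x" .
  with 1 have "x - 2.90511 < 0.000005" "- (x - 2.90511) < 0.000005" by simp_all
  thus ?thesis by (simp only: abs_less_iff)
qed

subsection \<open>Transfer of a square-root singularity\<close>

text \<open>Nothing is known on the circle of radius r itself, so Cauchy's inequality is applied to
  the second derivative on smaller circles, whose radius then tends to r.\<close>

lemma norm_deriv_le_of_second_deriv:
  assumes hol: "f holomorphic_on ball 0 r" and r: "0 < r"
    and M: "\<And>z. z \<in> ball 0 r \<Longrightarrow> norm (deriv (deriv f) z) \<le> M"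
  shows "norm ((deriv ^^ (n + 2)) f 0) \<le> fact n * M / r ^ n"
proof -
  let ?g = "deriv (deriv f)"
  have holg: "?g holomorphic_on ball 0 r"
    using hol by (intro holomorphic_deriv) auto
  have eq: "(deriv ^^ (n + 2)) f = (deriv ^^ n) ?g"
    by (simp only: funpow_add o_apply) (simp add: numeral_2_eq_2)
  have "\<forall>\<^sub>F s in at_left r. norm ((deriv ^^ n) ?g 0) \<le> fact n * M / s ^ n"
  proof -
    have "\<forall>\<^sub>F s in at_left r. s \<in> {0<..<r}"
      using r by (rule eventually_at_left_real)
    thus ?thesis
    proof eventually_elim
      case (elim s)
      have sub: "cball 0 s \<subseteq> ball (0::complex) r" using elim by auto
      show ?case
      proof (rule Cauchy_inequality)
        show "?g holomorphic_on ball 0 s" using holg sub by (meson ball_subset_cball holomorphic_on_subset order.trans)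
        show "continuous_on (cball 0 s) ?g"
          using holg sub holomorphic_on_imp_continuous_on continuous_on_subset by blast
        show "0 < s" using elim by simp
        fix x :: complex assume "norm (0 - x) = s"
        thus "norm (?g x) \<le> M" using elim by (intro M) auto
      qed
    qed
  qed
  moreover have "((\<lambda>s. fact n * M / s ^ n) \<longlongrightarrow> fact n * M / r ^ n) (at_left r)"
    using r by (intro tendsto_intros) auto
  ultimately have "norm ((deriv ^^ n) ?g 0) \<le> fact n * M / r ^ n"
    by (intro tendsto_lowerbound[where F = "at_left r"]) auto
  thus ?thesis by (simp only: eq)
qed

lemma has_fps_expansion_one_minus_powr:
  fixes a :: complex
  assumes r: "0 < r"
  shows "(\<lambda>z. (1 - z / of_real r) powr a) has_fps_expansion
    Abs_fps (\<lambda>n. (a gchoose n) * (- 1 / of_real r) ^ n)"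
proof -
  define c :: complex where "c = - 1 / of_real r"
  have "((\<lambda>x. (1 + x) powr a) \<circ> (\<lambda>z. c * z)) has_fps_expansion (fps_binomial a oo (fps_const c * fps_X))"
    by (intro has_fps_expansion_compose has_fps_expansion_binomial_complex fps_expansion_intros) auto
  also have "(\<lambda>x. (1 + x) powr a) \<circ> (\<lambda>z. c * z) = (\<lambda>z. (1 - z / of_real r) powr a)"
    by (auto simp: c_def fun_eq_iff)
  also have "fps_binomial a oo (fps_const c * fps_X) = Abs_fps (\<lambda>n. (a gchoose n) * c ^ n)"
    unfolding fps_compose_linear by (simp add: fps_eq_iff mult.commute)
  finally show ?thesis by (simp add: c_def)
qed

lemma Gamma_minus_one_half: "Gamma (- 1/2 :: complex) = - 2 * of_real (sqrt pi)"
proof -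
  have "Gamma (- 1/2 + 1 :: complex) = (- 1/2) * Gamma (- 1/2)"
  proof (rule Gamma_plus1, rule notI)
    assume "(- 1/2 :: complex) \<in> \<int>\<^sub>\<le>\<^sub>0"
    then obtain n where "(- 1/2 :: complex) = of_int n" by (auto elim: nonpos_Ints_cases)
    hence "real_of_int (2 * n) = real_of_int (- 1)" by (simp add: complex_eq_iff)
    thus False unfolding of_int_eq_iff by presburger
  qed
  thus ?thesis by (simp add: Gamma_one_half_complex)
qed

lemma gbinomial_tendsto:
  fixes a :: real
  shows "(\<lambda>n. ((of_real a :: complex) gchoose n) * (- 1) ^ n * of_real (real n powr (a + 1)))
    \<longlonglongrightarrow> inverse (Gamma (- of_real a))"
proof (rule Lim_transform_eventually[OF gbinomial_asymptotic])
  show "\<forall>\<^sub>F n in sequentially. ((of_real a :: complex) gchoose n) /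
      ((- 1) ^ n / exp ((of_real a + 1) * of_real (ln (real n)))) =
      (of_real a gchoose n) * (- 1) ^ n * of_real (real n powr (a + 1))"
    using eventually_gt_at_top[of 0]
  proof eventually_elim
    case (elim n)
    have "exp ((of_real a + 1) * of_real (ln (real n))) = (of_real (exp ((a + 1) * ln (real n))) :: complex)"
      by (simp flip: exp_of_real)
    also have "exp ((a + 1) * ln (real n)) = real n powr (a + 1)" using elim by (simp add: powr_def)
    finally show ?case by (simp add: field_simps flip: power_mult_distrib)
  qed
qed

text \<open>Exponent 1/2 contributes at order n^(-3/2) with constant 1 / Gamma(-1/2) = -1 / (2 sqrt
  \<pi>), exponent 3/2 only at order n^(-5/2), and the remainder at order n^-2.\<close>

theorem sqrt_singularity_transfer:
  fixes L :: "complex \<Rightarrow> complex" and f :: "complex fps"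
  assumes r: "0 < r" and L: "L holomorphic_on ball 0 r" "L has_fps_expansion f"
    and R: "R = (\<lambda>z. L z - (a0 + a1 * csqrt (1 - z / of_real r) + a2 * (1 - z / of_real r)
       + a3 * (1 - z / of_real r) * csqrt (1 - z / of_real r)))"
    and bnd: "\<And>z. z \<in> ball 0 r \<Longrightarrow> norm (deriv (deriv R) z) \<le> M"
  shows "(\<lambda>n. f $ n * of_real (r ^ n * real n powr (3/2))) \<longlonglongrightarrow> - a1 / (2 * of_real (sqrt pi))"
proof -
  have pos: "0 < Re (1 - z / of_real r)" if "z \<in> ball 0 r" for z
    using that r complex_Re_le_cmod[of z] by (simp add: Re_divide_of_real field_simps)
  hence np: "1 - z / of_real r \<notin> \<real>\<^sub>\<le>\<^sub>0" if "z \<in> ball 0 r" for z :: complex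
    using pos[OF that] by (auto simp: complex_nonpos_Reals_iff)
  have holR: "R holomorphic_on ball 0 r"
    unfolding R using r np by (intro holomorphic_intros L) auto
  define B where "B a = Abs_fps (\<lambda>n. (a gchoose n) * (- 1 / of_real r) ^ n)" for a :: complex
  have B: "(\<lambda>z. (1 - z / of_real r) powr a) has_fps_expansion B a" for a
    unfolding B_def by (rule has_fps_expansion_one_minus_powr[OF r])
  define T where "T = fps_const a0 + fps_const a1 * B (1/2) + fps_const a2 * (1 - fps_const (1 / of_real r) * fps_X)
    + fps_const a3 * B (3/2)"
  have "(\<lambda>z. L z - (a0 + a1 * (1 - z / of_real r) powr (1/2) + a2 * (1 - (1 / of_real r) * z)
       + a3 * (1 - z / of_real r) powr (3/2))) has_fps_expansion f - T"
    unfolding T_def by (intro fps_expansion_intros L B)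
  hence "R has_fps_expansion f - T"
  proof (rule has_fps_expansion_cong[THEN iffD1, rotated 2])
    have "eventually (\<lambda>z. z \<in> ball 0 r) (nhds (0::complex))"
      using r by (intro eventually_nhds_in_open) auto
    thus "\<forall>\<^sub>F z in nhds 0. L z - (a0 + a1 * (1 - z / of_real r) powr (1/2) + a2 * (1 - (1 / of_real r) * z)
       + a3 * (1 - z / of_real r) powr (3/2)) = R z"
    proof eventually_elim
      case (elim z)
      have ne: "1 - z / of_real r \<noteq> 0" using np[OF elim] by auto
      have "(1 - z / of_real r) powr (3/2) = (1 - z / of_real r) powr (1 + 1/2)" by simp
      also have "\<dots> = (1 - z / of_real r) * csqrt (1 - z / of_real r)"
        unfolding powr_add using ne by (simp add: csqrt_conv_powr)
      finally show ?case unfolding R by (simp add: csqrt_conv_powr mult.assoc)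
    qed
  qed auto
  hence coeffR: "(f - T) $ n = (deriv ^^ n) R 0 / fact n" for n
    by (rule fps_nth_fps_expansion)
  define t1 where "t1 n = a1 * (((1/2 :: complex) gchoose n) * (- 1) ^ n * of_real (real n powr (3/2)))" for n
  define t2 where "t2 n = a3 * (((3/2 :: complex) gchoose n) * (- 1) ^ n * of_real (real n powr (5/2))) * of_real (1 / real n)" for n
  define t3 where "t3 n = (f - T) $ n * of_real (r ^ n * real n powr (3/2))" for n
  have eq: "\<forall>\<^sub>F n in sequentially. f $ n * of_real (r ^ n * real n powr (3/2)) = t1 n + t2 n + t3 n"
    using eventually_ge_at_top[of 2]
  proof eventually_elim
    case (elim n)
    \<comment> \<open>From n = 2 on, the constant and linear terms of T have no coefficient
      left.\<close>
    have Tn: "T $ n = (a1 * ((1/2) gchoose n) + a3 * ((3/2) gchoose n)) * (- 1 / of_real r) ^ n"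
      using elim by (simp add: T_def B_def algebra_simps)
    have p: "real n powr (5/2) * (1 / real n) = real n powr (3/2)"
    proof -
      have "real n powr (5/2) = real n powr (3/2 + 1)" by simp
      also have "\<dots> = real n powr (3/2) * real n" using elim by (simp only: powr_add) simp
      finally show ?thesis using elim by simp
    qed
    have "t2 n = a3 * (((3/2 :: complex) gchoose n) * (- 1) ^ n) * of_real (real n powr (5/2) * (1 / real n))"
      by (simp only: t2_def of_real_mult mult_ac)
    hence "t1 n + t2 n = (a1 * ((1/2) gchoose n) + a3 * ((3/2) gchoose n)) * (- 1) ^ n * of_real (real n powr (3/2))"
      unfolding p by (simp add: t1_def algebra_simps)
    also have "\<dots> = T $ n * of_real (r ^ n * real n powr (3/2))"
    proof -
      have "(- 1 / of_real r) ^ n * of_real r ^ n = (- 1 :: complex) ^ n"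
        using r by (simp flip: power_mult_distrib)
      thus ?thesis unfolding Tn of_real_mult of_real_power by (metis mult.assoc)
    qed
    finally show ?case by (simp add: t3_def algebra_simps)
  qed
  have "t1 \<longlonglongrightarrow> a1 * inverse (Gamma (- 1/2))"
    unfolding t1_def using gbinomial_tendsto[of "1/2"] by (intro tendsto_mult_left) simp
  moreover have "t2 \<longlonglongrightarrow> a3 * inverse (Gamma (- 3/2)) * of_real 0"
    unfolding t2_def
  proof (intro tendsto_mult tendsto_of_real tendsto_const)
    show "(\<lambda>n. ((3/2 :: complex) gchoose n) * (- 1) ^ n * of_real (real n powr (5/2))) \<longlonglongrightarrow> inverse (Gamma (- 3/2))"
      using gbinomial_tendsto[of "3/2"] by simp
    show "(\<lambda>n. 1 / real n) \<longlonglongrightarrow> 0" by real_asymp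
  qed
  moreover have "t3 \<longlonglongrightarrow> 0"
  proof (rule Lim_null_comparison)
    show "\<forall>\<^sub>F n in sequentially. norm (t3 n) \<le> M * r^2 * (real n powr (3/2) / (real n * (real n - 1)))"
      using eventually_ge_at_top[of 2]
    proof eventually_elim
      case (elim n)
      then obtain m where n: "n = m + 2" by (metis add.commute le_Suc_ex)
      have "norm ((f - T) $ n) = norm ((deriv ^^ (m + 2)) R 0) / fact n"
        by (simp only: coeffR norm_divide norm_fact n)
      also have "\<dots> \<le> fact m * M / r ^ m / fact n"
        by (intro divide_right_mono norm_deriv_le_of_second_deriv[OF holR r bnd]) auto
      also have "fact n = real n * (real n - 1) * fact m" by (simp add: n algebra_simps)
      also have "fact m * M / r ^ m / (real n * (real n - 1) * fact m) = M / (r ^ m * (real n * (real n - 1)))"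
      proof -
        have "a * M / b / (x * a) = M / (b * x)" if "a \<noteq> 0" for a b x :: real
          using that by (cases "b = 0"; cases "x = 0") (auto simp: field_simps)
        from this[of "fact m"] show ?thesis by simp
      qed
      finally have "norm ((f - T) $ n) \<le> M / (r ^ m * (real n * (real n - 1)))" .
      moreover have nn: "0 \<le> r ^ n * real n powr (3/2)" using r by simp
      ultimately have "norm (t3 n) \<le> M / (r ^ m * (real n * (real n - 1))) * (r ^ n * real n powr (3/2))"
        unfolding t3_def norm_mult norm_of_real abs_of_nonneg[OF nn] by (rule mult_right_mono)
      also have "\<dots> = M * r^2 * (real n powr (3/2) / (real n * (real n - 1)))"
        using r by (simp add: n power_add power2_eq_square)
      finally show ?case .
    qed
    have "(\<lambda>n. real n powr (3/2) / (real n * (real n - 1))) \<longlonglongrightarrow> 0" by real_asymp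
    thus "(\<lambda>n. M * r^2 * (real n powr (3/2) / (real n * (real n - 1)))) \<longlonglongrightarrow> 0"
      by (rule tendsto_mult_right_zero)
  qed
  ultimately have "(\<lambda>n. t1 n + t2 n + t3 n) \<longlonglongrightarrow> a1 * inverse (Gamma (- 1/2))
      + a3 * inverse (Gamma (- 3/2)) * of_real 0 + 0"
    by (intro tendsto_add)
  moreover have "a1 * inverse (Gamma (- 1/2)) + a3 * inverse (Gamma (- 3/2)) * of_real 0 + 0
      = - a1 / (2 * of_real (sqrt pi))"
    unfolding Gamma_minus_one_half by (simp add: field_simps)
  ultimately have "(\<lambda>n. t1 n + t2 n + t3 n) \<longlonglongrightarrow> - a1 / (2 * of_real (sqrt pi))"
    by (simp only:)
  thus ?thesis
  proof (rule Lim_transform_eventually)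
    show "\<forall>\<^sub>F n in sequentially. t1 n + t2 n + t3 n = f $ n * of_real (r ^ n * real n powr (3/2))"
      using eq by eventually_elim (rule sym)
  qed
qed

subsection \<open>Convergence at the critical point\<close>

text \<open>Partial sums, because convergence at r is not known yet; the inequalities below stay
  between finite quantities.\<close>

definition psum :: "real fps \<Rightarrow> real \<Rightarrow> nat \<Rightarrow> real" where
  "psum f x N = (\<Sum>n\<le>N. f $ n * x ^ n)"

lemma psum_nonneg: "(\<And>n. 0 \<le> f $ n) \<Longrightarrow> 0 \<le> x \<Longrightarrow> 0 \<le> psum f x N"
  by (auto simp: psum_def intro!: sum_nonneg)

lemma psum_add: "psum (f + g) x N = psum f x N + psum g x N"
  by (simp add: psum_def algebra_simps sum.distrib)

lemma psum_1: "psum 1 x N = 1"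
  by (induction N) (simp_all add: psum_def)

lemma psum_X_le: "0 \<le> x \<Longrightarrow> psum fps_X x N \<le> x"
proof -
  assume "0 \<le> x"
  moreover have "psum fps_X x (Suc N) = x" for N
    by (induction N) (simp_all add: psum_def fps_X_def)
  ultimately show ?thesis by (cases N) (auto simp: psum_def)
qed

lemma psum_X_mult: "psum (fps_X * f) x (Suc N) = x * psum f x N"
proof -
  have "psum (fps_X * f) x (Suc N) = (\<Sum>n\<le>N. (fps_X * f) $ Suc n * x ^ Suc n)"
    unfolding psum_def sum.atMost_Suc_shift by simp
  also have "\<dots> = x * psum f x N"
    by (simp add: psum_def sum_distrib_left mult_ac)
  finally show ?thesis .
qed

lemma psum_mono:
  assumes "\<And>n. 0 \<le> f $ n" "0 \<le> x" "N \<le> M"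
  shows "psum f x N \<le> psum f x M"
  unfolding psum_def using assms by (intro sum_mono2) auto

text \<open>The product collects the pairs in the triangle i + j \<le> N, which lies in the square
  of pairs below N; the missing terms are nonnegative.\<close>

lemma psum_mult_le:
  assumes f: "\<And>n. 0 \<le> f $ n" and g: "\<And>n. 0 \<le> g $ n" and x: "0 \<le> x"
  shows "psum (f * g) x N \<le> psum f x N * psum g x N"
proof -
  have "psum (f * g) x N = (\<Sum>n\<le>N. \<Sum>i\<le>n. (f $ i * x ^ i) * (g $ (n - i) * x ^ (n - i)))"
    unfolding psum_def fps_mult_nth sum_distrib_right atLeast0AtMost
  proof (intro sum.cong refl)
    fix n i :: nat assume "i \<in> {..n}"
    hence "x ^ n = x ^ i * x ^ (n - i)" by (simp flip: power_add)
    thus "f $ i * g $ (n - i) * x ^ n = f $ i * x ^ i * (g $ (n - i) * x ^ (n - i))" by simp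
  qed
  also have "\<dots> = (\<Sum>(i,j)\<in>{(i,j). i + j \<le> N}. (f $ i * x ^ i) * (g $ j * x ^ j))"
    by (rule sum.triangle_reindex_eq[symmetric])
  also have "\<dots> \<le> (\<Sum>(i,j)\<in>{..N} \<times> {..N}. (f $ i * x ^ i) * (g $ j * x ^ j))"
    using f g x by (intro sum_mono2) auto
  also have "\<dots> = psum f x N * psum g x N"
    unfolding psum_def sum_product sum.cartesian_product ..
  finally show ?thesis .
qed

lemma gf_nonneg: "0 \<le> (gf A :: real fps) $ n"
  by (simp add: gf_def)

lemma gf_nth_0_win_trees: "gf win_trees $ 0 = 0"
proof -
  have "{\<phi> \<in> win_trees. nodes \<phi> = 0} = {}" by (auto simp: win_trees_def)
  thus ?thesis by (simp only: gf_def fps_nth_Abs_fps) simp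
qed

lemma gf_nth_1_win_trees: "gf win_trees $ 1 = 1"
  by (subst gf_win_trees) (simp add: fps_X_power_mult_nth)

lemma gf_nth_1_win_forests: "gf win_forests $ 1 = 1"
  by (subst gf_win_forests)
    (simp add: fps_mult_nth gf_nth_0_win_trees gf_nth_1_win_trees[simplified] gf_win_forests_nth_0)

text \<open>The generating function of the winning trees satisfies \<open>C = z + z\<^sup>2 K(C)\<close> with
  \<open>K(c) = c / ((1 - c)\<^sup>2 (1 + c))\<close>. Assumptions \<open>e1\<close> and \<open>e2\<close> say \<open>\<kappa> = r + r\<^sup>2 K(\<kappa>)\<close> and
  \<open>1 = r\<^sup>2 K'(\<kappa>)\<close>; \<open>q0\<close> keeps the cofactor of the resulting double root away from 0 for
  \<open>|c| \<le> \<kappa>\<close>.\<close>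

locale critical_point =
  fixes \<kappa> r :: real
  assumes \<kappa>: "0 < \<kappa>" "\<kappa> < 1" and r: "0 < r"
    and e1: "(\<kappa> - r) * ((1 - \<kappa>)^2 * (1 + \<kappa>)) = r^2 * \<kappa>"
    and e2: "r^2 * (1 + \<kappa> + 2 * \<kappa>^2) = (1 - \<kappa>) ^ 3 * (1 + \<kappa>)^2"
    and q0: "0 < r / \<kappa>^2 - (1 + r - 2 * \<kappa>) * \<kappa> - \<kappa>^2" "2 * \<kappa> < 1 + r"
begin

text \<open>Truncated, the equations for forests become linear inequalities between finite numbers,
  with coefficients \<kappa> and \<kappa>^2 below 1, and can be solved.\<close>

lemma psum_win_forests_le_aux:
  assumes C: "psum (gf win_trees) r N \<le> \<kappa>"
  shows "psum (gf win_forests) r N \<le> 1 / (1 - \<kappa>)"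
    and "psum (gf odd_win_forests) r N \<le> \<kappa> / (1 - \<kappa>^2)"
proof -
  let ?C = "psum (gf win_trees) r N" and ?L = "psum (gf win_forests) r N"
    and ?O = "psum (gf odd_win_forests) r N" and ?E = "psum (gf even_win_forests) r N"
  have r0: "0 \<le> r" using r by simp
  note nn = psum_nonneg[OF gf_nonneg r0]
  have "?L \<le> 1 + ?C * ?L"
    by (subst (1) gf_win_forests)
      (use psum_mult_le[OF gf_nonneg gf_nonneg r0] in \<open>simp add: psum_add psum_1\<close>)
  also have "\<dots> \<le> 1 + \<kappa> * ?L" using C nn by (intro add_mono mult_right_mono) auto
  finally show "?L \<le> 1 / (1 - \<kappa>)" using \<kappa> by (simp add: field_simps)
  have "?E \<le> 1 + ?C * ?O"
    by (subst (1) gf_even_win_forests)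
      (use psum_mult_le[OF gf_nonneg gf_nonneg r0] in \<open>simp add: psum_add psum_1\<close>)
  also have "\<dots> \<le> 1 + \<kappa> * ?O" using C nn by (intro add_mono mult_right_mono) auto
  finally have E: "?E \<le> 1 + \<kappa> * ?O" .
  have "?O \<le> ?C * ?E"
    by (subst (1) gf_odd_win_forests) (rule psum_mult_le[OF gf_nonneg gf_nonneg r0])
  also have "\<dots> \<le> \<kappa> * (1 + \<kappa> * ?O)" using C E nn \<kappa> by (intro mult_mono) auto
  finally have "?O * (1 - \<kappa>^2) \<le> \<kappa>" by (simp add: power2_eq_square algebra_simps)
  moreover have "\<kappa>^2 < 1" using \<kappa> by (simp add: power_less_one_iff)
  ultimately show "?O \<le> \<kappa> / (1 - \<kappa>^2)" by (simp add: pos_le_divide_eq)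
qed

text \<open>The factor \<open>fps_X ^ 2\<close> makes the next partial sum depend on earlier ones
  only, and monotonicity bounds it by r + r^2 K(\<kappa>), which is \<kappa> by \<open>e1\<close>.
  So the partial sums cannot pass this fixed point.\<close>

lemma psum_win_trees_le: "psum (gf win_trees) r N \<le> \<kappa>"
proof (induction N)
  case 0
  show ?case using \<kappa> by (simp add: psum_def gf_nth_0_win_trees)
next
  case (Suc N)
  let ?O = "psum (gf odd_win_forests) r N" and ?L = "psum (gf win_forests) r N"
  let ?OL = "gf odd_win_forests * gf win_forests :: real fps"
  have r0: "0 \<le> r" using r by simp
  note nn = psum_nonneg[OF gf_nonneg r0]
  have OL: "0 \<le> ?OL $ n" for n by (auto simp: fps_mult_nth intro!: sum_nonneg gf_nonneg mult_nonneg_nonneg)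
  have XOL: "0 \<le> (fps_X * ?OL) $ n" for n using OL by simp
  have k2: "\<kappa>^2 < 1" using \<kappa> by (simp add: power_less_one_iff)
  have "psum (gf win_trees) r (Suc N) = psum fps_X r (Suc N) + psum (fps_X * (fps_X * ?OL)) r (Suc N)"
    by (subst gf_win_trees) (simp add: psum_add power2_eq_square mult.assoc)
  also have "\<dots> \<le> r + r * psum (fps_X * ?OL) r N"
    using psum_X_le[OF r0] by (simp add: psum_X_mult)
  \<comment> \<open>Raising N to \<open>Suc N\<close> lets \<open>psum_X_mult\<close> remove the
    second factor without treating N = 0 apart.\<close>
  also have "psum (fps_X * ?OL) r N \<le> psum (fps_X * ?OL) r (Suc N)"
    by (intro psum_mono XOL r0) simp
  also have "\<dots> = r * psum ?OL r N" by (rule psum_X_mult)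
  also have "psum ?OL r N \<le> ?O * ?L" by (rule psum_mult_le[OF gf_nonneg gf_nonneg r0])
  also have "\<dots> \<le> (\<kappa> / (1 - \<kappa>^2)) * (1 / (1 - \<kappa>))"
    using psum_win_forests_le_aux[OF Suc.IH] nn \<kappa> k2 by (intro mult_mono) auto
  also have "r + r * (r * ((\<kappa> / (1 - \<kappa>^2)) * (1 / (1 - \<kappa>)))) = \<kappa>"
  proof -
    have eq: "(1 - \<kappa>^2) * (1 - \<kappa>) = (1 - \<kappa>)^2 * (1 + \<kappa>)" by algebra
    have "r + r * (r * ((\<kappa> / (1 - \<kappa>^2)) * (1 / (1 - \<kappa>)))) = r + r^2 * \<kappa> / ((1 - \<kappa>^2) * (1 - \<kappa>))"
      by (simp only: power2_eq_square[of r] times_divide_eq_left times_divide_eq_right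
          divide_divide_eq_left mult_1_right mult.assoc)
    also have "\<dots> = \<kappa>" unfolding eq e1[symmetric] using \<kappa> by simp
    finally show ?thesis .
  qed
  finally show ?case using r by simp
qed

lemma psum_win_forests_le: "psum (gf win_forests) r N \<le> 1 / (1 - \<kappa>)"
  by (rule psum_win_forests_le_aux[OF psum_win_trees_le])

end

lemma psum_bounded_imp_summable:
  assumes "\<And>n. 0 \<le> f $ n" "0 \<le> x" "\<And>N. psum f x N \<le> B"
  shows "summable (\<lambda>n. f $ n * x ^ n)" "(\<Sum>n. f $ n * x ^ n) \<le> B"
proof -
  show s: "summable (\<lambda>n. f $ n * x ^ n)"
  proof (rule bounded_imp_summable[of _ B])
    fix N show "(\<Sum>n\<le>N. f $ n * x ^ n) \<le> B" using assms(3)[of N] by (simp add: psum_def)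
  qed (use assms in auto)
  show "(\<Sum>n. f $ n * x ^ n) \<le> B"
  proof (rule suminf_le_const[OF s])
    fix N
    have "(\<Sum>n<N. f $ n * x ^ n) \<le> psum f x N"
      unfolding psum_def using assms by (intro sum_mono2) auto
    thus "(\<Sum>n<N. f $ n * x ^ n) \<le> B" using assms(3)[of N] by linarith
  qed
qed

text \<open>Keeping the first two terms together leaves a gap in the triangle inequality away from the
  positive real axis.\<close>

lemma eval_fps_norm_le:
  assumes f: "\<And>n. 0 \<le> f $ n" and r: "0 < r" and B: "\<And>N. psum f r N \<le> B" and z: "norm z < r"
    and g: "\<And>n. g $ n = complex_of_real (f $ n)"
  shows "norm (eval_fps g z) \<le> B - (f $ 0 + f $ 1 * r) + norm (g $ 0 + g $ 1 * z)"
    and "ereal r \<le> fps_conv_radius g"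
proof -
  have sr: "summable (\<lambda>n. f $ n * r ^ n)" and le: "(\<Sum>n. f $ n * r ^ n) \<le> B"
    using psum_bounded_imp_summable[OF f _ B] r by auto
  have sr2: "summable (\<lambda>n. f $ (n + 2) * r ^ (n + 2))" using sr by (rule summable_ignore_initial_segment)
  have ng: "norm (g $ n * w ^ n) = f $ n * norm w ^ n" for n w
    by (simp only: g norm_mult norm_power norm_of_real abs_of_nonneg[OF f])
  have "summable (\<lambda>n. norm (g $ n * of_real r ^ n))"
    unfolding ng using sr r by simp
  hence "conv_radius (fps_nth g) \<ge> ereal (norm (complex_of_real r))"
    by (rule conv_radius_geI[OF summable_norm_cancel])
  thus rad: "ereal r \<le> fps_conv_radius g" using r by (simp add: fps_conv_radius_def)
  have termle: "norm (g $ n * z ^ n) \<le> f $ n * r ^ n" for n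
    unfolding ng by (intro mult_left_mono power_mono f) (use z in auto)
  have sz: "summable (\<lambda>n. norm (g $ n * z ^ n))"
    by (rule summable_comparison_test'[OF sr, of 0]) (use termle in simp)
  have sz2: "summable (\<lambda>n. norm (g $ (n + 2) * z ^ (n + 2)))" using sz by (rule summable_ignore_initial_segment)
  have "eval_fps g z = (\<Sum>n. g $ (n + 2) * z ^ (n + 2)) + (g $ 0 + g $ 1 * z)"
    unfolding eval_fps_def suminf_split_initial_segment[OF summable_norm_cancel[OF sz], of 2]
    by (simp only: numeral_2_eq_2 sum.lessThan_Suc lessThan_0 sum.empty power_0 power_Suc0_right One_nat_def add_0 mult_1_right)
  hence "norm (eval_fps g z) \<le> norm (\<Sum>n. g $ (n + 2) * z ^ (n + 2)) + norm (g $ 0 + g $ 1 * z)"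
    by (simp only: norm_triangle_ineq)
  also have "norm (\<Sum>n. g $ (n + 2) * z ^ (n + 2)) \<le> (\<Sum>n. norm (g $ (n + 2) * z ^ (n + 2)))"
    by (rule summable_norm[OF sz2])
  also have "\<dots> \<le> (\<Sum>n. f $ (n + 2) * r ^ (n + 2))"
    by (rule suminf_le[OF _ sz2 sr2]) (rule termle)
  also have "\<dots> = (\<Sum>n. f $ n * r ^ n) - (f $ 0 + f $ 1 * r)"
    unfolding suminf_split_initial_segment[OF sr, of 2]
    by (simp only: numeral_2_eq_2 sum.lessThan_Suc lessThan_0 sum.empty power_0 power_Suc0_right One_nat_def add_0 mult_1_right add_diff_cancel_right')
  finally show "norm (eval_fps g z) \<le> B - (f $ 0 + f $ 1 * r) + norm (g $ 0 + g $ 1 * z)"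
    using le by linarith
qed

section \<open>The functional equation on the open disc, and bounds away from r\<close>

context critical_point
begin

definition K :: "complex \<Rightarrow> complex" where "K c = c / ((1 - c)^2 * (1 + c))"
definition K' :: "complex \<Rightarrow> complex" where "K' c = (1 + c + 2 * c\<^sup>2) / ((1 - c) ^ 3 * (1 + c)^2)"

lemma ball_1_neq: "c \<in> ball 0 1 \<Longrightarrow> 1 - c \<noteq> (0 :: complex)" "c \<in> ball 0 1 \<Longrightarrow> 1 + c \<noteq> (0 :: complex)"
  by (auto simp: add_eq_0_iff)

lemma K_deriv:
  assumes "c \<in> ball 0 1"
  shows "(K has_field_derivative K' c) (at c)"
proof -
  note ne = ball_1_neq[OF assms]
  define A where "A = (1 - c)^2 * (1 + c)"
  define A' where "A' = - 2 * (1 - c) * (1 + c) + (1 - c)^2"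
  have A: "A \<noteq> 0" using ne by (simp add: A_def)
  have "((\<lambda>c. (1 - c)^2 * (1 + c)) has_field_derivative A') (at c)"
    unfolding A'_def by (auto intro!: derivative_eq_intros simp: algebra_simps power2_eq_square)
  hence "((\<lambda>c. c / ((1 - c)^2 * (1 + c))) has_field_derivative (1 * A - c * A') / (A * A)) (at c)"
    using A unfolding A_def by (intro DERIV_divide DERIV_ident) auto
  moreover have "(1 * A - c * A') / (A * A) = K' c"
  proof -
    have "(1 * A - c * A') * ((1 - c) ^ 3 * (1 + c)^2) = (1 + c + 2 * c\<^sup>2) * (A * A)"
      unfolding A_def A'_def by algebra
    thus ?thesis using A ne unfolding K'_def by (subst frac_eq_eq) auto
  qed
  ultimately show ?thesis unfolding K_def by simp
qed

lemma holomorphic_K': "K' holomorphic_on ball 0 1"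
  unfolding K'_def using ball_1_neq by (auto intro!: holomorphic_intros)

definition tree_fun :: "complex \<Rightarrow> complex" where "tree_fun = eval_fps (gf win_trees)"
definition forest_fun :: "complex \<Rightarrow> complex" where "forest_fun = eval_fps (gf win_forests)"

lemma gf_of_real: "gf A $ n = complex_of_real (gf A $ n)"
  by (simp add: gf_def)

lemma conv_radius_gf:
  "ereal r \<le> fps_conv_radius (gf win_trees :: complex fps)"
  "ereal r \<le> fps_conv_radius (gf win_forests :: complex fps)"
  "ereal r \<le> fps_conv_radius (gf odd_win_forests :: complex fps)"
  using r by (auto intro!: eval_fps_norm_le(2)[OF gf_nonneg r _ _ gf_of_real, where z = 0]
      psum_win_trees_le psum_win_forests_le psum_win_forests_le_aux(2)[OF psum_win_trees_le])

lemma tree_fun_le: "norm z < r \<Longrightarrow> norm (tree_fun z) \<le> \<kappa> - r + norm z"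
  using eval_fps_norm_le(1)[OF gf_nonneg r psum_win_trees_le _ gf_of_real, of z]
  by (simp add: tree_fun_def gf_nth_0_win_trees gf_nth_1_win_trees[simplified])

lemma forest_fun_le: "norm z < r \<Longrightarrow> norm (forest_fun z) \<le> 1 / (1 - \<kappa>) - (1 + r) + norm (1 + z)"
  using eval_fps_norm_le(1)[OF gf_nonneg r psum_win_forests_le _ gf_of_real, of z]
  by (simp add: forest_fun_def gf_win_forests_nth_0 gf_nth_1_win_forests[simplified])

lemma tree_fun_less: "norm z < r \<Longrightarrow> norm (tree_fun z) < \<kappa>"
  using tree_fun_le[of z] by linarith

lemma tree_fun_ball: "norm z < r \<Longrightarrow> tree_fun z \<in> ball 0 1"
  using tree_fun_less[of z] \<kappa> by simp

lemma fun_relations: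
  assumes z: "norm z < r"
  shows "forest_fun z = inverse (1 - tree_fun z)"
    and "tree_fun z = z + z^2 * K (tree_fun z)"
proof -
  let ?C = "gf win_trees :: complex fps" and ?L = "gf win_forests :: complex fps"
    and ?O = "gf odd_win_forests :: complex fps"
  define c where "c = tree_fun z"
  have lt: "ereal (norm z) < fps_conv_radius f" if "ereal r \<le> fps_conv_radius f" for f :: "complex fps"
    using that z by (meson less_ereal.simps(1) order_less_le_trans)
  have rad_mult: "ereal r \<le> fps_conv_radius (f * g)" if "ereal r \<le> fps_conv_radius f" "ereal r \<le> fps_conv_radius g"
    for f g :: "complex fps"
    using that fps_conv_radius_mult[of f g] by (meson min.boundedI order.trans)
  have rad_add: "ereal r \<le> fps_conv_radius (f + g)" if "ereal r \<le> fps_conv_radius f" "ereal r \<le> fps_conv_radius g"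
    for f g :: "complex fps"
    using that fps_conv_radius_add[of f g] by (meson min.boundedI order.trans)
  have rad1: "ereal r \<le> fps_conv_radius (1 :: complex fps)" "ereal r \<le> fps_conv_radius (fps_X :: complex fps)"
     "ereal r \<le> fps_conv_radius (fps_X ^ 2 :: complex fps)" by simp_all
  have mult: "eval_fps (f * g) z = eval_fps f z * eval_fps g z"
    if "ereal r \<le> fps_conv_radius f" "ereal r \<le> fps_conv_radius g" for f g
    using that lt by (intro eval_fps_mult) auto
  have add: "eval_fps (f + g) z = eval_fps f z + eval_fps g z"
    if "ereal r \<le> fps_conv_radius f" "ereal r \<le> fps_conv_radius g" for f g
    using that lt by (intro eval_fps_add) auto
  note rad = conv_radius_gf rad1
  have "forest_fun z = eval_fps (1 + ?C * ?L) z"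
    unfolding forest_fun_def by (rule arg_cong[where f = "\<lambda>f. eval_fps f z"], rule gf_win_forests)
  also have "\<dots> = 1 + c * forest_fun z"
    by (simp add: add mult rad rad_mult rad_add c_def tree_fun_def forest_fun_def)
  finally have L: "forest_fun z * (1 - c) = 1" by (simp add: algebra_simps)
  define d where "d = eval_fps ?O z"
  have "d = eval_fps (?C * (1 + ?C * ?O)) z"
    unfolding d_def by (rule arg_cong[where f = "\<lambda>f. eval_fps f z"])
      (use gf_odd_win_forests gf_even_win_forests in metis)
  also have "\<dots> = c * (1 + c * d)"
    by (simp add: add mult rad rad_mult rad_add c_def tree_fun_def d_def)
  finally have D: "d * (1 - c\<^sup>2) = c" by (simp add: algebra_simps power2_eq_square)
  have "c = eval_fps (fps_X + fps_X ^ 2 * (?O * ?L)) z"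
    unfolding c_def tree_fun_def by (rule arg_cong[where f = "\<lambda>f. eval_fps f z"], rule gf_win_trees)
  also have "\<dots> = z + z^2 * (d * forest_fun z)"
    by (simp add: add mult rad rad_mult rad_add forest_fun_def d_def)
  finally have C: "c = z + z^2 * (d * forest_fun z)" .
  have ne: "1 - c \<noteq> 0" "1 + c \<noteq> 0" using ball_1_neq[OF tree_fun_ball[OF z]] by (auto simp: c_def)
  show L': "forest_fun z = inverse (1 - tree_fun z)"
    using L ne by (simp add: c_def field_simps)
  have "1 - c\<^sup>2 = (1 - c) * (1 + c)" by algebra
  hence "d * ((1 - c) * (1 + c)) = c" using D by simp
  hence "d = c / ((1 - c) * (1 + c))" using ne by (simp add: eq_divide_eq del: mult_cancel_left mult_cancel_right)
  hence "d * forest_fun z = K c"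
    unfolding L' c_def[symmetric] K_def using ne by (simp add: field_simps power2_eq_square)
  thus "tree_fun z = z + z^2 * K (tree_fun z)" using C by (simp add: c_def)
qed

lemma ball_subset_eball: "ereal r \<le> R \<Longrightarrow> ball (0 :: complex) r \<subseteq> eball 0 R"
  by (auto simp: eball_def) (meson less_ereal.simps(1) order_less_le_trans)

lemma holomorphic_tree_fun: "tree_fun holomorphic_on ball 0 r"
  unfolding tree_fun_def using conv_radius_gf(1)
  by (intro holomorphic_on_eval_fps ball_subset_eball)

lemma holomorphic_forest_fun: "forest_fun holomorphic_on ball 0 r"
  unfolding forest_fun_def using conv_radius_gf(2)
  by (intro holomorphic_on_eval_fps ball_subset_eball)

lemma forest_fun_expansion: "forest_fun has_fps_expansion gf win_forests"
  unfolding forest_fun_def using conv_radius_gf(2) r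
  by (intro eval_fps_has_fps_expansion) (auto intro: order_less_le_trans[of 0 "ereal r"])

text \<open>At \<open>z = r\<close> the value is exactly 1; the slack comes from the factor \<open>1 / (1 - c)\<close>, whose power
  series starts with \<open>1 + z\<close>.\<close>

lemma norm_K'_le:
  assumes z: "norm z < r"
  shows "norm (z^2 * K' (tree_fun z)) \<le> 1 - (1 - \<kappa>) * (1 + r - norm (1 + z))"
proof -
  define c where "c = tree_fun z"
  have c: "norm c \<le> \<kappa>" using tree_fun_less[OF z] by (simp add: c_def)
  have ne: "1 - c \<noteq> 0" "1 + c \<noteq> 0" using ball_1_neq[OF tree_fun_ball[OF z]] by (auto simp: c_def)
  have k2: "\<kappa>^2 < 1" using \<kappa> by (simp add: power_less_one_iff)
  have c2: "norm (c\<^sup>2) \<le> \<kappa>^2" using c by (simp add: norm_power power_mono)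
  \<comment> \<open>This isolates one factor 1 / (1 - c), which is \<open>forest_fun z\<close> and
    carries the gap; the rest is bounded by its value at \<kappa>.\<close>
  have "(1 - c) ^ 3 * (1 + c)^2 = (1 - c) * (1 - c\<^sup>2)^2" by algebra
  hence "K' c = (1 + c + 2 * c\<^sup>2) / (1 - c\<^sup>2)^2 * forest_fun z"
    using fun_relations(1)[OF z] ne by (simp add: K'_def c_def divide_inverse mult_ac)
  hence "norm (z^2 * K' c) = norm z ^ 2 * (norm (1 + c + 2 * c\<^sup>2) / norm (1 - c\<^sup>2) ^ 2) * norm (forest_fun z)"
    by (simp add: norm_mult norm_divide norm_power)
  also have "\<dots> \<le> r^2 * ((1 + \<kappa> + 2 * \<kappa>^2) / (1 - \<kappa>^2)^2) * (1 / (1 - \<kappa>) - (1 + r) + norm (1 + z))"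
  proof (intro mult_mono frac_le power_mono)
    have "norm (1 + c + 2 * c\<^sup>2) \<le> norm (1 + c) + norm (2 * c\<^sup>2)" by (rule norm_triangle_ineq)
    also have "\<dots> \<le> (1 + norm c) + 2 * norm (c\<^sup>2)"
      using norm_triangle_ineq[of 1 c] by (simp add: norm_mult)
    also have "\<dots> \<le> 1 + \<kappa> + 2 * \<kappa>^2" using c c2 by simp
    finally show "norm (1 + c + 2 * c\<^sup>2) \<le> 1 + \<kappa> + 2 * \<kappa>^2" .
    show "1 - \<kappa>^2 \<le> norm (1 - c\<^sup>2)" using norm_triangle_ineq2[of 1 "c\<^sup>2"] c2 by simp
    show "norm (forest_fun z) \<le> 1 / (1 - \<kappa>) - (1 + r) + norm (1 + z)" by (rule forest_fun_le[OF z])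
  qed (use z r \<kappa> k2 in auto)
  also have "r^2 * ((1 + \<kappa> + 2 * \<kappa>^2) / (1 - \<kappa>^2)^2) = 1 - \<kappa>"
  proof -
    have "(1 - \<kappa>^2)^2 * (1 - \<kappa>) = (1 - \<kappa>) ^ 3 * (1 + \<kappa>)^2" by algebra
    thus ?thesis using e2 k2 by (simp add: field_simps)
  qed
  also have "(1 - \<kappa>) * (1 / (1 - \<kappa>) - (1 + r) + norm (1 + z)) = 1 - (1 - \<kappa>) * (1 + r - norm (1 + z))"
    using \<kappa> by (simp add: field_simps)
  finally show ?thesis by (simp add: c_def)
qed

lemma away_gap:
  assumes \<epsilon>: "0 < \<epsilon>"
  obtains \<delta> where "0 < \<delta>" "\<And>z. norm z < r \<Longrightarrow> \<epsilon> \<le> norm (z - of_real r) \<Longrightarrow> \<delta> \<le> norm (1 - z^2 * K' (tree_fun z))"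
proof -
  \<comment> \<open>From |z| < r and |z - r| \<ge> \<epsilon> one gets 2 Re z \<le> 2r -
    \<epsilon>^2 / r, hence |1 + z|^2 \<le> (1 + r)^2 - \<epsilon>^2 / r.\<close>
  define s where "s = sqrt ((1 + r)^2 - \<epsilon>\<^sup>2 / r)"
  have s: "s < 1 + r"
  proof -
    have "(1 + r)^2 - \<epsilon>\<^sup>2 / r < (1 + r)^2" using \<epsilon> r by simp
    hence "s < sqrt ((1 + r)^2)" unfolding s_def by (rule real_sqrt_less_mono)
    thus ?thesis using r by simp
  qed
  show ?thesis
  proof
    show "0 < (1 - \<kappa>) * (1 + r - s)" using s \<kappa> by simp
    fix z :: complex assume z: "norm z < r" "\<epsilon> \<le> norm (z - of_real r)"
    have "\<epsilon>\<^sup>2 \<le> (norm (z - of_real r))^2" using z \<epsilon> by (intro power_mono) auto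
    also have "\<dots> = (norm z)^2 - 2 * r * Re z + r^2"
      unfolding cmod_power2 by (simp add: power2_eq_square algebra_simps)
    also have "(norm z)^2 \<le> r^2" using z by (intro power_mono) auto
    finally have "2 * r * Re z \<le> 2 * r^2 - \<epsilon>\<^sup>2" by simp
    hence "r * (2 * Re z) \<le> r * (2 * r - \<epsilon>\<^sup>2 / r)" using r by (simp add: algebra_simps power2_eq_square)
    hence Re: "2 * Re z \<le> 2 * r - \<epsilon>\<^sup>2 / r" using r by simp
    have "(norm (1 + z))^2 = 1 + 2 * Re z + (norm z)^2"
      unfolding cmod_power2 by (simp add: power2_eq_square algebra_simps)
    also have "\<dots> \<le> (1 + r)^2 - \<epsilon>\<^sup>2 / r"
      using Re \<open>(norm z)^2 \<le> r^2\<close> by (simp add: power2_eq_square algebra_simps)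
    finally have "norm (1 + z) \<le> s" unfolding s_def by (rule real_le_rsqrt)
    hence "(1 - \<kappa>) * (1 + r - s) \<le> (1 - \<kappa>) * (1 + r - norm (1 + z))"
      using \<kappa> by (intro mult_left_mono) auto
    also have "\<dots> \<le> 1 - norm (z^2 * K' (tree_fun z))" using norm_K'_le[OF z(1)] by simp
    also have "\<dots> \<le> norm (1 - z^2 * K' (tree_fun z))"
      using norm_triangle_ineq2[of 1 "z^2 * K' (tree_fun z)"] by simp
    finally show "(1 - \<kappa>) * (1 + r - s) \<le> norm (1 - z^2 * K' (tree_fun z))" .
  qed
qed

text \<open>Implicit differentiation of C = z + z^2 K(C). The factor 1 - z^2 K'(C) is left on the
  left side because \<open>away_gap\<close> bounds exactly this quantity from below.\<close>

lemma tree_fun_derivs: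
  assumes z: "norm z < r"
  defines "c \<equiv> tree_fun z" and "c1 \<equiv> deriv tree_fun z" and "c2 \<equiv> deriv (deriv tree_fun) z"
  shows "c1 * (1 - z^2 * K' c) = 1 + 2 * z * K c"
    and "c2 * (1 - z^2 * K' c) = 2 * K c + 4 * z * K' c * c1 + z^2 * deriv K' c * c1\<^sup>2"
    and "deriv (deriv forest_fun) z = c2 * forest_fun z ^ 2 + 2 * c1\<^sup>2 * forest_fun z ^ 3"
proof -
  have der: "(tree_fun has_field_derivative deriv tree_fun w) (at w)" if "w \<in> ball 0 r" for w
    using holomorphic_tree_fun that by (intro holomorphic_derivI) auto
  have der2: "(deriv tree_fun has_field_derivative deriv (deriv tree_fun) w) (at w)" if "w \<in> ball 0 r" for w
    using holomorphic_deriv[OF holomorphic_tree_fun] that by (intro holomorphic_derivI) auto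
  have derK: "((\<lambda>w. K (tree_fun w)) has_field_derivative K' (tree_fun w) * deriv tree_fun w) (at w)"
    if "w \<in> ball 0 r" for w
    using DERIV_chain2[OF K_deriv der] that tree_fun_ball by auto
  have derK': "((\<lambda>w. K' (tree_fun w)) has_field_derivative deriv K' (tree_fun w) * deriv tree_fun w) (at w)"
    if "w \<in> ball 0 r" for w
    using DERIV_chain2[OF holomorphic_derivI[OF holomorphic_K'] der] that tree_fun_ball by auto
  have eq1: "deriv tree_fun w = 1 + (2 * w * K (tree_fun w) + w\<^sup>2 * (K' (tree_fun w) * deriv tree_fun w))"
    if w: "w \<in> ball 0 r" for w
  proof -
    have "((\<lambda>w. w + w\<^sup>2 * K (tree_fun w)) has_field_derivative
        1 + (2 * w * K (tree_fun w) + w\<^sup>2 * (K' (tree_fun w) * deriv tree_fun w))) (at w)"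
      by (auto intro!: derivative_eq_intros derK[OF w] simp: algebra_simps)
    hence "(tree_fun has_field_derivative
        1 + (2 * w * K (tree_fun w) + w\<^sup>2 * (K' (tree_fun w) * deriv tree_fun w))) (at w)"
      by (rule has_field_derivative_transform_within_open[where S = "ball 0 r"])
        (use w fun_relations(2) in auto)
    thus ?thesis using DERIV_unique[OF der[OF w]] by blast
  qed
  have zb: "z \<in> ball 0 r" using z by simp
  show "c1 * (1 - z^2 * K' c) = 1 + 2 * z * K c"
    using eq1[OF zb] by (simp add: c_def c1_def algebra_simps)
  have "((\<lambda>w. 1 + (2 * w * K (tree_fun w) + w\<^sup>2 * (K' (tree_fun w) * deriv tree_fun w))) has_field_derivative
      (2 * K c + 2 * z * (K' c * c1)) + (2 * z * (K' c * c1) + z^2 * (deriv K' c * c1 * c1 + K' c * c2))) (at z)"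
    by (auto intro!: derivative_eq_intros derK[OF zb] derK'[OF zb] der2[OF zb]
        simp: c_def c1_def c2_def algebra_simps)
  hence "(deriv tree_fun has_field_derivative
      (2 * K c + 2 * z * (K' c * c1)) + (2 * z * (K' c * c1) + z^2 * (deriv K' c * c1 * c1 + K' c * c2))) (at z)"
    by (rule has_field_derivative_transform_within_open[where S = "ball 0 r"]) (use zb eq1 in auto)
  hence "c2 = (2 * K c + 2 * z * (K' c * c1)) + (2 * z * (K' c * c1) + z^2 * (deriv K' c * c1 * c1 + K' c * c2))"
    unfolding c2_def using DERIV_unique[OF der2[OF zb]] by blast
  thus "c2 * (1 - z^2 * K' c) = 2 * K c + 4 * z * K' c * c1 + z^2 * deriv K' c * c1\<^sup>2"
    by (simp add: algebra_simps power2_eq_square)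
  have L: "forest_fun w = inverse (1 - tree_fun w)" "1 - tree_fun w \<noteq> 0" if "w \<in> ball 0 r" for w
    using fun_relations(1) ball_1_neq(1)[OF tree_fun_ball] that by auto
  have derL: "(forest_fun has_field_derivative deriv tree_fun w * forest_fun w ^ 2) (at w)" if w: "w \<in> ball 0 r" for w
  proof -
    have "((\<lambda>w. inverse (1 - tree_fun w)) has_field_derivative deriv tree_fun w * forest_fun w ^ 2) (at w)"
      using L[OF w] by (auto intro!: derivative_eq_intros der[OF w] simp: power2_eq_square)
    thus ?thesis
      by (rule has_field_derivative_transform_within_open[where S = "ball 0 r"]) (use w L in auto)
  qed
  have "((\<lambda>w. deriv tree_fun w * forest_fun w ^ 2) has_field_derivative
      c2 * forest_fun z ^ 2 + 2 * c1\<^sup>2 * forest_fun z ^ 3) (at z)"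
    by (auto intro!: derivative_eq_intros derL[OF zb] der2[OF zb]
        simp: c1_def c2_def algebra_simps power2_eq_square power3_eq_cube)
  hence "(deriv forest_fun has_field_derivative
      c2 * forest_fun z ^ 2 + 2 * c1\<^sup>2 * forest_fun z ^ 3) (at z)"
    by (rule has_field_derivative_transform_within_open[where S = "ball 0 r"])
      (use zb derL DERIV_imp_deriv in \<open>fastforce+\<close>)
  thus "deriv (deriv forest_fun) z = c2 * forest_fun z ^ 2 + 2 * c1\<^sup>2 * forest_fun z ^ 3"
    by (rule DERIV_imp_deriv)
qed

text \<open>Once the factor 1 - z^2 K'(C) is divided out, everything else is continuous on the
  compact disc |c| \<le> \<kappa>, which lies inside the unit disc where K is holomorphic.\<close>

lemma forest_fun_away_bound:
  assumes \<epsilon>: "0 < \<epsilon>"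
  obtains M where "\<And>z. norm z < r \<Longrightarrow> \<epsilon> \<le> norm (z - of_real r) \<Longrightarrow> norm (deriv (deriv forest_fun) z) \<le> M"
proof -
  obtain \<delta> where \<delta>: "0 < \<delta>" "\<And>z. norm z < r \<Longrightarrow> \<epsilon> \<le> norm (z - of_real r) \<Longrightarrow> \<delta> \<le> norm (1 - z^2 * K' (tree_fun z))"
    using away_gap[OF \<epsilon>] by blast
  have sub: "cball 0 \<kappa> \<subseteq> ball (0::complex) 1" using \<kappa> by auto
  have bnd: "\<exists>B. \<forall>c\<in>cball 0 \<kappa>. norm (f c) \<le> B" if "f holomorphic_on ball 0 1" for f :: "complex \<Rightarrow> complex"
  proof -
    have "continuous_on (cball 0 \<kappa>) f"
      using that sub holomorphic_on_imp_continuous_on continuous_on_subset by blast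
    hence "bounded (f ` cball 0 \<kappa>)" by (intro compact_imp_bounded compact_continuous_image) auto
    thus ?thesis unfolding bounded_iff by blast
  qed
  have "K holomorphic_on ball 0 1"
    unfolding K_def using ball_1_neq by (auto intro!: holomorphic_intros)
  from bnd[OF this] obtain b0 where b0: "\<forall>c\<in>cball 0 \<kappa>. norm (K c) \<le> b0" by blast
  obtain b1 where b1: "\<forall>c\<in>cball 0 \<kappa>. norm (K' c) \<le> b1" using bnd[OF holomorphic_K'] by blast
  obtain b2 where b2: "\<forall>c\<in>cball 0 \<kappa>. norm (deriv K' c) \<le> b2"
    using bnd[OF holomorphic_deriv[OF holomorphic_K']] by blast
  define m1 where "m1 = (1 + 2 * r * b0) / \<delta>"
  define m2 where "m2 = (2 * b0 + 4 * r * b1 * m1 + r^2 * b2 * m1\<^sup>2) / \<delta>"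
  define l where "l = 1 / (1 - \<kappa>)"
  have "norm (deriv (deriv forest_fun) z) \<le> m2 * l ^ 2 + 2 * m1\<^sup>2 * l ^ 3"
    if z: "norm z < r" "\<epsilon> \<le> norm (z - of_real r)" for z
  proof -
    define c where "c = tree_fun z"
    define c1 where "c1 = deriv tree_fun z"
    define c2 where "c2 = deriv (deriv tree_fun) z"
    define p where "p = 1 - z^2 * K' c"
    have c: "c \<in> cball 0 \<kappa>" using tree_fun_less[OF z(1)] by (simp add: c_def)
    have K: "norm (K c) \<le> b0" "norm (K' c) \<le> b1" "norm (deriv K' c) \<le> b2" using b0 b1 b2 c by auto
    have nn: "0 \<le> b0" "0 \<le> b1" "0 \<le> b2" using K norm_ge_zero order.trans by blast+
    have p: "\<delta> \<le> norm p" using \<delta>(2)[OF z] by (simp add: p_def c_def)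
    have p0: "p \<noteq> 0" using p \<delta>(1) by auto
    have c1_eq: "c1 = (1 + 2 * z * K c) / p" and c2_eq: "c2 = (2 * K c + 4 * z * K' c * c1 + z^2 * deriv K' c * c1\<^sup>2) / p"
      using tree_fun_derivs(1,2)[OF z(1)] p0 by (simp_all add: c_def c1_def c2_def p_def eq_divide_eq)
    have "norm (1 + 2 * z * K c) \<le> 1 + 2 * r * b0"
    proof (rule norm_triangle_le)
      have "norm (2 * z * K c) \<le> 2 * r * b0"
        unfolding norm_mult using z K nn r by (intro mult_mono) auto
      thus "norm (1 :: complex) + norm (2 * z * K c) \<le> 1 + 2 * r * b0" by simp
    qed
    hence n1: "norm c1 \<le> m1"
      unfolding c1_eq norm_divide m1_def using p \<delta>(1) nn r by (intro frac_le) auto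
    hence m1: "0 \<le> m1" using norm_ge_zero order.trans by blast
    have "norm (2 * K c + 4 * z * K' c * c1 + z^2 * deriv K' c * c1\<^sup>2)
        \<le> 2 * b0 + 4 * r * b1 * m1 + r^2 * b2 * m1\<^sup>2"
    proof (intro norm_triangle_le add_mono)
      show "norm (2 * K c) \<le> 2 * b0" using K by (simp add: norm_mult)
      show "norm (4 * z * K' c * c1) \<le> 4 * r * b1 * m1"
        unfolding norm_mult using z K nn r n1 by (intro mult_mono) auto
      show "norm (z^2 * deriv K' c * c1\<^sup>2) \<le> r^2 * b2 * m1\<^sup>2"
        unfolding norm_mult norm_power using z K nn r n1 by (intro mult_mono power_mono) auto
    qed
    hence n2: "norm c2 \<le> m2"
      unfolding c2_eq norm_divide m2_def using p \<delta>(1) nn r m1 by (intro frac_le) auto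
    hence m2: "0 \<le> m2" using norm_ge_zero order.trans by blast
    have "norm (1 + z) \<le> 1 + r" using norm_triangle_ineq[of 1 z] z by simp
    hence nl: "norm (forest_fun z) \<le> l" using forest_fun_le[OF z(1)] by (simp add: l_def)
    have l: "0 \<le> l" using \<kappa> by (simp add: l_def)
    show ?thesis
      unfolding tree_fun_derivs(3)[OF z(1)] c1_def[symmetric] c2_def[symmetric]
    proof (intro norm_triangle_le add_mono)
      show "norm (c2 * forest_fun z ^ 2) \<le> m2 * l ^ 2"
        unfolding norm_mult norm_power using n2 nl m2 l by (intro mult_mono power_mono) auto
      show "norm (2 * c1\<^sup>2 * forest_fun z ^ 3) \<le> 2 * m1\<^sup>2 * l ^ 3"
        unfolding norm_mult norm_power using n1 nl m1 l by (intro mult_mono power_mono) auto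
    qed
  qed
  thus ?thesis using that by blast
qed

end

subsection \<open>Expansion at the singularity\<close>

lemma holomorphic_factor_id:
  assumes f: "f holomorphic_on ball 0 e" and e: "0 < e"
  shows "\<exists>g. g holomorphic_on ball 0 e \<and> g 0 = deriv f 0 \<and> (\<forall>s\<in>ball 0 e. f s = f 0 + s * g s)"
proof (intro exI conjI ballI)
  let ?g = "\<lambda>s. if s = 0 then deriv f 0 else (f s - f 0) / (s - 0)"
  show "?g holomorphic_on ball 0 e" using f e by (intro pole_lemma) auto
  show "?g 0 = deriv f 0" by simp
  fix s :: complex assume "s \<in> ball 0 e"
  show "f s = f 0 + s * ?g s" by simp
qed

text \<open>Splitting off s four times keeps the remainder in the form s^4 times a function
  holomorphic on the whole ball, which can be differentiated later. Only the first-order coefficient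
  is named, as it alone enters the limit.\<close>

lemma holomorphic_Taylor_4:
  assumes f: "f holomorphic_on ball 0 e" and e: "0 < e"
  obtains a2 a3 H where "H holomorphic_on ball 0 e"
    "\<And>s. s \<in> ball 0 e \<Longrightarrow> f s = f 0 + deriv f 0 * s + a2 * s\<^sup>2 + a3 * s ^ 3 + s ^ 4 * H s"
proof -
  obtain g1 where g1: "g1 holomorphic_on ball 0 e" "g1 0 = deriv f 0" "\<forall>s\<in>ball 0 e. f s = f 0 + s * g1 s"
    using holomorphic_factor_id[OF f e] by blast
  obtain g2 where g2: "g2 holomorphic_on ball 0 e" "\<forall>s\<in>ball 0 e. g1 s = g1 0 + s * g2 s"
    using holomorphic_factor_id[OF g1(1) e] by blast
  obtain g3 where g3: "g3 holomorphic_on ball 0 e" "\<forall>s\<in>ball 0 e. g2 s = g2 0 + s * g3 s"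
    using holomorphic_factor_id[OF g2(1) e] by blast
  obtain H where H: "H holomorphic_on ball 0 e" "\<forall>s\<in>ball 0 e. g3 s = g3 0 + s * H s"
    using holomorphic_factor_id[OF g3(1) e] by blast
  show ?thesis
  proof (rule that[OF H(1), of "g2 0" "g3 0"])
    fix s :: complex assume s: "s \<in> ball 0 e"
    have "f s = f 0 + s * (deriv f 0 + s * (g2 0 + s * (g3 0 + s * H s)))"
      using g1(2) g1(3)[rule_format, OF s] g2(2)[rule_format, OF s] g3(2)[rule_format, OF s] H(2)[rule_format, OF s]
      by metis
    thus "f s = f 0 + deriv f 0 * s + g2 0 * s\<^sup>2 + g3 0 * s ^ 3 + s ^ 4 * H s"
      by (simp add: algebra_simps power2_eq_square power3_eq_cube power4_eq_xxxx)
  qed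
qed

text \<open>The square of s has positive real part, so s lies in the sector |Im s| < Re s;
  \<open>sigma_eq\<close> uses this to rule out the wrong sign.\<close>

lemma sqrt_branch_deriv:
  fixes z :: complex
  assumes "norm z < r"
  defines "s \<equiv> csqrt (1 - z / of_real r)"
  shows "((\<lambda>z. csqrt (1 - z / of_real r)) has_field_derivative - 1 / (2 * of_real r * s)) (at z)"
    and "s \<noteq> 0" and "s\<^sup>2 = 1 - z / of_real r" and "0 < Re s" and "\<bar>Im s\<bar> < Re s"
proof -
  have r: "0 < r" using assms norm_ge_zero[of z] by linarith
  have Re: "0 < Re (1 - z / of_real r)"
    using assms r complex_Re_le_cmod[of z] by (simp add: Re_divide_of_real field_simps)
  hence np: "1 - z / of_real r \<notin> \<real>\<^sub>\<le>\<^sub>0" by (auto simp: complex_nonpos_Reals_iff)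
  show "s\<^sup>2 = 1 - z / of_real r" by (simp add: s_def)
  show s0: "s \<noteq> 0" using Re by (auto simp: s_def)
  have "((\<lambda>z. csqrt (1 - z / of_real r)) has_field_derivative - (1 / of_real r) / (2 * csqrt (1 - z / of_real r))) (at z)"
    using r np by (auto intro!: derivative_eq_intros simp: field_simps)
  thus "((\<lambda>z. csqrt (1 - z / of_real r)) has_field_derivative - 1 / (2 * of_real r * s)) (at z)"
    by (simp add: s_def mult_ac)
  have "Re (s\<^sup>2) = (Re s)^2 - (Im s)^2" by (simp add: power2_eq_square)
  hence "(Im s)^2 < (Re s)^2" using Re \<open>s\<^sup>2 = _\<close> by simp
  moreover have "0 \<le> Re s" using csqrt_principal[of "1 - z / of_real r"] by (auto simp: s_def)
  ultimately show "\<bar>Im s\<bar> < Re s" by (metis abs_le_square_iff abs_of_nonneg not_less)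
  thus "0 < Re s" by simp
qed

text \<open>With s the square root of 1 - z / r, ds/dz = -1 / (2 r s), so a derivative in z costs
  two powers of s: s^4 H(s) becomes s^2 A(s), and then B(s), which is holomorphic and hence bounded
  for |s| \<le> e/2.\<close>

lemma near_second_deriv_bound:
  assumes r: "0 < r" and U: "open U" "U \<subseteq> ball 0 r" and H: "H holomorphic_on ball 0 e" and e: "0 < e"
    and s: "\<And>z. z \<in> U \<Longrightarrow> norm (csqrt (1 - z / of_real r)) \<le> e / 2"
    and R: "\<And>z. z \<in> U \<Longrightarrow> R z = (1 - z / of_real r)^2 * H (csqrt (1 - z / of_real r))"
  obtains M where "\<And>z. z \<in> U \<Longrightarrow> norm (deriv (deriv R) z) \<le> M"
proof -
  define A where "A s = - (2 * H s + s * deriv H s / 2) / of_real r" for s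
  define B where "B s = - (A s + s * deriv A s / 2) / of_real r" for s
  have A: "A holomorphic_on ball 0 e"
    unfolding A_def using H r by (auto intro!: holomorphic_intros holomorphic_deriv)
  have B: "B holomorphic_on ball 0 e"
    unfolding B_def using A r by (auto intro!: holomorphic_intros holomorphic_deriv)
  have sub: "cball 0 (e / 2) \<subseteq> ball (0::complex) e" using e by auto
  have "continuous_on (cball 0 (e / 2)) B"
    using B sub holomorphic_on_imp_continuous_on continuous_on_subset by blast
  hence "bounded (B ` cball 0 (e / 2))" by (intro compact_imp_bounded compact_continuous_image) auto
  then obtain M where M: "\<forall>s\<in>cball 0 (e / 2). norm (B s) \<le> M" unfolding bounded_iff by blast
  define s where "s z = csqrt (1 - z / of_real r)" for z
  have ds: "(s has_field_derivative - 1 / (2 * of_real r * s z)) (at z)" and s0: "s z \<noteq> 0"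
    and s2: "1 - z / of_real r = s z ^ 2" if "z \<in> U" for z
    using sqrt_branch_deriv[of z r] U(2) that unfolding s_def by auto
  have sb: "s z \<in> ball 0 e" if "z \<in> U" for z
    using assms(6)[OF that] e by (simp add: s_def)
  have dH: "((\<lambda>z. H (s z)) has_field_derivative deriv H (s z) * (- 1 / (2 * of_real r * s z))) (at z)"
    if "z \<in> U" for z
    by (rule DERIV_chain2[OF holomorphic_derivI[OF H _ sb[OF that]] ds[OF that]]) simp
  have dA: "((\<lambda>z. A (s z)) has_field_derivative deriv A (s z) * (- 1 / (2 * of_real r * s z))) (at z)"
    if "z \<in> U" for z
    by (rule DERIV_chain2[OF holomorphic_derivI[OF A _ sb[OF that]] ds[OF that]]) simp
  have dt: "((\<lambda>z. 1 - z / of_real r) has_field_derivative - 1 / of_real r) (at z)" for z :: complex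
    using r by (auto intro!: derivative_eq_intros)
  have R1: "(R has_field_derivative (1 - z / of_real r) * A (s z)) (at z)" if z: "z \<in> U" for z
  proof -
    have "((\<lambda>z. (1 - z / of_real r)^2 * H (s z)) has_field_derivative
        (2 * (1 - z / of_real r) * (- 1 / of_real r)) * H (s z)
        + (deriv H (s z) * (- 1 / (2 * of_real r * s z))) * (1 - z / of_real r)^2) (at z)"
      using DERIV_mult[OF DERIV_power[OF dt, of 2] dH[OF z]] by simp
    also have "(2 * (1 - z / of_real r) * (- 1 / of_real r)) * H (s z)
        + (deriv H (s z) * (- 1 / (2 * of_real r * s z))) * (1 - z / of_real r)^2 = (1 - z / of_real r) * A (s z)"
      unfolding s2[OF z] A_def using s0[OF z] r by (simp add: field_simps power2_eq_square)
    finally show ?thesis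
      by (rule has_field_derivative_transform_within_open[OF _ U(1) z]) (simp add: R s_def)
  qed
  have "norm (deriv (deriv R) z) \<le> M" if z: "z \<in> U" for z
  proof -
    have "((\<lambda>z. (1 - z / of_real r) * A (s z)) has_field_derivative
        (- 1 / of_real r) * A (s z) + (deriv A (s z) * (- 1 / (2 * of_real r * s z))) * (1 - z / of_real r)) (at z)"
      by (rule DERIV_mult[OF dt dA[OF z]])
    also have "(- 1 / of_real r) * A (s z) + (deriv A (s z) * (- 1 / (2 * of_real r * s z))) * (1 - z / of_real r)
        = B (s z)"
      unfolding s2[OF z] B_def using s0[OF z] r by (simp add: field_simps power2_eq_square)
    finally have "(deriv R has_field_derivative B (s z)) (at z)"
      by (rule has_field_derivative_transform_within_open[OF _ U(1) z]) (use R1 DERIV_imp_deriv in force)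
    hence "deriv (deriv R) z = B (s z)" by (rule DERIV_imp_deriv)
    thus ?thesis using M assms(6)[OF z] by (simp add: s_def)
  qed
  thus ?thesis using that by blast
qed

section \<open>The double root at the critical value, and the limit of \<open>tree_fun\<close> at
  r\<close>

context critical_point
begin

definition J :: "complex \<Rightarrow> complex" where "J c = (1 - c)^2 * (1 + c)"
definition quad :: "complex \<Rightarrow> complex" where
  "quad c = c\<^sup>2 + of_real (2 * \<kappa> - 1 - r) * c - of_real (r / \<kappa>^2)"

text \<open>\<open>e1\<close> and \<open>e2\<close> say that the left side and its derivative vanish
  at \<kappa>; these are \<open>F1\<close> and \<open>F2\<close> in the proof. \<open>quad\<close>
  is the remaining factor, and \<open>Y\<close> and \<open>X\<close> match the coefficients of c^2
  and c.\<close>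

lemma double_root: "(c - of_real r) * J c - of_real r ^ 2 * c = (c - of_real \<kappa>)^2 * quad c"
proof -
  define Jk where "Jk = (1 - \<kappa>)^2 * (1 + \<kappa>)"
  have Jk: "Jk \<noteq> 0" using \<kappa> by (simp add: Jk_def)
  define q where "q = r / \<kappa>^2"
  have q: "q * \<kappa>^2 = r" using \<kappa> by (simp add: q_def)
  have F1: "(\<kappa> - r) * (1 - \<kappa> - \<kappa>^2 + \<kappa> ^ 3) - r^2 * \<kappa> = 0"
    using e1 by (simp add: power2_eq_square power3_eq_cube algebra_simps)
  have "Jk * (4 * \<kappa> ^ 3 - 3 * (1 + r) * \<kappa>^2 + 2 * (r - 1) * \<kappa> + (1 + r - r^2))
      = (1 - \<kappa>) * ((1 - \<kappa>) ^ 3 * (1 + \<kappa>)^2 - r^2 * (1 + \<kappa> + 2 * \<kappa>^2))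
        - (1 - \<kappa>) * (1 + 3 * \<kappa>) * ((\<kappa> - r) * Jk - r^2 * \<kappa>)"
    unfolding Jk_def by algebra
  also have "\<dots> = 0" using e1 e2 by (simp add: Jk_def)
  finally have F2: "4 * \<kappa> ^ 3 - 3 * (1 + r) * \<kappa>^2 + 2 * (r - 1) * \<kappa> + (1 + r - r^2) = 0" using Jk by simp
  have "\<kappa>^2 * (- q - 2 * \<kappa> * (2 * \<kappa> - 1 - r) + \<kappa>^2 - (r - 1)) = 0"
    using F1 F2 q by algebra
  hence Y: "- q - 2 * \<kappa> * (2 * \<kappa> - 1 - r) + \<kappa>^2 = r - 1" using \<kappa> by simp
  have "\<kappa> * (2 * \<kappa> * q + \<kappa>^2 * (2 * \<kappa> - 1 - r) - (1 + r - r^2)) = 0"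
    using F1 F2 q by algebra
  hence X: "2 * \<kappa> * q + \<kappa>^2 * (2 * \<kappa> - 1 - r) = 1 + r - r^2" using \<kappa> by simp
  define k R Q where "k = complex_of_real \<kappa>" and "R = complex_of_real r" and "Q = complex_of_real q"
  have "- Q - 2 * k * (2 * k - 1 - R) + k^2 = R - 1" "2 * k * Q + k^2 * (2 * k - 1 - R) = 1 + R - R\<^sup>2"
      "Q * k^2 = R"
    using arg_cong[OF Y, of complex_of_real] arg_cong[OF X, of complex_of_real] arg_cong[OF q, of complex_of_real]
    by (simp_all add: k_def R_def Q_def)
  hence "(c - R) * ((1 - c)^2 * (1 + c)) - R ^ 2 * c = (c - k)^2 * (c\<^sup>2 + (2 * k - 1 - R) * c - Q)"
    by algebra
  thus ?thesis by (simp add: J_def quad_def k_def R_def Q_def q_def)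
qed

lemma tree_fun_J: "norm z < r \<Longrightarrow> (tree_fun z - z) * J (tree_fun z) = z^2 * tree_fun z"
proof -
  assume z: "norm z < r"
  have "J (tree_fun z) \<noteq> 0" using ball_1_neq[OF tree_fun_ball[OF z]] by (simp add: J_def)
  moreover have "tree_fun z - z = z^2 * (tree_fun z / J (tree_fun z))"
    using fun_relations(2)[OF z] by (simp add: K_def J_def algebra_simps)
  ultimately show ?thesis by simp
qed

text \<open>Subtract the curve equations at r and at z: a factor z - r comes out on the right and
  the double root on the left, so c - \<kappa> has the size of a square root of z - r.\<close>

lemma tree_fun_quad:
  assumes z: "norm z < r"
  defines "c \<equiv> tree_fun z"
  shows "(c - of_real \<kappa>)^2 * quad c = (z - of_real r) * (J c + (z + of_real r) * c)"
proof -
  have "(c - z) * J c = z^2 * c" using tree_fun_J[OF z] by (simp add: c_def)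
  thus ?thesis unfolding double_root[symmetric] by algebra
qed

text \<open>By \<open>q0\<close> the cofactor \<open>quad\<close> is bounded away from 0 for all |c|
  \<le> \<kappa>, not only near \<kappa>, so the identity above forces c to \<kappa> without prior
  knowledge of the limit.\<close>

lemma tree_fun_tendsto: "(tree_fun \<longlongrightarrow> of_real \<kappa>) (at (of_real r) within ball 0 r)"
proof -
  define q where "q = r / \<kappa>^2 - (1 + r - 2 * \<kappa>) * \<kappa> - \<kappa>^2"
  have q: "0 < q" using q0(1) by (simp add: q_def)
  define B where "B = ((1 + \<kappa>) ^ 2 * (1 + \<kappa>) + 2 * r * \<kappa>) / q"
  have le: "norm (tree_fun z - of_real \<kappa>) \<le> sqrt (B * norm (z - of_real r))" if z: "norm z < r" for z
  proof -
    define c where "c = tree_fun z"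
    have c: "norm c \<le> \<kappa>" using tree_fun_less[OF z] by (simp add: c_def)
    have "q \<le> norm (quad c)"
    proof -
      have "norm (c\<^sup>2 + of_real (2 * \<kappa> - 1 - r) * c) \<le> \<kappa>^2 + (1 + r - 2 * \<kappa>) * \<kappa>"
      proof (intro norm_triangle_le add_mono)
        show "norm (c\<^sup>2) \<le> \<kappa>^2" using c by (simp add: norm_power power_mono)
        show "norm (of_real (2 * \<kappa> - 1 - r) * c) \<le> (1 + r - 2 * \<kappa>) * \<kappa>"
          unfolding norm_mult norm_of_real using c q0(2) \<kappa> by (intro mult_mono) auto
      qed
      moreover have "norm (complex_of_real (r / \<kappa>^2)) = r / \<kappa>^2" using r by (simp del: of_real_divide)
      ultimately show ?thesis
        using norm_triangle_ineq2[of "complex_of_real (r / \<kappa>^2)" "c\<^sup>2 + of_real (2 * \<kappa> - 1 - r) * c"]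
        unfolding quad_def q_def norm_minus_commute[of "_ + _"] by linarith
    qed
    hence "norm (c - of_real \<kappa>) ^ 2 * q \<le> norm (c - of_real \<kappa>) ^ 2 * norm (quad c)"
      by (intro mult_left_mono) auto
    also have "\<dots> = norm (z - of_real r) * norm (J c + (z + of_real r) * c)"
      using arg_cong[OF tree_fun_quad[OF z], of norm] by (simp add: norm_mult norm_power c_def)
    also have "norm (J c + (z + of_real r) * c) \<le> (1 + \<kappa>) ^ 2 * (1 + \<kappa>) + 2 * r * \<kappa>"
    proof (intro norm_triangle_le add_mono)
      have "norm (1 - c) \<le> 1 + \<kappa>" "norm (1 + c) \<le> 1 + \<kappa>"
        using norm_triangle_ineq4[of 1 c] norm_triangle_ineq[of 1 c] c by auto
      thus "norm (J c) \<le> (1 + \<kappa>) ^ 2 * (1 + \<kappa>)"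
        unfolding J_def norm_mult norm_power using \<kappa> by (intro mult_mono power_mono) auto
      have "norm (z + of_real r) \<le> 2 * r" using norm_triangle_ineq[of z "of_real r"] z r by simp
      thus "norm ((z + of_real r) * c) \<le> 2 * r * \<kappa>"
        unfolding norm_mult using c r by (intro mult_mono) auto
    qed
    finally have "norm (c - of_real \<kappa>) ^ 2 * q \<le> norm (z - of_real r) * ((1 + \<kappa>) ^ 2 * (1 + \<kappa>) + 2 * r * \<kappa>)"
      by (simp add: mult_left_mono)
    hence "norm (c - of_real \<kappa>) ^ 2 \<le> B * norm (z - of_real r)"
      unfolding B_def using q by (simp add: field_simps)
    thus ?thesis unfolding c_def by (rule real_le_rsqrt)
  qed
  have "((\<lambda>z. tree_fun z - of_real \<kappa>) \<longlongrightarrow> 0) (at (of_real r) within ball 0 r)"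
  proof (rule Lim_null_comparison)
    show "\<forall>\<^sub>F z in at (of_real r) within ball 0 r. norm (tree_fun z - of_real \<kappa>) \<le> sqrt (B * norm (z - of_real r))"
      using le by (auto simp: eventually_at_filter)
    have "((\<lambda>z :: complex. sqrt (B * norm (z - of_real r))) \<longlongrightarrow> sqrt (B * norm (complex_of_real r - of_real r)))
        (at (of_real r) within ball 0 r)"
      by (intro tendsto_intros)
    thus "((\<lambda>z :: complex. sqrt (B * norm (z - of_real r))) \<longlongrightarrow> 0) (at (of_real r) within ball 0 r)" by simp
  qed
  thus ?thesis by (simp add: LIM_zero_iff)
qed

end

section \<open>A local coordinate at the critical value\<close>

context critical_point
begin

text \<open>The curve (c - z) J(c) = z^2 c is quadratic in z; this is its solution by the branch
  that takes the value r at \<kappa>. As a function of c it is analytic there, so the singularity is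
  treated from the side of c.\<close>

definition Zfun :: "complex \<Rightarrow> complex" where
  "Zfun c = (csqrt ((J c)^2 + 4 * c\<^sup>2 * J c) - J c) / (2 * c)"
text \<open>The identity \<open>tree_fun_quad\<close> solved for 1 - z / r with z =
  \<open>Zfun c\<close>: on the curve, 1 - z / r = (\<kappa> - c)^2 \<open>Wfun c\<close>.\<close>

definition Wfun :: "complex \<Rightarrow> complex" where
  "Wfun c = - quad c / (of_real r * (J c + (Zfun c + of_real r) * c))"

text \<open>The value of \<open>Wfun\<close> at \<kappa>. Its positivity makes the square root of
  \<open>Wfun\<close> analytic there, and its root becomes the slope of the local
  coordinate.\<close>

definition w0 :: real where
  "w0 = (r / \<kappa>^2 + (1 + r) * \<kappa> - 3 * \<kappa>^2) / (r * ((1 - \<kappa>)^2 * (1 + \<kappa>) + 2 * r * \<kappa>))"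

lemma w0_pos: "0 < w0"
proof -
  \<comment> \<open>The numerator of \<open>w0\<close> is the first bound in \<open>q0\<close> plus
    twice this quantity.\<close>
  have "0 < (1 + r - 2 * \<kappa>) * \<kappa>" using q0(2) \<kappa> by simp
  hence "0 < r / \<kappa>^2 + (1 + r) * \<kappa> - 3 * \<kappa>^2"
    using q0(1) by (simp add: algebra_simps power2_eq_square)
  moreover have "0 < r * ((1 - \<kappa>)^2 * (1 + \<kappa>) + 2 * r * \<kappa>)"
    using \<kappa> r by (intro mult_pos_pos add_pos_pos) auto
  ultimately show ?thesis unfolding w0_def by (rule divide_pos_pos)
qed

lemma J_kappa: "J (of_real \<kappa>) = of_real ((1 - \<kappa>)^2 * (1 + \<kappa>))"
  by (simp add: J_def)

text \<open>Both 2 c z + J(c) and its negative square to the discriminant; the sign condition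
  selects the one that \<open>csqrt\<close> returns.\<close>

lemma Zfun_eqI:
  assumes "c \<noteq> 0" "(c - z) * J c = z^2 * c" "0 < Re (2 * c * z + J c)"
  shows "Zfun c = z"
proof -
  have "(2 * c * z + J c)^2 = (J c)^2 + 4 * c\<^sup>2 * J c"
    using assms(2) by algebra
  hence "csqrt ((J c)^2 + 4 * c\<^sup>2 * J c) = 2 * c * z + J c"
    using assms(3) by (intro csqrt_unique) auto
  thus ?thesis using assms(1) by (simp add: Zfun_def)
qed

lemma Zfun_kappa: "Zfun (of_real \<kappa>) = of_real r"
proof (rule Zfun_eqI)
  show "(of_real \<kappa> - of_real r) * J (of_real \<kappa>) = of_real r ^ 2 * complex_of_real \<kappa>"
    using arg_cong[OF e1, of complex_of_real] by (simp add: J_kappa)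
  have "2 * complex_of_real \<kappa> * of_real r + J (of_real \<kappa>) = of_real (2 * \<kappa> * r + (1 - \<kappa>)^2 * (1 + \<kappa>))"
    by (simp add: J_kappa)
  hence "Re (2 * complex_of_real \<kappa> * of_real r + J (of_real \<kappa>)) = 2 * \<kappa> * r + (1 - \<kappa>)^2 * (1 + \<kappa>)"
    by (simp only: Re_complex_of_real)
  thus "0 < Re (2 * complex_of_real \<kappa> * of_real r + J (of_real \<kappa>))"
    using \<kappa> r by (simp add: add_pos_pos)
qed (use \<kappa> in auto)

lemma Wfun_kappa: "Wfun (of_real \<kappa>) = of_real w0"
proof -
  have "- quad (of_real \<kappa>) = of_real (r / \<kappa>^2 + (1 + r) * \<kappa> - 3 * \<kappa>^2)"
    by (simp add: quad_def algebra_simps power2_eq_square)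
  thus ?thesis unfolding Wfun_def Zfun_kappa J_kappa w0_def by (simp add: algebra_simps)
qed

lemma analytic_Wfun: "(\<lambda>c. csqrt (Wfun c)) analytic_on {of_real \<kappa>}"
proof -
  have J: "J analytic_on {of_real \<kappa>}" unfolding J_def by (intro analytic_intros)
  have pos: "0 < (1 - \<kappa>)^2 * (1 + \<kappa>)" using \<kappa> by simp
  have "(J (of_real \<kappa>))^2 + 4 * (of_real \<kappa>)^2 * J (of_real \<kappa>) =
      of_real (((1 - \<kappa>)^2 * (1 + \<kappa>))^2 + 4 * \<kappa>^2 * ((1 - \<kappa>)^2 * (1 + \<kappa>)))"
    by (simp add: J_kappa)
  moreover have "0 < ((1 - \<kappa>)^2 * (1 + \<kappa>))^2 + 4 * \<kappa>^2 * ((1 - \<kappa>)^2 * (1 + \<kappa>))"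
    using pos \<kappa> by (intro add_pos_pos mult_pos_pos) auto
  ultimately have np: "(J (of_real \<kappa>))^2 + 4 * (of_real \<kappa>)^2 * J (of_real \<kappa>) \<notin> \<real>\<^sub>\<le>\<^sub>0"
    by (simp only: complex_nonpos_Reals_iff Re_complex_of_real not_le) simp
  have Z: "Zfun analytic_on {of_real \<kappa>}"
    unfolding Zfun_def using np \<kappa> by (intro analytic_intros J) auto
  have "J (of_real \<kappa>) + (Zfun (of_real \<kappa>) + of_real r) * of_real \<kappa>
      = of_real ((1 - \<kappa>)^2 * (1 + \<kappa>) + 2 * r * \<kappa>)"
    by (simp add: J_kappa Zfun_kappa)
  moreover have "0 < (1 - \<kappa>)^2 * (1 + \<kappa>) + 2 * r * \<kappa>" using pos \<kappa> r by (intro add_pos_pos) auto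
  ultimately have ne: "J (of_real \<kappa>) + (Zfun (of_real \<kappa>) + of_real r) * of_real \<kappa> \<noteq> 0"
    by (simp only: of_real_eq_0_iff)
  have q: "quad analytic_on {of_real \<kappa>}" unfolding quad_def by (intro analytic_intros)
  have "Wfun analytic_on {of_real \<kappa>}"
    unfolding Wfun_def using ne r by (intro analytic_intros J Z q) auto
  moreover have "Wfun (of_real \<kappa>) \<notin> \<real>\<^sub>\<le>\<^sub>0"
    unfolding Wfun_kappa using w0_pos by simp
  ultimately show ?thesis by (intro analytic_intros) auto
qed

text \<open>\<open>\<sigma>(c) = (\<kappa> - c) \<surd>W(c)\<close> is a local coordinate at \<open>\<kappa>\<close> whose square is \<open>1 - z / r\<close> on
  the curve; the sign is fixed by \<open>Re (\<kappa> - c) > 0\<close>.\<close>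

lemma sigma_eq:
  assumes z: "norm z < r" and c: "c = tree_fun z" "c \<noteq> 0"
    and Re1: "0 < Re (2 * c * z + J c)" and Re2: "0 < Re (J c + (z + of_real r) * c)"
    and h: "norm (csqrt (Wfun c) - of_real h0) < h0 / 4"
  shows "(of_real \<kappa> - c) * csqrt (Wfun c) = csqrt (1 - z / of_real r)"
proof -
  define h where "h = csqrt (Wfun c)"
  define s where "s = csqrt (1 - z / of_real r)"
  have Z: "Zfun c = z" using Zfun_eqI[OF c(2) _ Re1] tree_fun_J[OF z] c by simp
  have ne: "J c + (z + of_real r) * c \<noteq> 0"
    using Re2 by (metis less_irrefl zero_complex.sel(1))
  have "((of_real \<kappa> - c) * h)^2 = - ((c - of_real \<kappa>)^2 * quad c) / (of_real r * (J c + (z + of_real r) * c))"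
    by (simp add: h_def power_mult_distrib Wfun_def Z power2_commute)
  also have "\<dots> = (of_real r - z) / of_real r"
    using tree_fun_quad[OF z] ne by (simp add: c(1)[symmetric]) (simp add: diff_divide_distrib)
  also have "\<dots> = s\<^sup>2" using r by (simp add: s_def field_simps)
  finally have "(of_real \<kappa> - c) * h = s \<or> (of_real \<kappa> - c) * h = - s" by (simp add: power2_eq_iff)
  moreover have "(of_real \<kappa> - c) * h \<noteq> - s"
  proof
    assume eq: "(of_real \<kappa> - c) * h = - s"
    have h0: "0 < h0" using h norm_ge_zero[of "csqrt (Wfun c) - of_real h0"] by linarith
    have "\<bar>Re (h - of_real h0)\<bar> < h0 / 4" "\<bar>Im (h - of_real h0)\<bar> < h0 / 4"
      using h abs_Re_le_cmod[of "h - of_real h0"] abs_Im_le_cmod[of "h - of_real h0"] by (auto simp: h_def)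
    hence Reh: "h0 / 2 < Re h" and Imh: "\<bar>Im h\<bar> < h0 / 2" by (auto simp: abs_if split: if_splits)
    have "0 < \<kappa> - Re c" using tree_fun_less[OF z] complex_Re_le_cmod[of c] c(1) by simp
    hence Rek: "0 < Re (of_real \<kappa> - c)" by simp
    \<comment> \<open>After multiplication by \<open>cnj h\<close> the left side has nonnegative
      real part, while that of the right side is -(Re s Re h + Im s Im h), negative because h is
      close to the positive number \<open>h0\<close> and |Im s| < Re s.\<close>
    have "(of_real \<kappa> - c) * (h * cnj h) = - s * cnj h" using eq by (metis mult.assoc)
    hence "Re ((of_real \<kappa> - c) * of_real (norm h ^ 2)) = Re (- s * cnj h)" by (simp only: complex_norm_square)
    hence "Re (of_real \<kappa> - c) * norm h ^ 2 = - (Re s * Re h + Im s * Im h)" by (simp add: mult.commute)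
    moreover have "0 \<le> Re (of_real \<kappa> - c) * norm h ^ 2" using Rek by simp
    moreover have "0 < Re s * Re h + Im s * Im h"
    proof -
      note s = sqrt_branch_deriv(4,5)[OF z, folded s_def]
      have "\<bar>Im s * Im h\<bar> \<le> Re s * (h0 / 2)"
        unfolding abs_mult using s Imh by (intro mult_mono) auto
      moreover have "Re s * (h0 / 2) < Re s * Re h" using s Reh by simp
      ultimately show ?thesis by linarith
    qed
    ultimately show False by linarith
  qed
  ultimately show ?thesis by (auto simp: h_def s_def)
qed

text \<open>The coordinate \<sigma> has derivative -sqrt \<open>w0\<close> at \<kappa>, hence a
  holomorphic local inverse g with \<open>tree_fun z\<close> = g(s), where s is the square root of 1
  - z / r. Then G = 1 / (1 - g), and the chain rule gives its derivative at 0.\<close>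

lemma forest_fun_near:
  obtains \<epsilon> e G where "0 < \<epsilon>" "0 < e" "G holomorphic_on ball 0 e"
    "deriv G 0 = - of_real (1 / (sqrt w0 * (1 - \<kappa>)^2))"
    "\<And>z. norm z < r \<Longrightarrow> norm (z - of_real r) < \<epsilon> \<Longrightarrow>
       norm (csqrt (1 - z / of_real r)) \<le> e / 2 \<and> forest_fun z = G (csqrt (1 - z / of_real r))"
proof -
  define k where "k = complex_of_real \<kappa>"
  define h where "h c = csqrt (Wfun c)" for c
  define h0 where "h0 = sqrt w0"
  have h0: "0 < h0" using w0_pos by (simp add: h0_def)
  have hk: "h k = of_real h0"
    unfolding h_def k_def Wfun_kappa h0_def using w0_pos by (simp add: csqrt_of_real)
  obtain e1 where e1: "0 < e1" "h holomorphic_on ball k e1"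
    using analytic_Wfun unfolding analytic_on_def h_def k_def by auto
  define S where "S = ball k e1 \<inter> ball 0 1"
  have kS: "k \<in> S" using e1 \<kappa> by (simp add: S_def k_def)
  have S: "open S" by (simp add: S_def open_Int)
  have hS: "h holomorphic_on S" using e1 holomorphic_on_subset by (auto simp: S_def)
  define \<sigma> where "\<sigma> c = (k - c) * h c" for c
  have \<sigma>S: "\<sigma> holomorphic_on S" unfolding \<sigma>_def by (intro holomorphic_intros hS)
  have "(\<sigma> has_field_derivative (- h k)) (at k)"
  proof -
    have "(h has_field_derivative deriv h k) (at k)" using hS S kS by (rule holomorphic_derivI)
    thus ?thesis unfolding \<sigma>_def by (auto intro!: derivative_eq_intros)
  qed
  hence d\<sigma>: "deriv \<sigma> k = - of_real h0" using hk DERIV_imp_deriv by fastforce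
  hence "deriv \<sigma> k \<noteq> 0" using h0 by simp
  then obtain e2 where e2: "0 < e2" "ball k e2 \<subseteq> S" "open (\<sigma> ` ball k e2)" "inj_on \<sigma> (ball k e2)"
    using has_complex_derivative_locally_invertible[OF \<sigma>S kS S] by blast
  have \<sigma>2: "\<sigma> holomorphic_on ball k e2" using \<sigma>S e2(2) holomorphic_on_subset by blast
  obtain g where g: "g holomorphic_on \<sigma> ` ball k e2"
      "\<And>c. c \<in> ball k e2 \<Longrightarrow> deriv \<sigma> c * deriv g (\<sigma> c) = 1" "\<And>c. c \<in> ball k e2 \<Longrightarrow> g (\<sigma> c) = c"
    using holomorphic_has_inverse[OF \<sigma>2 open_ball e2(4)] by blast
  have kb: "k \<in> ball k e2" using e2 by simp
  have \<sigma>k: "\<sigma> k = 0" by (simp add: \<sigma>_def)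
  have "0 \<in> \<sigma> ` ball k e2" using kb \<sigma>k by force
  then obtain e where e: "0 < e" "ball 0 e \<subseteq> \<sigma> ` ball k e2"
    using e2(3) open_contains_ball by blast
  define G where "G s = inverse (1 - g s)" for s
  have g_ne: "1 - g s \<noteq> 0" if s: "s \<in> ball 0 e" for s
  proof -
    obtain c where c: "c \<in> ball k e2" "s = \<sigma> c" using s e by blast
    hence "g s \<in> ball 0 1" using g(3) e2(2) by (auto simp: S_def)
    thus ?thesis by (rule ball_1_neq)
  qed
  have g_hol: "g holomorphic_on ball 0 e" using g(1) e(2) holomorphic_on_subset by blast
  have G_hol: "G holomorphic_on ball 0 e" unfolding G_def by (intro holomorphic_intros g_hol) (use g_ne in auto)
  have g0: "g 0 = k" using g(3)[OF kb] \<sigma>k by simp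
  have "deriv g 0 = inverse (deriv \<sigma> k)" using g(2)[OF kb] \<sigma>k by (simp add: inverse_unique)
  hence "deriv g 0 = - of_real (1 / h0)" unfolding d\<sigma> by (simp add: inverse_eq_divide)
  hence "(g has_field_derivative - of_real (1 / h0)) (at 0)"
    using holomorphic_derivI[OF g_hol open_ball, of 0] e by simp
  hence "(G has_field_derivative - of_real (1 / h0) * inverse ((1 - g 0)^2)) (at 0)"
    unfolding G_def using g_ne[of 0] e by (auto intro!: derivative_eq_intros simp: power2_eq_square)
  hence "deriv G 0 = - of_real (1 / h0) * inverse ((1 - k)^2)" unfolding g0 by (rule DERIV_imp_deriv)
  also have "\<dots> = - of_real (1 / (sqrt w0 * (1 - \<kappa>)^2))"
    by (simp add: k_def h0_def field_simps)
  finally have dG: "deriv G 0 = - of_real (1 / (sqrt w0 * (1 - \<kappa>)^2))" .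
  \<comment> \<open>Every hypothesis of \<open>sigma_eq\<close>, and membership in the balls used
    above, holds near r because \<open>tree_fun\<close> tends to \<kappa>.\<close>
  let ?F = "at (complex_of_real r) within ball 0 r"
  have lim: "(tree_fun \<longlongrightarrow> k) ?F" using tree_fun_tendsto by (simp add: k_def)
  have limz: "((\<lambda>z. z) \<longlongrightarrow> of_real r) ?F" by (rule tendsto_ident_at)
  have pos: "0 < (1 - \<kappa>)^2 * (1 + \<kappa>)" using \<kappa> by simp
  have limJ: "((\<lambda>z. J (tree_fun z)) \<longlongrightarrow> J k) ?F" unfolding J_def by (intro tendsto_intros lim)
  have lim1: "((\<lambda>z. Re (2 * tree_fun z * z + J (tree_fun z))) \<longlongrightarrow> Re (2 * k * of_real r + J k)) ?F"
    by (intro tendsto_intros lim limz limJ)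
  have val1: "Re (2 * k * of_real r + J k) = 2 * \<kappa> * r + (1 - \<kappa>)^2 * (1 + \<kappa>)"
    unfolding k_def J_kappa by (simp del: of_real_mult of_real_power of_real_add of_real_diff flip: of_real_mult of_real_add)
  have pos1: "0 < 2 * \<kappa> * r + (1 - \<kappa>)^2 * (1 + \<kappa>)" using pos \<kappa> r by (simp add: add_pos_pos)
  have ev1: "\<forall>\<^sub>F z in ?F. 0 < Re (2 * tree_fun z * z + J (tree_fun z))"
    by (rule order_tendstoD(1)[OF lim1[unfolded val1] pos1])
  have lim2: "((\<lambda>z. Re (J (tree_fun z) + (z + of_real r) * tree_fun z)) \<longlongrightarrow> Re (J k + (of_real r + of_real r) * k)) ?F"
    by (intro tendsto_intros lim limz limJ)
  have val2: "Re (J k + (of_real r + of_real r) * k) = (1 - \<kappa>)^2 * (1 + \<kappa>) + 2 * r * \<kappa>"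
    unfolding k_def J_kappa by (simp del: of_real_mult of_real_power of_real_add of_real_diff flip: of_real_mult of_real_add)
  have pos2: "0 < (1 - \<kappa>)^2 * (1 + \<kappa>) + 2 * r * \<kappa>" using pos \<kappa> r by (simp add: add_pos_pos)
  have ev2: "\<forall>\<^sub>F z in ?F. 0 < Re (J (tree_fun z) + (z + of_real r) * tree_fun z)"
    by (rule order_tendstoD(1)[OF lim2[unfolded val2] pos2])
  have "isCont h k" using hS S kS by (metis at_within_open continuous_on_eq_continuous_within holomorphic_on_imp_continuous_on)
  hence limh: "((\<lambda>z. h (tree_fun z)) \<longlongrightarrow> of_real h0) ?F" using isCont_tendsto_compose lim hk by fastforce
  have ev3: "\<forall>\<^sub>F z in ?F. norm (h (tree_fun z) - of_real h0) < h0 / 4"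
    using tendstoD[OF limh, of "h0 / 4"] h0 by (simp add: dist_norm)
  have ev4: "\<forall>\<^sub>F z in ?F. dist (tree_fun z) k < e2" using tendstoD[OF lim e2(1)] .
  have k0: "k \<noteq> 0" using \<kappa> by (simp add: k_def)
  have ev5: "\<forall>\<^sub>F z in ?F. tree_fun z \<noteq> 0" using tendsto_imp_eventually_ne[OF lim k0] .
  have "((\<lambda>z. sqrt (norm (1 - z / of_real r))) \<longlongrightarrow> sqrt (norm (1 - complex_of_real r / of_real r))) ?F"
    using r by (intro tendsto_intros limz) auto
  hence "((\<lambda>z. sqrt (norm (1 - z / of_real r))) \<longlongrightarrow> 0) ?F" using r by simp
  hence ev6: "\<forall>\<^sub>F z in ?F. sqrt (norm (1 - z / of_real r)) < e / 2"
    using e by (intro order_tendstoD(2)[where a = "e / 2"]) auto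
  have "\<forall>\<^sub>F z in ?F. norm z < r \<longrightarrow>
      norm (csqrt (1 - z / of_real r)) \<le> e / 2 \<and> forest_fun z = G (csqrt (1 - z / of_real r))"
    using ev1 ev2 ev3 ev4 ev5 ev6
  proof eventually_elim
    case (elim z)
    show ?case
    proof (intro impI conjI)
      assume z: "norm z < r"
      show ns: "norm (csqrt (1 - z / of_real r)) \<le> e / 2"
        using elim(6) by (simp add: norm_csqrt)
      have "\<sigma> (tree_fun z) = csqrt (1 - z / of_real r)"
        unfolding \<sigma>_def k_def h_def
        by (rule sigma_eq[OF z refl, where ?h0.0 = h0]) (use elim in \<open>auto simp: h_def\<close>)
      moreover have "tree_fun z \<in> ball k e2" using elim(4) by (simp add: dist_commute)
      ultimately have "g (csqrt (1 - z / of_real r)) = tree_fun z" using g(3) by metis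
      thus "forest_fun z = G (csqrt (1 - z / of_real r))"
        using fun_relations(1)[OF z] by (simp add: G_def)
    qed
  qed
  then obtain \<epsilon> where \<epsilon>: "0 < \<epsilon>" "\<And>z. z \<in> ball 0 r \<Longrightarrow> z \<noteq> of_real r \<Longrightarrow> dist z (of_real r) < \<epsilon> \<Longrightarrow> norm z < r \<longrightarrow>
      norm (csqrt (1 - z / of_real r)) \<le> e / 2 \<and> forest_fun z = G (csqrt (1 - z / of_real r))"
    unfolding eventually_at by metis
  show ?thesis
  proof (rule that[OF \<epsilon>(1) e(1) G_hol dG])
    fix z :: complex assume z: "norm z < r" "norm (z - of_real r) < \<epsilon>"
    have "z \<noteq> of_real r" using z r by auto
    thus "norm (csqrt (1 - z / of_real r)) \<le> e / 2 \<and> forest_fun z = G (csqrt (1 - z / of_real r))"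
      using \<epsilon>(2)[of z] z by (simp add: dist_norm)
  qed
qed

text \<open>The second derivative of the remainder R is bounded on two overlapping grounds: near r,
  R is (1 - z / r)^2 H(s); elsewhere \<open>forest_fun\<close> and the subtracted terms have bounded
  second derivatives separately. The limit is -G'(0) / (2 sqrt \<pi>).\<close>

theorem win_forests_tendsto:
  "(\<lambda>n. gf win_forests $ n * complex_of_real (r ^ n * real n powr (3/2))) \<longlonglongrightarrow>
     of_real (1 / (2 * sqrt w0 * (1 - \<kappa>)^2) / sqrt pi)"
proof -
  obtain \<epsilon> e G where near: "0 < \<epsilon>" "0 < e" "G holomorphic_on ball 0 e"
    "deriv G 0 = - of_real (1 / (sqrt w0 * (1 - \<kappa>)^2))"
    "\<And>z. norm z < r \<Longrightarrow> norm (z - of_real r) < \<epsilon> \<Longrightarrow>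
       norm (csqrt (1 - z / of_real r)) \<le> e / 2 \<and> forest_fun z = G (csqrt (1 - z / of_real r))"
    using forest_fun_near by blast
  obtain a2 a3 H where H: "H holomorphic_on ball 0 e"
    "\<And>s. s \<in> ball 0 e \<Longrightarrow> G s = G 0 + deriv G 0 * s + a2 * s\<^sup>2 + a3 * s ^ 3 + s ^ 4 * H s"
    using holomorphic_Taylor_4[OF near(3,2)] by blast
  define s where "s z = csqrt (1 - z / of_real r)" for z
  define R where "R = (\<lambda>z. forest_fun z - (G 0 + deriv G 0 * csqrt (1 - z / of_real r)
      + a2 * (1 - z / of_real r) + a3 * (1 - z / of_real r) * csqrt (1 - z / of_real r)))"
  define U where "U = ball 0 r \<inter> ball (complex_of_real r) \<epsilon>"
  have U: "open U" "U \<subseteq> ball 0 r" by (auto simp: U_def)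
  have Uz: "norm z < r" "norm (z - of_real r) < \<epsilon>" if "z \<in> U" for z
    using that by (auto simp: U_def dist_norm norm_minus_commute)
  obtain M1 where M1: "\<And>z. z \<in> U \<Longrightarrow> norm (deriv (deriv R) z) \<le> M1"
  proof (rule near_second_deriv_bound[OF r U H(1) near(2)])
    fix z assume z: "z \<in> U"
    show nle: "norm (csqrt (1 - z / of_real r)) \<le> e / 2" using near(5)[OF Uz[OF z]] by simp
    define t where "t = 1 - z / of_real r"
    define S where "S = csqrt t"
    have S2: "S\<^sup>2 = t" by (simp add: S_def)
    hence S3: "S ^ 3 = t * S" by (simp add: power3_eq_cube power2_eq_square)
    have S4: "S ^ 4 = t\<^sup>2" using S2 power_mult[of S 2 2] by simp
    have "S \<in> ball 0 e" using nle near(2) by (simp add: S_def t_def)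
    hence "forest_fun z = G 0 + deriv G 0 * S + a2 * t + a3 * (t * S) + t\<^sup>2 * H S"
      using H(2)[of S] near(5)[OF Uz[OF z]] unfolding S2 S3 S4 by (simp add: S_def t_def)
    thus "R z = (1 - z / of_real r)^2 * H (csqrt (1 - z / of_real r))"
      unfolding R_def t_def[symmetric] S_def[symmetric] by (simp add: mult.assoc)
  qed (use that in blast)
  obtain M2 where M2: "\<And>z. norm z < r \<Longrightarrow> \<epsilon> \<le> norm (z - of_real r) \<Longrightarrow> norm (deriv (deriv forest_fun) z) \<le> M2"
    using forest_fun_away_bound[OF near(1)] by blast
  \<comment> \<open>A lower bound for |s| when |z - r| \<ge> \<epsilon>. It controls the second
    derivatives of s and s^3, which are -1 / (4 r^2 s^3) and 3 / (4 r^2 s).\<close>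
  define m where "m = sqrt (\<epsilon> / r)"
  have m: "0 < m" using near(1) r by (simp add: m_def)
  define M3 where "M3 = M2 + norm (deriv G 0) * (1 / (4 * r^2 * m ^ 3)) + norm a3 * (3 / (4 * r^2 * m))"
  have away: "norm (deriv (deriv R) z) \<le> M3" if z: "norm z < r" "\<epsilon> \<le> norm (z - of_real r)" for z
  proof -
    have ds: "(s has_field_derivative - 1 / (2 * of_real r * s w)) (at w)" and s0: "s w \<noteq> 0"
      and s2: "1 - w / of_real r = s w ^ 2" if "w \<in> ball 0 r" for w
      using sqrt_branch_deriv[of w r] that unfolding s_def by auto
    have dL: "(forest_fun has_field_derivative deriv forest_fun w) (at w)" if "w \<in> ball 0 r" for w
      using holomorphic_forest_fun that by (intro holomorphic_derivI) auto
    have dL2: "(deriv forest_fun has_field_derivative deriv (deriv forest_fun) w) (at w)" if "w \<in> ball 0 r" for w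
      using holomorphic_deriv[OF holomorphic_forest_fun] that by (intro holomorphic_derivI) auto
    have dt: "((\<lambda>z. 1 - z / of_real r) has_field_derivative - 1 / of_real r) (at w)" for w :: complex
      using r by (auto intro!: derivative_eq_intros)
    have zb: "z \<in> ball 0 r" using z by simp
    let ?D = "\<lambda>w. deriv forest_fun w - (deriv G 0 * (- 1 / (2 * of_real r * s w)) + a2 * (- 1 / of_real r)
        + a3 * (- 3 / (2 * of_real r) * s w))"
    have R1: "(R has_field_derivative ?D w) (at w)" if w: "w \<in> ball 0 r" for w
    proof -
      have "((\<lambda>z. (1 - z / of_real r) * s z) has_field_derivative
          - 1 / of_real r * s w + - 1 / (2 * of_real r * s w) * (1 - w / of_real r)) (at w)"
        by (rule DERIV_mult[OF dt ds[OF w]])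
      also have "- 1 / of_real r * s w + - 1 / (2 * of_real r * s w) * (1 - w / of_real r) = - 3 / (2 * of_real r) * s w"
        unfolding s2[OF w] using s0[OF w] r by (simp add: field_simps power2_eq_square)
      finally have "((\<lambda>z. forest_fun z - (G 0 + deriv G 0 * s z + a2 * (1 - z / of_real r)
          + a3 * ((1 - z / of_real r) * s z))) has_field_derivative
          deriv forest_fun w - (0 + deriv G 0 * (- 1 / (2 * of_real r * s w)) + a2 * (- 1 / of_real r)
        + a3 * (- 3 / (2 * of_real r) * s w))) (at w)"
        by (intro DERIV_diff DERIV_add DERIV_cmult DERIV_const dL[OF w] ds[OF w] dt)
      thus ?thesis unfolding R_def s_def by (simp add: mult.assoc)
    qed
    have inv: "((\<lambda>w. - 1 / (2 * of_real r * s w)) has_field_derivative - (1 / (4 * of_real r ^ 2 * s z ^ 3))) (at z)"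
      using s0[OF zb] r
      by (auto intro!: derivative_eq_intros ds[OF zb] simp: field_simps power2_eq_square power3_eq_cube)
    have "(?D has_field_derivative deriv (deriv forest_fun) z - (deriv G 0 * (- (1 / (4 * of_real r ^ 2 * s z ^ 3))) + 0
        + a3 * (- 3 / (2 * of_real r) * (- 1 / (2 * of_real r * s z))))) (at z)"
      by (intro DERIV_diff DERIV_add DERIV_cmult DERIV_const dL2[OF zb] ds[OF zb] inv)
    hence "(deriv R has_field_derivative deriv (deriv forest_fun) z - (deriv G 0 * (- (1 / (4 * of_real r ^ 2 * s z ^ 3))) + 0
        + a3 * (- 3 / (2 * of_real r) * (- 1 / (2 * of_real r * s z))))) (at z)"
      by (rule has_field_derivative_transform_within_open[where S = "ball 0 r"])
        (use zb R1 DERIV_imp_deriv in \<open>force+\<close>)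
    hence "deriv (deriv R) z = deriv (deriv forest_fun) z - (deriv G 0 * (- (1 / (4 * of_real r ^ 2 * s z ^ 3))) + 0
        + a3 * (- 3 / (2 * of_real r) * (- 1 / (2 * of_real r * s z))))"
      by (rule DERIV_imp_deriv)
    also have "\<dots> = deriv (deriv forest_fun) z + deriv G 0 * (1 / (4 * of_real r ^ 2 * s z ^ 3))
        + - (a3 * (3 / (4 * of_real r ^ 2 * s z)))"
      by (simp add: power2_eq_square)
    finally have eq: "deriv (deriv R) z = \<dots>" .
    have ms: "m \<le> norm (s z)"
    proof -
      have "1 - z / of_real r = (of_real r - z) / of_real r" using r by (simp add: field_simps)
      hence "norm (1 - z / of_real r) = norm (z - of_real r) / r"
        using r by (simp add: norm_divide norm_minus_commute)
      hence "\<epsilon> / r \<le> norm (1 - z / of_real r)" using z r by (simp add: divide_right_mono)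
      thus ?thesis by (simp add: m_def s_def norm_csqrt)
    qed
    show ?thesis
      unfolding eq M3_def
    proof (intro norm_triangle_le add_mono)
      show "norm (deriv (deriv forest_fun) z) \<le> M2" by (rule M2[OF z])
      have "norm (1 / (4 * of_real r ^ 2 * s z ^ 3)) = 1 / (4 * r^2 * norm (s z) ^ 3)"
        using r by (simp add: norm_divide norm_mult norm_power)
      also have "\<dots> \<le> 1 / (4 * r^2 * m ^ 3)"
        using ms m r by (intro divide_left_mono mult_left_mono power_mono) (auto intro!: mult_pos_pos)
      finally show "norm (deriv G 0 * (1 / (4 * of_real r ^ 2 * s z ^ 3))) \<le> norm (deriv G 0) * (1 / (4 * r^2 * m ^ 3))"
        unfolding norm_mult by (rule mult_left_mono) simp
      have "norm (3 / (4 * of_real r ^ 2 * s z)) = 3 / (4 * r^2 * norm (s z))"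
        using r by (simp add: norm_divide norm_mult norm_power)
      also have "\<dots> \<le> 3 / (4 * r^2 * m)"
        using ms m r by (intro divide_left_mono mult_left_mono) (auto intro!: mult_pos_pos)
      finally show "norm (- (a3 * (3 / (4 * of_real r ^ 2 * s z)))) \<le> norm a3 * (3 / (4 * r^2 * m))"
        unfolding norm_minus_cancel norm_mult by (rule mult_left_mono) simp
    qed
  qed
  have "norm (deriv (deriv R) z) \<le> max M1 M3" if "z \<in> ball 0 r" for z
  proof (cases "z \<in> U")
    case True
    thus ?thesis using M1[OF True] by simp
  next
    case False
    hence "\<epsilon> \<le> norm (z - of_real r)" using that by (auto simp: U_def dist_norm norm_minus_commute)
    thus ?thesis using away[of z] that by auto
  qed
  from sqrt_singularity_transfer[OF r holomorphic_forest_fun forest_fun_expansion R_def this]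
  show ?thesis unfolding near(4) by (simp add: field_simps)
qed

end

subsection \<open>Asymptotics\<close>

lemma critical_point_root:
  assumes k: "0.52700329 < k" "k < 0.52700330" "critical_poly k = 0"
    and r: "r = k^2 * (1 + 3 * k) / (1 + k + 2 * k^2)"
  shows "critical_point k r"
proof -
  define b where "b = 1 + k + 2 * k^2"
  have b: "0 < b" using k by (simp add: b_def add_pos_nonneg)
  have rb: "r * b = k^2 * (1 + 3 * k)" using r b by (simp add: b_def)
  \<comment> \<open>With r b = k^2 (1 + 3k), the condition \<open>e2\<close> multiplied by b becomes
    this equation, and the difference of its sides is \<open>critical_poly k\<close>.\<close>
  have m: "k ^ 4 * (1 + 3 * k)^2 = b * ((1 - k) ^ 3 * (1 + k)^2)"
  proof -
    have "k ^ 4 * (1 + 3 * k)^2 - b * ((1 - k) ^ 3 * (1 + k)^2) = critical_poly k"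
      unfolding b_def critical_poly_def by algebra
    thus ?thesis using k(3) by simp
  qed
  have "b * (r^2 * b) = (r * b)^2" by (simp add: power2_eq_square)
  also have "\<dots> = k ^ 4 * (1 + 3 * k)^2" unfolding rb by algebra
  also have "\<dots> = b * ((1 - k) ^ 3 * (1 + k)^2)" by (rule m)
  finally have e2: "r^2 * b = (1 - k) ^ 3 * (1 + k)^2" using b by simp
  have "b * ((k - r) * ((1 - k)^2 * (1 + k))) = (k * b - r * b) * ((1 - k)^2 * (1 + k))" by algebra
  also have "\<dots> = k * ((1 - k) ^ 3 * (1 + k)^2)" unfolding rb unfolding b_def by algebra
  also have "\<dots> = b * (r^2 * k)" unfolding e2[symmetric] by simp
  finally have e1: "(k - r) * ((1 - k)^2 * (1 + k)) = r^2 * k" using b by simp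
  \<comment> \<open>Coarse bounds suffice for \<open>q0\<close>: r / k^2 exceeds 1, while the
    subtracted terms are at most 0.3 * 0.53 and 0.278.\<close>
  have k2: "0.277 < k^2" "k^2 < 0.278"
  proof -
    have "0.52700329\<^sup>2 < k^2" "k^2 < 0.52700330\<^sup>2" using k by (intro power_strict_mono; simp)+
    thus "0.277 < k^2" "k^2 < 0.278" by (simp_all add: power_divide)
  qed
  have "0.34 * b < 0.34 * 2.084" using k k2 by (simp add: b_def)
  also have "\<dots> < 0.277 * 2.58" by simp
  also have "\<dots> \<le> k^2 * (1 + 3 * k)" using k k2 by (intro mult_mono) auto
  finally have "0.34 * b < r * b" unfolding rb .
  hence r1: "0.34 < r" using b by simp
  have "r * b \<le> 0.278 * 2.582" unfolding rb using k k2 by (intro mult_mono) auto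
  also have "\<dots> < 0.35 * 2.08" by simp
  also have "\<dots> < 0.35 * b" using k k2 by (simp add: b_def)
  finally have r2: "r < 0.35" using b by simp
  show ?thesis
  proof
    show "0 < k" "k < 1" "0 < r" using k r1 by simp_all
    show "(k - r) * ((1 - k)^2 * (1 + k)) = r^2 * k" by (rule e1)
    show "r^2 * (1 + k + 2 * k^2) = (1 - k) ^ 3 * (1 + k)^2" using e2 by (simp add: b_def)
    show "2 * k < 1 + r" using k r1 by simp
    have "1 < r / k^2" using k k2 r1 by (subst pos_less_divide_eq) auto
    moreover have "(1 + r - 2 * k) * k \<le> 0.3 * 0.53" using k r1 r2 by (intro mult_mono) auto
    ultimately show "0 < r / k^2 - (1 + r - 2 * k) * k - k^2" using k2 by simp
  qed
qed

text \<open>The numerator n and the factor d in the denominator of \<open>w0\<close> are linear in r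
  apart from powers of \<kappa>, so multiplying each by b leaves r only in the product r b, which is
  a polynomial in \<kappa>. This gives the rational function treated in
  \<open>critical_gamma_sq_eq\<close>.\<close>

lemma (in critical_point) w0_gamma:
  assumes k: "critical_poly \<kappa> = 0" and rb: "r * (1 + \<kappa> + 2 * \<kappa>^2) = \<kappa>^2 * (1 + 3 * \<kappa>)"
  shows "(1 / (2 * sqrt w0 * (1 - \<kappa>)^2))^2 = critical_gamma_sq \<kappa>"
proof -
  define b where "b = 1 + \<kappa> + 2 * \<kappa>^2"
  define n where "n = r / \<kappa>^2 + (1 + r) * \<kappa> - 3 * \<kappa>^2"
  define d where "d = (1 - \<kappa>)^2 * (1 + \<kappa>) + 2 * r * \<kappa>"
  define p where "p = \<kappa>^2 * (1 + 3 * \<kappa>) * (1 + 5 * \<kappa> ^ 4 + 2 * \<kappa> ^ 5)"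
  have b: "0 < b" using \<kappa> by (simp add: b_def add_pos_nonneg)
  have rb: "r * b = \<kappa>^2 * (1 + 3 * \<kappa>)" using assms(2) by (simp add: b_def)
  have "n * b = r * b / \<kappa>^2 + \<kappa> * b + \<kappa> * (r * b) - 3 * \<kappa>^2 * b"
    by (simp add: n_def algebra_simps)
  also have "r * b / \<kappa>^2 = 1 + 3 * \<kappa>" unfolding rb using \<kappa> by simp
  also have "1 + 3 * \<kappa> + \<kappa> * b + \<kappa> * (r * b) - 3 * \<kappa>^2 * b = (1 - \<kappa>) * (1 + 5 * \<kappa> + 3 * \<kappa>^2 + 3 * \<kappa> ^ 3)"
    unfolding rb unfolding b_def by algebra
  finally have nb: "n * b = (1 - \<kappa>) * (1 + 5 * \<kappa> + 3 * \<kappa>^2 + 3 * \<kappa> ^ 3)" .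
  have "d * b = (1 - \<kappa>)^2 * (1 + \<kappa>) * b + 2 * \<kappa> * (r * b)" by (simp add: d_def algebra_simps)
  also have "\<dots> = 1 + 5 * \<kappa> ^ 4 + 2 * \<kappa> ^ 5" unfolding rb unfolding b_def by algebra
  finally have db: "d * b = 1 + 5 * \<kappa> ^ 4 + 2 * \<kappa> ^ 5" .
  have p: "p = (r * b) * (d * b)" unfolding rb db p_def by simp
  have d0: "0 < d" using \<kappa> r by (simp add: d_def add_pos_pos)
  have w: "w0 = n / (r * d)" by (simp add: w0_def n_def d_def)
  have "w0 * p = (n * b) * b" unfolding w p using d0 r by (simp add: field_simps)
  moreover have "critical_gamma_sq \<kappa> * (4 * (1 - \<kappa>) ^ 4 * ((n * b) * b)) = p"
  proof -
    have "critical_gamma_sq \<kappa> * (4 * (1 - \<kappa>) ^ 4 * ((n * b) * b))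
        = critical_gamma_sq \<kappa> * (4 * (1 - \<kappa>) ^ 5 * b * (1 + 5 * \<kappa> + 3 * \<kappa>^2 + 3 * \<kappa> ^ 3))"
      unfolding nb by algebra
    also have "\<dots> = p" unfolding b_def p_def by (rule critical_gamma_sq_eq[OF k])
    finally show ?thesis .
  qed
  ultimately have "critical_gamma_sq \<kappa> * (4 * (1 - \<kappa>) ^ 4 * w0) * p = 1 * p" by (metis mult.assoc mult_1)
  moreover have "p \<noteq> 0" unfolding p using r b d0 by simp
  ultimately have eq: "critical_gamma_sq \<kappa> * (4 * (1 - \<kappa>) ^ 4 * w0) = 1" by simp
  have "(2 * sqrt w0 * (1 - \<kappa>)^2)^2 = 4 * (1 - \<kappa>) ^ 4 * w0"
    using w0_pos by (simp add: power_mult_distrib)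
  hence "(1 / (2 * sqrt w0 * (1 - \<kappa>)^2))^2 = 1 / (4 * (1 - \<kappa>) ^ 4 * w0)" by (simp only: power_divide power_one)
  thus ?thesis using eq by (metis nonzero_eq_divide_eq mult_zero_right zero_neq_one)
qed

lemma Eeta_wins_asymptotics:
  "\<exists>\<rho> \<gamma> :: real. (\<forall>x. x > 0 \<and> growth_poly x = 0 \<longleftrightarrow> x = \<rho>) \<and> \<bar>\<rho> - 2.90511\<bar> < 0.000005 \<and>
     17348952064*\<gamma>^14 - 11927404544*\<gamma>^12 - 6678731520*\<gamma>^10 - 886278144*\<gamma>^8
         - 33824320*\<gamma>^6 - 516144*\<gamma>^4 + 4048*\<gamma>^2 + 11 = 0 \<and>
     \<bar>\<gamma> - 1.04240\<bar> < 0.000005 \<and>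
     (\<lambda>n. real (card (finite_lattice.Eeta_wins (Tam n))))
         \<sim>[at_top] (\<lambda>n. \<gamma> / sqrt pi * real n powr (-3/2) * \<rho> ^ n)"
proof -
  obtain k where k: "0.52700329 < k" "k < 0.52700330" "critical_poly k = 0" using ex_critical by blast
  define r where "r = k^2 * (1 + 3 * k) / (1 + k + 2 * k^2)"
  define \<rho> where "\<rho> = (1 + k + 2 * k^2) / (k^2 * (1 + 3 * k))"
  interpret critical_point k r using critical_point_root[OF k r_def] .
  have \<rho>r: "\<rho> = 1 / r" by (simp add: \<rho>_def r_def)
  have \<rho>0: "0 < \<rho>" using r by (simp add: \<rho>r)
  define \<gamma> where "\<gamma> = 1 / (2 * sqrt w0 * (1 - k)^2)"
  have \<gamma>0: "0 < \<gamma>" unfolding \<gamma>_def using w0_pos \<kappa> by simp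
  have b: "1 + k + 2 * k^2 \<noteq> 0" using \<kappa> by (smt (verit) zero_le_power2)
  have G: "\<gamma>\<^sup>2 = critical_gamma_sq k" unfolding \<gamma>_def using b by (intro w0_gamma k) (simp add: r_def)
  show ?thesis
  proof (intro exI conjI allI)
    fix x
    have root: "growth_poly \<rho> = 0" using growth_poly_root[OF k(3) \<kappa>(1) \<rho>_def] .
    show "(x > 0 \<and> growth_poly x = 0) \<longleftrightarrow> x = \<rho>"
      using growth_poly_unique[of x \<rho>] root \<rho>0 by auto
    show "\<bar>\<rho> - 2.90511\<bar> < 0.000005" using growth_bounds[OF k(1,2) \<rho>_def] .
    have "\<gamma> ^ (2 * j) = critical_gamma_sq k ^ j" for j unfolding G[symmetric] by (simp add: power_mult)
    from this[of 2] this[of 3] this[of 4] this[of 5] this[of 6] this[of 7] G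
    show "17348952064*\<gamma>^14 - 11927404544*\<gamma>^12 - 6678731520*\<gamma>^10 - 886278144*\<gamma>^8
         - 33824320*\<gamma>^6 - 516144*\<gamma>^4 + 4048*\<gamma>^2 + 11 = 0"
      using critical_gamma_sq_root[OF k(3)] by simp
    have "1.042395 < \<gamma>" "\<gamma> < 1.042405"
      using power_less_imp_less_base[OF critical_gamma_sq_bounds(1)[OF k(1,2), folded G]]
        power_less_imp_less_base[OF critical_gamma_sq_bounds(2)[OF k(1,2), folded G]] \<gamma>0
      by simp_all
    hence "\<gamma> - 1.04240 < 0.000005" "- (\<gamma> - 1.04240) < 0.000005" by simp_all
    thus "\<bar>\<gamma> - 1.04240\<bar> < 0.000005" by (simp only: abs_less_iff)
    define f where "f n = real (card (finite_lattice.Eeta_wins (Tam n)))" for n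
    have fc: "complex_of_real (f n) = gf win_forests $ n" for n
      using card_Eeta_wins_Tam_gf[of n, where 'a = complex] by (simp add: f_def)
    have "(\<lambda>n. complex_of_real (f n * (r ^ n * real n powr (3/2)))) \<longlonglongrightarrow> of_real (\<gamma> / sqrt pi)"
      using win_forests_tendsto unfolding fc[symmetric] \<gamma>_def[symmetric] of_real_mult[symmetric] .
    hence "(\<lambda>n. f n * (r ^ n * real n powr (3/2))) \<longlonglongrightarrow> \<gamma> / sqrt pi"
      by (simp only: tendsto_of_real_iff)
    hence "(\<lambda>n. f n * (r ^ n * real n powr (3/2)) / (\<gamma> / sqrt pi)) \<longlonglongrightarrow> (\<gamma> / sqrt pi) / (\<gamma> / sqrt pi)"
      using \<gamma>0 by (intro tendsto_divide tendsto_const) auto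
    hence lim: "(\<lambda>n. f n * (r ^ n * real n powr (3/2)) / (\<gamma> / sqrt pi)) \<longlonglongrightarrow> 1" using \<gamma>0 by simp
    have "f \<sim>[at_top] (\<lambda>n. \<gamma> / sqrt pi * real n powr (-3/2) * \<rho> ^ n)"
    proof (rule asymp_equivI', rule Lim_transform_eventually[OF lim])
      show "\<forall>\<^sub>F n in sequentially. f n * (r ^ n * real n powr (3/2)) / (\<gamma> / sqrt pi)
          = f n / (\<gamma> / sqrt pi * real n powr (-3/2) * \<rho> ^ n)"
        using eventually_gt_at_top[of 0]
      proof eventually_elim
        case (elim n)
        define x where "x = real n powr (3/2)"
        have x: "real n powr (-3/2) = 1 / x" by (simp add: x_def powr_minus_divide)
        show ?case unfolding x x_def[symmetric] using r by (simp add: \<rho>r power_divide field_simps)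
      qed
    qed
    thus "(\<lambda>n. real (card (finite_lattice.Eeta_wins (Tam n))))
         \<sim>[at_top] (\<lambda>n. \<gamma> / sqrt pi * real n powr (-3/2) * \<rho> ^ n)"
      unfolding f_def .
  qed
qed

theorem theorem1p10:
  shows "annihilates Q_poly Eeta_Tam_gf \<and>
    algebraic_of_degree Eeta_Tam_gf 4 \<and>
    (\<exists>\<rho> \<gamma> :: real.
       (\<forall>x. x > 0 \<and> 32*x^7 - 32*x^6 - 155*x^5 - 20*x^4 - 148*x^3 + 60*x^2 - 8*x - 4 = 0
          \<longleftrightarrow> x = \<rho>) \<and>
       \<bar>\<rho> - 2.90511\<bar> < 0.000005 \<and>
       17348952064*\<gamma>^14 - 11927404544*\<gamma>^12 - 6678731520*\<gamma>^10 - 886278144*\<gamma>^8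
         - 33824320*\<gamma>^6 - 516144*\<gamma>^4 + 4048*\<gamma>^2 + 11 = 0 \<and>
       \<bar>\<gamma> - 1.04240\<bar> < 0.000005 \<and>
       (\<lambda>n. real (card (finite_lattice.Eeta_wins (Tam n))))
         \<sim>[at_top] (\<lambda>n. \<gamma> / sqrt pi * real n powr (-3/2) * \<rho> ^ n))"
proof (intro conjI)
  show ann: "annihilates Q_poly Eeta_Tam_gf" by (rule annihilates_Q_poly)
  have "Eeta_Tam_gf $ 0 = 0" by (simp add: Eeta_Tam_gf_def)
  thus "algebraic_of_degree Eeta_Tam_gf 4"
    using ann by (rule algebraic_of_degree_4) (rule ann[unfolded annihilates_Q_poly_iff])
qed (rule Eeta_wins_asymptotics[unfolded growth_poly_def])

end
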